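(* Let $n\ge r\ge1$ and let $\mathcal{V}^0_{n,r}$ be the set of pointed vector configurations in $\mathbf{R}^{r\times n}$ in general position. Let $(\mathfrak{F}^*_{n,r})^0:=\operatorname{aff}\{f^*(V):V\in\mathcal{V}^0_{n,r}\}$. Then $\dim(\mathfrak{F}^*_{n,r})^0=\lfloor\frac{r-1}{2}\rfloor\lfloor\frac{n-r+1}{2}\rfloor$ and $$(\mathfrak{F}^*_{n,r})^0=f^*(V_0)+S(\mathfrak{G}^0_{n,r})$$ for any $V_0\in\mathcal{V}^0_{n,r}$, where $\mathfrak{G}^0_{n,r}$ is the space of real matrices $g=[g_{j,k}]_{0\le j\le r,0\le k\le n-r}$ satisfying $g_{j,k}=-g_{r-j,k}=-g_{j,n-r-k}=g_{r-j,n-r-k}$ for all $j,k$ and $g_{0,k}=0$ for all $k$, and $S=S_{n,r}$ is the injective linear map sending such a matrix $g$ to the matrix whose $(s,t)$ entry is the coefficient of $x^{n-s}y^t$ in $-\sum_{j,k}g_{j,k}(x+y)^k(x+1)^{n-r-k}y^j$.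
   Context: $[n]=\{1,\dots,n\}$. A vector configuration is a matrix $V=[v_1|\cdots|v_n]\in\mathbf{R}^{r\times n}$; it is in general position if any $r$ columns are linearly independent, and pointed if all columns lie in an open linear halfspace $\{x:\langle u,x\rangle>0\}$ for some $u\ne0$. For $F\in\{-1,0,+1\}^n$ let $F_+,F_0,F_-$ be the sets of $i$ with $F_i=+1,0,-1$. $\mathcal{F}^*(V)$ is the set of sign vectors $(\operatorname{sgn}\lambda_1,\dots,\operatorname{sgn}\lambda_n)$ over all nontrivial linear dependencies $\sum_i\lambda_iv_i=0$. The $f^*$-matrix $f^*(V)=[f^*_{s,t}(V)]$ has entries $f^*_{s,t}(V)=|\{F\in\mathcal{F}^*(V):|F_-|=t,|F_+|=s-t\}|$ (indices $0\le s\le n$, $0\le t\le n$). *)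

theory Defs
  imports "HOL-Analysis.Analysis" "HOL-Library.Function_Algebras"
    "HOL-Computational_Algebra.Polynomial"
begin

text \<open>Conventions. A vector configuration V in R^(r x n) is encoded as
  V :: nat => nat => real, where V j i is the i-th coordinate (i < r) of the
  column v_j (j < n; columns indexed 0..n-1 instead of 1..n). Entries outside
  the range are required to be 0. Real matrices indexed by pairs of naturals
  are encoded as nat => nat => real (zero outside the relevant index range).\<close>

type_synonym rmat = "nat \<Rightarrow> nat \<Rightarrow> real"

definition vconf :: "nat \<Rightarrow> nat \<Rightarrow> rmat \<Rightarrow> bool" where
  "vconf n r V \<longleftrightarrow> (\<forall>j i. (j \<ge> n \<or> i \<ge> r) \<longrightarrow> V j i = 0)"

definition general_position :: "nat \<Rightarrow> nat \<Rightarrow> rmat \<Rightarrow> bool" where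
  "general_position n r V \<longleftrightarrow>
     (\<forall>J. J \<subseteq> {..<n} \<and> card J = r \<longrightarrow>
        (\<forall>c :: nat \<Rightarrow> real. (\<forall>i<r. (\<Sum>j\<in>J. c j * V j i) = 0) \<longrightarrow> (\<forall>j\<in>J. c j = 0)))"

definition pointed :: "nat \<Rightarrow> nat \<Rightarrow> rmat \<Rightarrow> bool" where
  "pointed n r V \<longleftrightarrow>
     (\<exists>u :: nat \<Rightarrow> real. (\<exists>i<r. u i \<noteq> 0) \<and> (\<forall>j<n. (\<Sum>i<r. u i * V j i) > 0))"

definition V0_set :: "nat \<Rightarrow> nat \<Rightarrow> rmat set" where
  "V0_set n r = {V. vconf n r V \<and> general_position n r V \<and> pointed n r V}"

definition lin_dep :: "nat \<Rightarrow> nat \<Rightarrow> rmat \<Rightarrow> (nat \<Rightarrow> real) \<Rightarrow> bool" where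
  "lin_dep n r V lam \<longleftrightarrow> (\<forall>j\<ge>n. lam j = 0) \<and> (\<exists>j<n. lam j \<noteq> 0) \<and>
     (\<forall>i<r. (\<Sum>j<n. lam j * V j i) = 0)"

definition sign_vectors :: "nat \<Rightarrow> nat \<Rightarrow> rmat \<Rightarrow> (nat \<Rightarrow> real) set" where
  "sign_vectors n r V = {(\<lambda>j. sgn (lam j)) | lam. lin_dep n r V lam}"

definition pos_part :: "nat \<Rightarrow> (nat \<Rightarrow> real) \<Rightarrow> nat set" where
  "pos_part n F = {j. j < n \<and> F j = 1}"

definition neg_part :: "nat \<Rightarrow> (nat \<Rightarrow> real) \<Rightarrow> nat set" where
  "neg_part n F = {j. j < n \<and> F j = -1}"

text \<open>f^*_{s,t}(V) = #{F : |F_-| = t, |F_+| = s - t}; written |F_+| + t = s to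
  avoid truncated subtraction (entries with t > s are 0).\<close>
definition fstar :: "nat \<Rightarrow> nat \<Rightarrow> rmat \<Rightarrow> rmat" where
  "fstar n r V = (\<lambda>s t. real (card {F \<in> sign_vectors n r V.
        card (neg_part n F) = t \<and> card (pos_part n F) + t = s}))"

definition mscale :: "real \<Rightarrow> rmat \<Rightarrow> rmat" where
  "mscale c M = (\<lambda>s t. c * M s t)"

definition mat_affine_hull :: "rmat set \<Rightarrow> rmat set" where
  "mat_affine_hull S = {x. \<exists>F u. finite F \<and> F \<noteq> {} \<and> F \<subseteq> S \<and> sum u F = 1 \<and>
       x = (\<Sum>v\<in>F. mscale (u v) v)}"

definition mat_aff_dim :: "rmat set \<Rightarrow> nat" where
  "mat_aff_dim A = vector_space.dim mscale {x - y | x y. x \<in> A \<and> y \<in> A}"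

definition G0_space :: "nat \<Rightarrow> nat \<Rightarrow> rmat set" where
  "G0_space n r = {g. (\<forall>j k. (j > r \<or> k > n - r) \<longrightarrow> g j k = 0) \<and>
      (\<forall>j\<le>r. \<forall>k\<le>n-r. g j k = - g (r - j) k \<and> g j k = - g j (n - r - k) \<and>
                         g j k = g (r - j) (n - r - k)) \<and>
      (\<forall>k\<le>n-r. g 0 k = 0)}"

text \<open>The bivariate polynomial -\<Sum> g_{j,k} (x+y)^k (x+1)^(n-r-k) y^j, encoded as a
  polynomial in y whose coefficients are polynomials in x.\<close>
definition S_poly :: "nat \<Rightarrow> nat \<Rightarrow> rmat \<Rightarrow> real poly poly" where
  "S_poly n r g = - (\<Sum>j\<le>r. \<Sum>k\<le>n-r.
      smult [:g j k:] ([:[:0, 1:], 1:] ^ k * [:[:1, 1:]:] ^ (n - r - k) * monom 1 j))"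

definition S_map :: "nat \<Rightarrow> nat \<Rightarrow> rmat \<Rightarrow> rmat" where
  "S_map n r g = (\<lambda>s t. if s \<le> n \<and> t \<le> n then coeff (coeff (S_poly n r g) t) (n - s) else 0)"

end

theory Submission
  imports Defs
begin

text \<open>
  Encode \<open>f\<^sup>*(V)\<close> by \<open>f(x, y) = \<Sum>\<^sub>F x\<^bsup>|F\<^sub>0|\<^esup> y\<^bsup>|F\<^sub>-|\<^esup>\<close>, summed over the nonzero sign vectors of the
  \<open>(n - r)\<close>-dimensional space of dependencies. Expanding in powers of \<open>x + 1\<close> and \<open>y - 1\<close>, the coefficients
  are sums of Euler characteristics of open cones \<open>{F\<^sub>A = 0, F\<^sub>I < 0}\<close>; these are independent of \<open>V\<close> as
  soon as the cone is forced to be nonempty, that is for \<open>|A| + |I| \<le> n - r\<close>. The remaining monomials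
  are combinations of \<open>(x + y)\<^sup>k (x + 1)\<^bsup>n-r-k\<^esup> y\<^sup>j\<close>, so a difference of two f-polynomials comes from a
  unique matrix \<open>g\<close>. Its symmetries follow from \<open>F \<mapsto> -F\<close> and from Euler's relation for closed
  cells, \<open>f(-1-y-x, y) = (-1)\<^bsup>n-r+1\<^esup> f(x, y)\<close>; pointedness means \<open>f(x, 0) = 0\<close> and kills \<open>g\<^bsub>0,k\<^esub>\<close>.

  Conversely every basis element of the space of such \<open>g\<close> is realised by one mutation: start from a
  configuration with a single degenerate \<open>r\<close>-subset, whose circuit has \<open>j\<close> negative entries and whose
  hyperplane has \<open>k\<close> further vectors on its positive side, and push one vector to either side of it.
\<close>

section \<open>Sign vectors of uniform subspaces\<close>

text \<open>Two arbitrary configurations are compared by counting alone, not by joining them through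
  a chain of mutations. The counting runs over abstract subspaces of \<open>R^E\<close>, because
  setting coordinates to zero and forgetting a coordinate both stay within that class. A mutation
  yields a single basis element for this reason: only sign vectors that extend plus or minus the
  circuit can change, and those absent on a given side are described by independent conditions on
  the coordinates, so their weights sum to a product. The four products (two signs of the circuit,
  two sides) combine, up to sign, to (y^p - y^(r-p)) ((x+y)^k (x+1)^(M-k) - (x+y)^(M-k) (x+1)^k)
  with M = n - r. Pointedness is the delicate point of the construction: it rules out circuits of
  constant sign, in accordance with the vanishing of row 0 of \<open>g\<close>, and it dictates the
  size of the negative circuit entries.\<close>

definition wt :: "real \<Rightarrow> real \<Rightarrow> real \<Rightarrow> real" where
  "wt x y s = (if s = 0 then x else if s = -1 then y else 1)"

section \<open>Sums over product sets of signs\<close>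

definition choices :: "'a set \<Rightarrow> ('a \<Rightarrow> real set) \<Rightarrow> ('a \<Rightarrow> real) set" where
  "choices E S = {F. (\<forall>j\<in>E. F j \<in> S j) \<and> (\<forall>j. j \<notin> E \<longrightarrow> F j = 0)}"

lemma choices_insert:
  assumes "e \<notin> E"
  shows "choices (insert e E) S = (\<lambda>(s, F). F(e := s)) ` (S e \<times> choices E S)"
proof (intro equalityI subsetI)
  fix F assume F: "F \<in> choices (insert e E) S"
  have "F = (\<lambda>(s, F). F(e := s)) (F e, F(e := 0))" by simp
  moreover have "(F e, F(e := 0)) \<in> S e \<times> choices E S"
    using F assms by (auto simp: choices_def)
  ultimately show "F \<in> (\<lambda>(s, F). F(e := s)) ` (S e \<times> choices E S)" by blast
next
  fix F assume "F \<in> (\<lambda>(s, F). F(e := s)) ` (S e \<times> choices E S)"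
  then show "F \<in> choices (insert e E) S" using assms by (auto simp: choices_def)
qed

lemma finite_choices:
  assumes "finite E" "\<And>j. j \<in> E \<Longrightarrow> finite (S j)"
  shows "finite (choices E S)"
  using assms
proof (induction E rule: finite_induct)
  case empty
  have "choices {} S = {\<lambda>_. 0}" by (auto simp: choices_def)
  then show ?case by simp
qed (simp add: choices_insert)

text \<open>Distributivity: a set of sign vectors given by independent conditions on the coordinates
  has a product as its total weight. The explicit products below arise this way.\<close>

lemma sum_choices_prod:
  fixes h :: "'a \<Rightarrow> real \<Rightarrow> real"
  assumes "finite E"
  shows "(\<Sum>F\<in>choices E S. \<Prod>j\<in>E. h j (F j)) = (\<Prod>j\<in>E. \<Sum>s\<in>S j. h j s)"
  using assms
proof (induction E rule: finite_induct)
  case empty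
  have "choices {} S = {\<lambda>_. 0}" by (auto simp: choices_def)
  then show ?case by simp
next
  case (insert e E)
  have inj: "inj_on (\<lambda>(s, F). F(e := s)) (S e \<times> choices E S)"
  proof (rule inj_onI, clarify)
    fix s F s' F' assume a: "F \<in> choices E S" "F' \<in> choices E S" "F(e := s) = F'(e := s')"
    from a(3) have "s = s'" by (rule fun_upd_eqD)
    moreover have "F e = 0" "F' e = 0" using a insert.hyps by (auto simp: choices_def)
    then have "F = (F(e := s))(e := 0)" "F' = (F'(e := s'))(e := 0)" by auto
    ultimately show "s = s' \<and> F = F'" using a(3) by metis
  qed
  have "(\<Sum>F\<in>choices (insert e E) S. \<Prod>j\<in>insert e E. h j (F j))
      = (\<Sum>(s, F)\<in>S e \<times> choices E S. h e s * (\<Prod>j\<in>E. h j (F j)))"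
    unfolding choices_insert[OF insert.hyps(2)] sum.reindex[OF inj] using insert.hyps
    by (auto intro!: sum.cong prod.cong simp: split_def)
  also have "\<dots> = (\<Sum>s\<in>S e. h e s) * (\<Sum>F\<in>choices E S. \<Prod>j\<in>E. h j (F j))"
    by (simp add: sum.cartesian_product[symmetric] sum_product)
  finally show ?case using insert by simp
qed

section \<open>Signs under small perturbations and positive combinations\<close>

lemma sgn_perturb:
  fixes x y :: "'a \<Rightarrow> real"
  assumes "finite E"
  obtains d where "d > 0"
    "\<And>h j. \<bar>h\<bar> < d \<Longrightarrow> j \<in> E \<Longrightarrow> x j \<noteq> 0 \<Longrightarrow> sgn (x j + h * y j) = sgn (x j)"
proof -
  have "\<forall>\<^sub>F h in nhds 0. \<forall>j\<in>E. x j \<noteq> 0 \<longrightarrow> \<bar>h * y j\<bar> < \<bar>x j\<bar>"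
  proof (intro eventually_ball_finite assms ballI)
    fix j assume "j \<in> E"
    have "((\<lambda>h. \<bar>h * y j\<bar>) \<longlongrightarrow> \<bar>0 * y j\<bar>) (nhds 0)"
      by (intro tendsto_intros filterlim_ident)
    then show "\<forall>\<^sub>F h in nhds 0. x j \<noteq> 0 \<longrightarrow> \<bar>h * y j\<bar> < \<bar>x j\<bar>"
      by (cases "x j = 0") (auto dest: order_tendstoD(2)[where a="\<bar>x j\<bar>"])
  qed
  then obtain d where d: "d > 0" "\<And>h. dist h 0 < d \<Longrightarrow> \<forall>j\<in>E. x j \<noteq> 0 \<longrightarrow> \<bar>h * y j\<bar> < \<bar>x j\<bar>"
    unfolding eventually_nhds_metric by blast
  show thesis
  proof (rule that[OF d(1)])
    fix h j assume "\<bar>h\<bar> < d" "j \<in> E" "x j \<noteq> 0"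
    then have "\<bar>h * y j\<bar> < \<bar>x j\<bar>" using d(2)[of h] by simp
    then show "sgn (x j + h * y j) = sgn (x j)" by (auto simp: sgn_real_def split: if_splits)
  qed
qed

lemma sgn_pos_combination:
  fixes p q a b :: real
  assumes "sgn p = sgn q" "a > 0" "b > 0"
  shows "sgn (a * p + b * q) = sgn p"
proof (cases "p" "0::real" rule: linorder_cases)
  case less
  then have "q < 0" using assms(1) by (simp add: sgn_real_def split: if_splits)
  then have "a * p + b * q < 0" using less assms by (intro add_neg_neg mult_pos_neg)
  then show ?thesis using less by simp
next
  case equal
  then have "q = 0" using assms(1) by (simp add: sgn_real_def split: if_splits)
  then show ?thesis using equal by simp
next
  case greater
  then have "q > 0" using assms(1) by (simp add: sgn_real_def split: if_splits)
  then have "a * p + b * q > 0" using greater assms by (intro add_pos_pos mult_pos_pos)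
  then show ?thesis using greater by simp
qed

section \<open>Subspaces in general position and their minors\<close>

definition sgns :: "('a \<Rightarrow> real) set \<Rightarrow> ('a \<Rightarrow> real) set" where
  "sgns L = {(\<lambda>j. sgn (x j)) | x. x \<in> L \<and> x \<noteq> (\<lambda>_. 0)}"

lemma sgnsI: "x \<in> L \<Longrightarrow> x \<noteq> (\<lambda>_. 0) \<Longrightarrow> (\<And>j. F j = sgn (x j)) \<Longrightarrow> F \<in> sgns L"
  unfolding sgns_def by blast

lemma sgns_iff: "F \<in> sgns L \<longleftrightarrow> (\<exists>x\<in>L. x \<noteq> (\<lambda>_. 0) \<and> (\<forall>j. F j = sgn (x j)))"
  unfolding sgns_def by (auto simp: fun_eq_iff)

lemma sgnsE:
  assumes "F \<in> sgns L"
  obtains x where "x \<in> L" "x \<noteq> (\<lambda>_. 0)" "\<And>j. F j = sgn (x j)" "F \<noteq> (\<lambda>_. 0)"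
proof -
  from assms obtain x where x: "x \<in> L" "x \<noteq> (\<lambda>_. 0)" "F = (\<lambda>j. sgn (x j))"
    unfolding sgns_def by blast
  moreover have "F \<noteq> (\<lambda>_. 0)" using x(2,3) by (metis sgn_0_0)
  ultimately show thesis using that by blast
qed

text \<open>The space of linear dependencies of a configuration in general position: a subspace of
  \<open>\<real>\<^sup>E\<close> on which any \<open>M\<close> coordinates form a linear isomorphism onto \<open>\<real>\<^sup>M\<close>.\<close>
locale uniform_space =
  fixes E :: "'a set" and M :: nat and L :: "('a \<Rightarrow> real) set"
  assumes fin: "finite E"
    and M_le: "M \<le> card E"
    and lin: "x \<in> L \<Longrightarrow> y \<in> L \<Longrightarrow> (\<lambda>j. a * x j + b * y j) \<in> L"
    and supp: "x \<in> L \<Longrightarrow> j \<notin> E \<Longrightarrow> x j = 0"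
    and interp: "A \<subseteq> E \<Longrightarrow> card A = M \<Longrightarrow> \<exists>x\<in>L. \<forall>j\<in>A. x j = m j"
    and vanish: "A \<subseteq> E \<Longrightarrow> card A = M \<Longrightarrow> x \<in> L \<Longrightarrow> \<forall>j\<in>A. x j = 0 \<Longrightarrow> x = (\<lambda>_. 0)"
begin

lemma interp_le:
  assumes "A \<subseteq> E" "card A \<le> M"
  obtains x where "x \<in> L" "\<And>j. j \<in> A \<Longrightarrow> x j = m j"
proof -
  have "finite A" using assms fin finite_subset by blast
  obtain B where B: "B \<subseteq> E - A" "card B = M - card A"
  proof (rule obtain_subset_with_card_n)
    show "M - card A \<le> card (E - A)"
      using assms M_le fin \<open>finite A\<close> by (simp add: card_Diff_subset)
  qed
  have "card (A \<union> B) = M"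
    using B assms fin \<open>finite A\<close> by (subst card_Un_disjoint) (auto intro: finite_subset)
  then obtain x where "x \<in> L" "\<forall>j\<in>A \<union> B. x j = m j"
    using interp[of "A \<union> B" m] B assms by blast
  then show thesis using that by auto
qed

lemma zeros_less:
  assumes "x \<in> L" "x \<noteq> (\<lambda>_. 0)"
  shows "card {j\<in>E. x j = 0} < M"
proof (rule ccontr)
  assume "\<not> ?thesis"
  then obtain A where "A \<subseteq> {j\<in>E. x j = 0}" "card A = M"
    using obtain_subset_with_card_n[of M "{j\<in>E. x j = 0}"] by (auto simp: not_less)
  then show False using vanish[of A x] assms by blast
qed

lemma sgns_subset: "sgns L \<subseteq> choices E (\<lambda>_. {-1, 0, 1})"
  proof
  fix F assume "F \<in> sgns L"
  then obtain x where x: "x \<in> L" "\<And>j. F j = sgn (x j)" by (auto elim: sgnsE)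
  have "sgn t \<in> {-1, 0, 1}" for t :: real by (simp add: sgn_real_def)
  then show "F \<in> choices E (\<lambda>_. {-1, 0, 1})" using x supp by (auto simp: choices_def sgn_0_0)
qed

lemma finite_sgns: "finite (sgns L)"
  by (rule finite_subset[OF sgns_subset]) (auto intro: finite_choices fin)

text \<open>Fewer than \<open>M\<close> coordinates of \<open>x\<close> vanish, so some vector of
  \<open>L\<close> takes prescribed values on these zeros. A small multiple of it, added to
  \<open>x\<close>, sets the zero entries freely and keeps the other signs; hence zeros may be
  replaced by arbitrary signs.\<close>

lemma fill:
  assumes x: "x \<in> L" "x \<noteq> (\<lambda>_. 0)"
    and G: "G \<in> choices E (\<lambda>_. {-1, 0, 1})" "\<And>j. j \<in> E \<Longrightarrow> x j \<noteq> 0 \<Longrightarrow> G j = sgn (x j)"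
  shows "G \<in> sgns L"
proof -
  obtain v where v: "v \<in> L" "\<And>j. j \<in> {j\<in>E. x j = 0} \<Longrightarrow> v j = G j"
    using interp_le[of "{j\<in>E. x j = 0}" G] zeros_less[OF x] by auto
  obtain d where d: "d > 0"
    "\<And>h j. \<bar>h\<bar> < d \<Longrightarrow> j \<in> E \<Longrightarrow> x j \<noteq> 0 \<Longrightarrow> sgn (x j + h * v j) = sgn (x j)"
    using sgn_perturb[OF fin, where x=x and y=v] by blast
  define z where "z = (\<lambda>j. 1 * x j + (d/2) * v j)"
  have zL: "z \<in> L" unfolding z_def by (intro lin x v)
  have sg: "sgn (z j) = G j" for j
  proof (cases "j \<in> E")
    case True
    then show ?thesis
    proof (cases "x j = 0")
      case True
      then have "z j = (d/2) * G j" using v \<open>j \<in> E\<close> by (simp add: z_def)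
      moreover have "G j \<in> {-1, 0, 1}" using G \<open>j \<in> E\<close> by (auto simp: choices_def)
      ultimately show ?thesis using d(1) by (auto simp: sgn_mult)
    next
      case False
      then show ?thesis using d(1) d(2)[of "d/2" j] G(2)[of j] \<open>j \<in> E\<close> by (simp add: z_def)
    qed
  next
    case False
    then show ?thesis using supp[OF zL] G by (auto simp: choices_def)
  qed
  obtain j where j: "x j \<noteq> 0" using x by auto
  then have "j \<in> E" using supp x by blast
  then have "sgn (z j) = sgn (x j)" using j G(2) sg by auto
  then have "z \<noteq> (\<lambda>_. 0)" using j by (metis sgn_0 sgn_0_0)
  then show ?thesis using zL sg by (intro sgnsI[of z]) auto
qed

lemma fill_sgns:
  assumes "F \<in> sgns L" "G \<in> choices E (\<lambda>_. {-1, 0, 1})" "\<And>j. j \<in> E \<Longrightarrow> F j \<noteq> 0 \<Longrightarrow> G j = F j"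
  shows "G \<in> sgns L"
  using assms(1)
proof (rule sgnsE)
  fix x assume x: "x \<in> L" "x \<noteq> (\<lambda>_. 0)" "\<And>j. F j = sgn (x j)"
  show ?thesis by (rule fill[OF x(1,2) assms(2)]) (use assms(3) x(3) in \<open>auto simp: sgn_0_0\<close>)
qed

lemma restriction:
  assumes "A \<subseteq> E" "card A \<le> M"
  shows "uniform_space (E - A) (M - card A) {x\<in>L. \<forall>j\<in>A. x j = 0}"
proof
  have finA: "finite A" using assms fin finite_subset by blast
  show "finite (E - A)" using fin by simp
  show "M - card A \<le> card (E - A)" using assms M_le finA by (simp add: card_Diff_subset)
  show "\<And>x y a b. x \<in> {x \<in> L. \<forall>j\<in>A. x j = 0} \<Longrightarrow> y \<in> {x \<in> L. \<forall>j\<in>A. x j = 0} \<Longrightarrow>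
    (\<lambda>j. a * x j + b * y j) \<in> {x \<in> L. \<forall>j\<in>A. x j = 0}"
    using lin by auto
  show "\<And>x j. x \<in> {x \<in> L. \<forall>j\<in>A. x j = 0} \<Longrightarrow> j \<notin> E - A \<Longrightarrow> x j = 0"
    using supp by blast
  fix B assume B: "B \<subseteq> E - A" "card B = M - card A"
  then have "finite B" "A \<inter> B = {}" using fin finite_subset[of B E] by auto
  then have AB: "card (A \<union> B) = M" "A \<union> B \<subseteq> E"
    using assms B finA by (auto simp: card_Un_disjoint)
  show "\<exists>x\<in>{x \<in> L. \<forall>j\<in>A. x j = 0}. \<forall>j\<in>B. x j = m j" for m
    using interp[OF AB(2,1), of "\<lambda>j. if j \<in> A then 0 else m j"] B by fastforce
  show "\<And>x. x \<in> {x \<in> L. \<forall>j\<in>A. x j = 0} \<Longrightarrow> \<forall>j\<in>B. x j = 0 \<Longrightarrow> x = (\<lambda>_. 0)"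
    using vanish[OF AB(2,1)] by blast
qed

text \<open>Forgetting \<open>e\<close> is injective on \<open>L\<close>: by
  \<open>M < card E\<close>, the \<open>M\<close> coordinates that determine a vector can be chosen
  away from \<open>e\<close>. So the dimension stays \<open>M\<close>, whereas
  \<open>restriction\<close> lowers it.\<close>

lemma deletion:
  assumes "e \<in> E" "M < card E"
  shows "uniform_space (E - {e}) M ((\<lambda>x. x(e := 0)) ` L)"
proof
  show "finite (E - {e})" using fin by simp
  show "M \<le> card (E - {e})" using assms fin by simp
  show "\<And>x j. x \<in> (\<lambda>x. x(e := 0)) ` L \<Longrightarrow> j \<notin> E - {e} \<Longrightarrow> x j = 0"
    using supp by auto
  show "(\<lambda>j. a * x j + b * y j) \<in> (\<lambda>x. x(e := 0)) ` L"
    if xy: "x \<in> (\<lambda>x. x(e := 0)) ` L" "y \<in> (\<lambda>x. x(e := 0)) ` L" for x y a b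
  proof -
    obtain x' y' where "x' \<in> L" "y' \<in> L" "x = x'(e := 0)" "y = y'(e := 0)" using xy by blast
    then show ?thesis by (intro image_eqI[where x="\<lambda>j. a * x' j + b * y' j"]) (auto intro: lin)
  qed
  fix B assume B: "B \<subseteq> E - {e}" "card B = M"
  show "\<exists>x\<in>(\<lambda>x. x(e := 0)) ` L. \<forall>j\<in>B. x j = m j" for m
    using interp[of B m] B by fastforce
  show "x = (\<lambda>_. 0)" if x: "x \<in> (\<lambda>x. x(e := 0)) ` L" "\<forall>j\<in>B. x j = 0" for x
  proof -
    obtain x' where x': "x' \<in> L" "x = x'(e := 0)" using x by blast
    have "x' j = 0" if "j \<in> B" for j
      using x(2) x'(2) B that by (metis Diff_iff fun_upd_apply insertI1 subsetD)
    then have "\<forall>j\<in>B. x' j = 0" by blast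
    then have "x' = (\<lambda>_. 0)" using vanish[of B x'] B x' by blast
    then show ?thesis using x' by auto
  qed
qed

text \<open>Coordinate \<open>e\<close> is a hyperplane that either meets the cell of
  \<open>F\<close> or misses it. If it meets the cell, both sides occur by filling the zero at
  \<open>e\<close>; conversely, points on both sides produce one on the hyperplane by
  convexity.\<close>

lemma deletion_fibre:
  assumes e: "e \<in> E" "M < card E" and F: "F \<in> sgns ((\<lambda>x. x(e := 0)) ` L)"
  shows "{s. F(e := s) \<in> sgns L} \<in> {{1}, {-1}, {-1, 0, 1}}"
proof -
  let ?S = "{s. F(e := s) \<in> sgns L}"
  have sub: "?S \<subseteq> {-1, 0, 1}"
  proof
    fix s assume "s \<in> ?S"
    then have "F(e := s) \<in> choices E (\<lambda>_. {-1, 0, 1})" using sgns_subset by blast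
    then show "s \<in> {-1, 0, 1}" using e by (auto simp: choices_def)
  qed
  obtain x where x: "x \<in> L" "x(e := 0) \<noteq> (\<lambda>_. 0)" "\<And>j. F j = sgn ((x(e := 0)) j)"
    and F0: "F \<noteq> (\<lambda>_. 0)"
    using F by (elim sgnsE) auto
  have Fe: "F e = 0" using x by simp
  have "x \<noteq> (\<lambda>_. 0)" using x(2) by auto
  then have "F(e := sgn (x e)) \<in> sgns L" using x(1,3) by (intro sgnsI[of x]) auto
  then have ne: "?S \<noteq> {}" by blast
  have zero: "1 \<in> ?S \<and> -1 \<in> ?S" if "0 \<in> ?S"
  proof -
    have F': "F(e := 0) \<in> sgns L" using that by simp
    then have "F(e := 0) \<in> choices E (\<lambda>_. {-1, 0, 1})" using sgns_subset by blast
    then have "F(e := s) \<in> sgns L" if "s \<in> {-1, 1}" for s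
      using that e by (intro fill_sgns[OF F']) (auto simp: choices_def split: if_splits)
    then show ?thesis by auto
  qed
  have conv: "0 \<in> ?S" if both: "1 \<in> ?S" "-1 \<in> ?S"
  proof -
    obtain p where p: "p \<in> L" "\<And>j. (F(e := 1)) j = sgn (p j)"
      using both unfolding mem_Collect_eq sgns_iff by blast
    obtain q where q: "q \<in> L" "\<And>j. (F(e := -1)) j = sgn (q j)"
      using both unfolding mem_Collect_eq sgns_iff by blast
    have pe: "p e > 0" using p(2)[of e] by (simp add: sgn_real_def split: if_splits)
    have qe: "q e < 0" using q(2)[of e] by (simp add: sgn_real_def split: if_splits)
    \<comment> \<open>Both weights are positive, so the signs away from \<open>e\<close> survive,
      and they are chosen so that the combination cancels at \<open>e\<close>.\<close>
    define z where "z = (\<lambda>j. (- q e) * p j + p e * q j)"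
    have zL: "z \<in> L" unfolding z_def by (intro lin p q)
    have sg: "(F(e := 0)) j = sgn (z j)" for j
    proof (cases "j = e")
      case True then show ?thesis by (simp add: z_def)
    next
      case False
      then have "sgn (p j) = F j" "sgn (q j) = F j" using p(2)[of j] q(2)[of j] by auto
      then have "sgn (p j) = F j" "sgn (q j) = sgn (p j)" by auto
      moreover have "sgn (z j) = sgn (p j)"
        unfolding z_def using pe qe calculation(2) by (intro sgn_pos_combination) auto
      ultimately show ?thesis using False by simp
    qed
    have "z \<noteq> (\<lambda>_. 0)"
    proof
      assume "z = (\<lambda>_. 0)"
      then have "F(e := 0) = (\<lambda>_. 0)" using sg by auto
      then show False using F0 Fe by (metis fun_upd_triv)
    qed
    then show ?thesis using zL sg by (auto intro: sgnsI[of z])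
  qed
  show ?thesis using sub ne zero conv by auto
qed

end

text \<open>The Euler characteristic of an open cone cut out by coordinate hyperplanes. Deleting a coordinate
  outside \<open>I\<close> replaces each fibre by one face of the same weight, since \<open>1 + 1 - 1 = 1\<close>.\<close>
lemma region_sum:
  assumes "uniform_space E M L" "I \<subseteq> E" "\<And>i. i \<in> I \<Longrightarrow> \<sigma> i \<noteq> 0"
    and "x0 \<in> L" "\<And>i. i \<in> I \<Longrightarrow> sgn (x0 i) = \<sigma> i"
  shows "(\<Sum>F | F \<in> sgns L \<and> (\<forall>i\<in>I. F i = \<sigma> i). \<Prod>j\<in>E. wt (-1) 1 (F j))
       = 1 - (if I = {} then (-1)^M else 0)"
  using assms(1,2,4,5)
proof (induction "card E" arbitrary: E L x0 rule: less_induct)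
  case less
  interpret uniform_space E M L by (rule less.prems)
  have \<sigma>: "\<sigma> i \<in> {-1, 1}" if "i \<in> I" for i
    using less.prems(4)[OF that] assms(3)[OF that] by (auto simp: sgn_real_def split: if_splits)
  consider (all) "card E = M" | (full) "M < card E" "E = I" | (del) e where "M < card E" "e \<in> E - I"
    using M_le less.prems(2) by fastforce
  then show ?case
  proof cases
    case all
    \<comment> \<open>Here \<open>L\<close> is all of R^E, so the signs off \<open>I\<close> are
      free and every factor of the product is 1. Only the zero vector is lacking in
      \<open>sgns\<close>; it satisfies the constraints exactly for \<open>I = {}\<close> and has
      weight (-1)^M.\<close>
    define S where "S = (\<lambda>i. if i \<in> I then {\<sigma> i} else {-1, 0, 1})"
    have fin_ch: "finite (choices E S)" by (intro finite_choices fin) (auto simp: S_def)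
    have set_eq: "{F. F \<in> sgns L \<and> (\<forall>i\<in>I. F i = \<sigma> i)} = choices E S - {\<lambda>_. 0}"
    proof (intro equalityI subsetI)
      fix F assume F: "F \<in> {F. F \<in> sgns L \<and> (\<forall>i\<in>I. F i = \<sigma> i)}"
      then have "F \<noteq> (\<lambda>_. 0)" by (auto elim: sgnsE)
      moreover have "F \<in> choices E (\<lambda>_. {-1, 0, 1})" using sgns_subset F by blast
      ultimately show "F \<in> choices E S - {\<lambda>_. 0}" using F by (auto simp: choices_def S_def)
    next
      fix F assume F: "F \<in> choices E S - {\<lambda>_. 0}"
      have F': "F j \<in> {-1, 0, 1}" if "j \<in> E" for j
      proof (cases "j \<in> I")
        case True then show ?thesis using F \<sigma>[of j] that by (auto simp: choices_def S_def)
      next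
        case False then show ?thesis using F that by (auto simp: choices_def S_def)
      qed
      obtain x where x: "x \<in> L" "\<forall>j\<in>E. x j = F j" using interp[of E F] all by blast
      have "F j = x j" for j using x supp[OF x(1), of j] F by (cases "j \<in> E") (auto simp: choices_def)
      then have Fx: "F = x" by auto
      have "F j = sgn (F j)" for j using F'[of j] supp[OF x(1), of j] Fx by (cases "j \<in> E") auto
      then have "F \<in> sgns L" using F x Fx by (intro sgnsI[of x]) auto
      moreover have "F i = \<sigma> i" if "i \<in> I" for i
      proof -
        have "F i \<in> S i" using F that less.prems(2) by (auto simp: choices_def)
        then show ?thesis by (simp add: S_def that)
      qed
      ultimately show "F \<in> {F. F \<in> sgns L \<and> (\<forall>i\<in>I. F i = \<sigma> i)}"
        by blast
    qed
    have zero: "(\<lambda>_. 0) \<in> choices E S \<longleftrightarrow> I = {}"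
      using assms(3) less.prems(2) by (fastforce simp: choices_def S_def)
    have "(\<Sum>F\<in>choices E S. \<Prod>j\<in>E. wt (-1) 1 (F j)) = (\<Prod>j\<in>E. \<Sum>s\<in>S j. wt (-1) 1 s)"
      by (rule sum_choices_prod[OF fin])
    also have "\<dots> = 1"
    proof (intro prod.neutral ballI)
      show "(\<Sum>s\<in>S j. wt (-1) 1 s) = 1" for j
        using \<sigma>[of j] by (cases "j \<in> I") (auto simp: S_def wt_def)
    qed
    finally have tot: "(\<Sum>F\<in>choices E S. \<Prod>j\<in>E. wt (-1) 1 (F j)) = 1" .
    show ?thesis unfolding set_eq using fin_ch zero all tot
      by (auto simp: sum_diff1 wt_def)
  next
    case full
    \<comment> \<open>All signs are prescribed, so the region is the single cell of
      \<open>x0\<close>, which has no zero entry on \<open>E\<close>.\<close>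
    have "card I > 0" using full by simp
    then have ne: "I \<noteq> {}" by auto
    have x0: "x0 \<noteq> (\<lambda>_. 0)" using ne assms(3) less.prems(4) by fastforce
    have set_eq: "{F. F \<in> sgns L \<and> (\<forall>i\<in>I. F i = \<sigma> i)} = {\<lambda>j. sgn (x0 j)}"
    proof (intro equalityI subsetI)
      fix F assume F: "F \<in> {F. F \<in> sgns L \<and> (\<forall>i\<in>I. F i = \<sigma> i)}"
      have "F \<in> choices E (\<lambda>_. {-1, 0, 1})" using sgns_subset F by blast
      then have "F j = sgn (x0 j)" for j
        using F full less.prems(4)[of j] supp[OF less.prems(3), of j]
        by (cases "j \<in> E") (auto simp: choices_def)
      then show "F \<in> {\<lambda>j. sgn (x0 j)}" by auto
    next
      fix F assume "F \<in> {\<lambda>j. sgn (x0 j)}"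
      then show "F \<in> {F. F \<in> sgns L \<and> (\<forall>i\<in>I. F i = \<sigma> i)}"
        using x0 less.prems by (auto intro: sgnsI[of x0])
    qed
    have "(\<Prod>j\<in>E. wt (-1) 1 (sgn (x0 j))) = 1"
    proof (intro prod.neutral ballI)
      fix j assume "j \<in> E"
      then show "wt (-1) 1 (sgn (x0 j)) = 1"
        using \<sigma>[of j] full less.prems(4)[of j] by (auto simp: wt_def)
    qed
    then show ?thesis unfolding set_eq using ne by simp
  next
    case del
    let ?L = "(\<lambda>x. x(e := 0)) ` L"
    let ?X = "{F. F \<in> sgns L \<and> (\<forall>i\<in>I. F i = \<sigma> i)}"
    let ?Y = "{F. F \<in> sgns ?L \<and> (\<forall>i\<in>I. F i = \<sigma> i)}"
    have e: "e \<in> E" "e \<notin> I" using del by auto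
    interpret D: uniform_space "E - {e}" M ?L by (rule deletion[OF e(1) del(1)])
    have IH: "(\<Sum>F\<in>?Y. \<Prod>j\<in>E - {e}. wt (-1) 1 (F j)) = 1 - (if I = {} then (-1)^M else 0)"
      using e less.prems fin
      by (intro less.hyps[of "E - {e}" ?L "x0(e := 0)"] D.uniform_space_axioms) 
        (auto simp: card_Diff1_less simp del: card_Diff_insert card_Diff_singleton)
    have maps: "(\<lambda>F. F(e := 0)) ` ?X \<subseteq> ?Y"
    proof (intro image_subsetI CollectI conjI ballI)
      fix F assume F': "F \<in> ?X"
      then have F: "F \<in> sgns L" "\<forall>i\<in>I. F i = \<sigma> i" by auto
      show "(F(e := 0)) i = \<sigma> i" if "i \<in> I" for i using that F(2) e by auto
      obtain x where x: "x \<in> L" "x \<noteq> (\<lambda>_. 0)" "\<And>j. F j = sgn (x j)" using F(1) unfolding sgns_iff by blast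
      have "x(e := 0) \<noteq> (\<lambda>_. 0)"
      proof
        assume 0: "x(e := 0) = (\<lambda>_. 0)"
        have "M \<le> card (E - {e})" by (rule D.M_le)
        then obtain A where A: "A \<subseteq> E - {e}" "card A = M"
          by (rule obtain_subset_with_card_n)
        have "x j = 0" if "j \<in> A" for j
          using that A fun_cong[OF 0, of j] by (auto split: if_splits)
        then show False using vanish[of A x] A x by blast
      qed
      then show "F(e := 0) \<in> sgns ?L" using x by (intro sgnsI[of "x(e := 0)"]) auto
    qed
    have fibre: "(\<Sum>F\<in>{F\<in>?X. F(e := 0) = G}. \<Prod>j\<in>E. wt (-1) 1 (F j))
        = (\<Prod>j\<in>E - {e}. wt (-1) 1 (G j))" if G: "G \<in> ?Y" for G
    proof -
      have Ge: "G e = 0" using G D.sgns_subset by (auto simp: choices_def)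
      let ?S = "{s. G(e := s) \<in> sgns L}"
      have set_eq: "{F\<in>?X. F(e := 0) = G} = (\<lambda>s. G(e := s)) ` ?S"
      proof (intro equalityI subsetI)
        fix F assume F: "F \<in> {F\<in>?X. F(e := 0) = G}"
        then show "F \<in> (\<lambda>s. G(e := s)) ` ?S" by (intro image_eqI[of _ _ "F e"]) auto
      next
        fix F assume "F \<in> (\<lambda>s. G(e := s)) ` ?S"
        then obtain s where "F = G(e := s)" "G(e := s) \<in> sgns L" by blast
        then show "F \<in> {F\<in>?X. F(e := 0) = G}" using G e Ge by (auto simp: fun_upd_idem)
      qed
      have inj: "inj_on (\<lambda>s. G(e := s)) ?S" by (auto intro!: inj_onI dest: fun_upd_eqD)
      have split: "(\<Prod>j\<in>E. wt (-1) 1 ((G(e := s)) j)) = wt (-1) 1 s * (\<Prod>j\<in>E - {e}. wt (-1) 1 (G j))" for s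
        using e fin by (subst prod.remove[of E e]) (auto intro!: prod.cong)
      have "(\<Sum>F\<in>{F\<in>?X. F(e := 0) = G}. \<Prod>j\<in>E. wt (-1) 1 (F j))
          = (\<Sum>s\<in>?S. \<Prod>j\<in>E. wt (-1) 1 ((G(e := s)) j))"
        unfolding set_eq by (simp only: sum.reindex[OF inj] o_def)
      also have "\<dots> = (\<Sum>s\<in>?S. wt (-1) 1 s) * (\<Prod>j\<in>E - {e}. wt (-1) 1 (G j))"
        unfolding split sum_distrib_right ..
      finally have "(\<Sum>F\<in>{F\<in>?X. F(e := 0) = G}. \<Prod>j\<in>E. wt (-1) 1 (F j))
          = (\<Sum>s\<in>?S. wt (-1) 1 s) * (\<Prod>j\<in>E - {e}. wt (-1) 1 (G j))" .
      moreover have "?S \<in> {{1}, {-1}, {-1, 0, 1}}"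
        using G by (intro deletion_fibre e del) auto
      then have "(\<Sum>s\<in>?S. wt (-1) 1 s) = 1"
        by (elim insertE emptyE) (simp_all only:, simp_all add: wt_def)
      ultimately show ?thesis by simp
    qed
    have "(\<Sum>F\<in>?X. \<Prod>j\<in>E. wt (-1) 1 (F j))
        = (\<Sum>G\<in>?Y. \<Sum>F\<in>{F\<in>?X. F(e := 0) = G}. \<Prod>j\<in>E. wt (-1) 1 (F j))"
      by (rule sum.group[symmetric, OF _ _ maps]) (use finite_sgns D.finite_sgns in auto)
    also have "\<dots> = (\<Sum>F\<in>?Y. \<Prod>j\<in>E - {e}. wt (-1) 1 (F j))" by (intro sum.cong refl fibre)
    finally show ?thesis using IH by simp
  qed
qed

text \<open>The polynomial \<open>\<Sum>\<^sub>F x\<^bsup>|F\<^sub>0|\<^esup> y\<^bsup>|F\<^sub>-|\<^esup>\<close> encoding the f*-matrix.\<close>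
definition fpoly :: "'a set \<Rightarrow> ('a \<Rightarrow> real) set \<Rightarrow> real \<Rightarrow> real \<Rightarrow> real" where
  "fpoly E L x y = (\<Sum>F\<in>sgns L. \<Prod>j\<in>E. wt x y (F j))"

text \<open>Up to sign an Euler characteristic counted by cells: the cell of \<open>F\<close> has
  dimension \<open>M\<close> minus the number of zeros of \<open>F\<close>, and the origin is left
  out.\<close>

definition ecoef :: "'a set \<Rightarrow> ('a \<Rightarrow> real) set \<Rightarrow> 'a set \<Rightarrow> 'a set \<Rightarrow> real" where
  "ecoef E L A I = (\<Sum>F | F \<in> sgns L \<and> (\<forall>j\<in>A. F j = 0) \<and> (\<forall>j\<in>I. F j = -1).
     \<Prod>j\<in>E - A. wt (-1) 1 (F j))"

lemma prod_if_const:
  assumes "finite A"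
  shows "(\<Prod>j\<in>A. if P j then c else (0::real)) = (if \<forall>j\<in>A. P j then c ^ card A else 0)"
  using assms by (induction A rule: finite_induct) auto

lemma (in uniform_space) fpoly_expand:
  "fpoly E L (z - 1) (1 - w)
     = (\<Sum>A\<in>Pow E. \<Sum>I\<in>Pow (E - A). z ^ card A * (- w) ^ card I * ecoef E L A I)"
proof -
  have trm: "(\<Prod>j\<in>E. wt (z - 1) (1 - w) (F j))
     = (\<Sum>A\<in>Pow E. \<Sum>I\<in>Pow (E - A). z ^ card A * (- w) ^ card I *
          (if (\<forall>j\<in>A. F j = 0) \<and> (\<forall>j\<in>I. F j = -1) then \<Prod>j\<in>E - A. wt (-1) 1 (F j) else 0))"
    for F :: "'a \<Rightarrow> real"
  proof -
    \<comment> \<open>Each weight is its value at x = -1, y = 1 plus a correction for each of the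
      signs 0 and -1. In the expanded product \<open>A\<close> and \<open>I\<close> collect the
      coordinates where a correction is picked.\<close>
    have "(\<Prod>j\<in>E. wt (z - 1) (1 - w) (F j))
        = (\<Prod>j\<in>E. (if F j = 0 then z else 0) + ((if F j = -1 then -w else 0) + wt (-1) 1 (F j)))"
      by (intro prod.cong) (auto simp: wt_def)
    also have "\<dots> = (\<Sum>A\<in>Pow E. \<Sum>I\<in>Pow (E - A). (\<Prod>j\<in>A. if F j = 0 then z else 0) *
        ((\<Prod>j\<in>I. if F j = -1 then -w else 0) * (\<Prod>j\<in>E - A - I. wt (-1) 1 (F j))))"
      by (simp add: prod_add fin sum_distrib_left)
    also have "\<dots> = (\<Sum>A\<in>Pow E. \<Sum>I\<in>Pow (E - A). z ^ card A * (- w) ^ card I *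
          (if (\<forall>j\<in>A. F j = 0) \<and> (\<forall>j\<in>I. F j = -1) then \<Prod>j\<in>E - A. wt (-1) 1 (F j) else 0))"
    proof (intro sum.cong refl)
      fix A I assume AI: "A \<in> Pow E" "I \<in> Pow (E - A)"
      then have f: "finite A" "finite I" using fin finite_subset[of I E] finite_subset[of A E] by auto
      have "(\<Prod>j\<in>E - A. wt (-1) 1 (F j)) = (\<Prod>j\<in>E - A - I. wt (-1) 1 (F j))" if "\<forall>j\<in>I. F j = -1"
        using AI fin that by (subst prod.subset_diff[of I]) (auto simp: wt_def)
      then show "(\<Prod>j\<in>A. if F j = 0 then z else 0) *
        ((\<Prod>j\<in>I. if F j = -1 then -w else 0) * (\<Prod>j\<in>E - A - I. wt (-1) 1 (F j))) = 
         z ^ card A * (- w) ^ card I *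
          (if (\<forall>j\<in>A. F j = 0) \<and> (\<forall>j\<in>I. F j = -1) then \<Prod>j\<in>E - A. wt (-1) 1 (F j) else 0)"
        by (simp add: prod_if_const f)
    qed
    finally show ?thesis .
  qed
  have "fpoly E L (z - 1) (1 - w) = (\<Sum>A\<in>Pow E. \<Sum>I\<in>Pow (E - A). \<Sum>F\<in>sgns L. z ^ card A * (- w) ^ card I *
          (if (\<forall>j\<in>A. F j = 0) \<and> (\<forall>j\<in>I. F j = -1) then \<Prod>j\<in>E - A. wt (-1) 1 (F j) else 0))"
    unfolding fpoly_def trm by (subst sum.swap, intro sum.cong refl, subst sum.swap, simp)
  also have "\<dots> = (\<Sum>A\<in>Pow E. \<Sum>I\<in>Pow (E - A). z ^ card A * (- w) ^ card I * ecoef E L A I)"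
    unfolding ecoef_def sum_distrib_left[symmetric]
    by (simp add: sum.If_cases finite_sgns Int_def)
  finally show ?thesis .
qed

lemma sgns_restriction:
  "sgns {x\<in>L. \<forall>j\<in>A. x j = 0} = {F \<in> sgns L. \<forall>j\<in>A. F j = 0}"
  by (auto simp: sgns_iff sgn_0_0)

text \<open>As \<open>card I\<close> is at most the dimension left after imposing the zeros on
  \<open>A\<close>, a vector with entries -1 on \<open>I\<close> exists and
  \<open>region_sum\<close> applies. No other trace of \<open>L\<close> remains in the value, so
  these coefficients cancel in a difference.\<close>

lemma (in uniform_space) ecoef_eq:
  assumes "A \<subseteq> E" "I \<subseteq> E - A" "card A \<le> M" "card I \<le> M - card A"
  shows "ecoef E L A I = 1 - (if I = {} then (-1) ^ (M - card A) else 0)"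
proof -
  interpret R: uniform_space "E - A" "M - card A" "{x\<in>L. \<forall>j\<in>A. x j = 0}"
    by (rule restriction[OF assms(1,3)])
  obtain x0 where x0: "x0 \<in> {x\<in>L. \<forall>j\<in>A. x j = 0}" "\<And>j. j \<in> I \<Longrightarrow> x0 j = -1"
    using R.interp_le[OF assms(2,4), of "\<lambda>_. -1"] by blast
  show ?thesis
    using region_sum[OF R.uniform_space_axioms assms(2), where \<sigma>="\<lambda>_. -1", OF _ x0(1)] x0(2)
    by (simp add: ecoef_def sgns_restriction conj_assoc)
qed

lemma (in uniform_space) ecoef_eq_0:
  assumes "A \<subseteq> E" "M < card A"
  shows "ecoef E L A I = 0"
proof -
  have "\<not> (F \<in> sgns L \<and> (\<forall>j\<in>A. F j = 0))" for F
  proof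
    assume F: "F \<in> sgns L \<and> (\<forall>j\<in>A. F j = 0)"
    then obtain x where x: "x \<in> L" "x \<noteq> (\<lambda>_. 0)" "\<And>j. F j = sgn (x j)" by (auto simp: sgns_iff)
    have "card A \<le> card {j\<in>E. x j = 0}"
      using assms fin F x(3) by (intro card_mono) (auto simp: sgn_0_0)
    then show False using zeros_less[OF x(1,2)] assms by simp
  qed
  then have "{F. F \<in> sgns L \<and> (\<forall>j\<in>A. F j = 0) \<and> (\<forall>j\<in>I. F j = -1)} = {}" by blast
  then show ?thesis unfolding ecoef_def by (simp only: sum.empty)
qed

section \<open>Differences of f-polynomials\<close>

text \<open>The polynomial of \<open>S_poly\<close> with the opposite sign, as a function of two
  real arguments and with \<open>M\<close> in place of \<open>n - r\<close>.\<close>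

definition gpoly :: "nat \<Rightarrow> nat \<Rightarrow> (nat \<Rightarrow> nat \<Rightarrow> real) \<Rightarrow> real \<Rightarrow> real \<Rightarrow> real" where
  "gpoly r M g x y = (\<Sum>j\<le>r. \<Sum>k\<le>M. g j k * (x + y) ^ k * (x + 1) ^ (M - k) * y ^ j)"

lemma polyfun_eq_0_cofinite:
  fixes c :: "nat \<Rightarrow> real"
  assumes "finite B" "\<And>t. t \<notin> B \<Longrightarrow> (\<Sum>k\<le>n. c k * t ^ k) = 0" "k \<le> n"
  shows "c k = 0"
proof (rule ccontr)
  assume "c k \<noteq> 0"
  then have "finite {t. (\<Sum>k\<le>n. c k * t ^ k) = 0}"
    using assms(3) by (subst polyfun_finite_roots) auto
  moreover have "UNIV \<subseteq> B \<union> {t. (\<Sum>k\<le>n. c k * t ^ k) = 0}" using assms(2) by auto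
  ultimately have "finite (UNIV :: real set)" using assms(1) finite_subset by blast
  then show False using infinite_UNIV_char_0 by blast
qed

text \<open>Substituting \<open>x + y = t (x + 1)\<close> leaves \<open>(x + 1)\<^sup>M\<close> times a polynomial in \<open>t\<close>.\<close>
lemma mixed_power_basis:
  fixes c :: "nat \<Rightarrow> real"
  assumes "y \<noteq> 1" "\<And>x. (\<Sum>k\<le>M. c k * (x + y) ^ k * (x + 1) ^ (M - k)) = 0" "k \<le> M"
  shows "c k = 0"
proof (rule polyfun_eq_0_cofinite[of "{1}"])
  fix t :: real assume "t \<notin> {1}"
  then have t: "1 - t \<noteq> 0" by simp
  define x where "x = (t - y) / (1 - t)"
  have x1: "x + 1 = (1 - y) / (1 - t)" and xy: "x + y = t * (x + 1)"
    using t by (simp_all add: x_def field_simps)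
  \<comment> \<open>This is where \<open>y \<noteq> 1\<close> enters; at y = 1 all the products
    collapse to (x+1)^M.\<close>
  have "x + 1 \<noteq> 0" using x1 assms(1) t by simp
  have "0 = (\<Sum>k\<le>M. c k * (x + y) ^ k * (x + 1) ^ (M - k))" using assms(2) by simp
  also have "\<dots> = (\<Sum>k\<le>M. (x + 1) ^ M * (c k * t ^ k))"
  proof (intro sum.cong refl)
    fix k assume "k \<in> {..M}"
    then have M: "(x + 1) ^ M = (x + 1) ^ k * (x + 1) ^ (M - k)" by (simp flip: power_add)
    show "c k * (x + y) ^ k * (x + 1) ^ (M - k) = (x + 1) ^ M * (c k * t ^ k)"
      unfolding xy power_mult_distrib M by simp
  qed
  also have "\<dots> = (x + 1) ^ M * (\<Sum>k\<le>M. c k * t ^ k)" by (simp add: sum_distrib_left)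
  finally show "(\<Sum>k\<le>M. c k * t ^ k) = 0" using \<open>x + 1 \<noteq> 0\<close> by simp
qed (use assms in auto)

lemma gpoly_swap:
  "gpoly r M g x y = (\<Sum>k\<le>M. (\<Sum>j\<le>r. g j k * y ^ j) * (x + y) ^ k * (x + 1) ^ (M - k))"
  unfolding gpoly_def by (subst sum.swap) (simp add: sum_distrib_left sum_distrib_right mult_ac)

text \<open>Coefficients are compared first in \<open>k\<close> for fixed \<open>y\<close>, then in
  \<open>j\<close>. Finitely many values of \<open>y\<close> may be left out: 1, where the mixed
  powers coincide, and 0, so that identities involving division by \<open>y\<close> are
  admissible.\<close>

lemma gpoly_eq_0:
  assumes "\<And>x y. y \<noteq> 0 \<Longrightarrow> gpoly r M g x y = 0" "j \<le> r" "k \<le> M"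
  shows "g j k = 0"
proof -
  have "(\<Sum>j\<le>r. g j k * y ^ j) = 0" if "y \<notin> {0, 1}" for y
  proof (rule mixed_power_basis[where y=y and M=M and k=k and c="\<lambda>k. \<Sum>j\<le>r. g j k * y ^ j"])
    show "(\<Sum>k\<le>M. (\<Sum>j\<le>r. g j k * y ^ j) * (x + y) ^ k * (x + 1) ^ (M - k)) = 0" for x
      unfolding gpoly_swap[symmetric] using assms(1) that by simp
  qed (use that assms in auto)
  then show ?thesis using assms(2) by (rule polyfun_eq_0_cofinite[where B="{0, 1}", rotated]) auto
qed

lemma gpoly_add: "gpoly r M (\<lambda>j k. g j k + h j k) x y = gpoly r M g x y + gpoly r M h x y"
  by (simp add: gpoly_def algebra_simps sum.distrib)

lemma gpoly_scale: "gpoly r M (\<lambda>j k. c * g j k) x y = c * gpoly r M g x y"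
  by (simp add: gpoly_def algebra_simps sum_distrib_left)

lemma gpoly_cong: "(\<And>j k. j \<le> r \<Longrightarrow> k \<le> M \<Longrightarrow> g j k = h j k) \<Longrightarrow> gpoly r M g x y = gpoly r M h x y"
  unfolding gpoly_def by (intro sum.cong) auto

lemma sum_atMost_rev: "(\<Sum>k\<le>M. f (M - k)) = (\<Sum>k\<le>(M::nat). f k)"
  by (rule sum.reindex_bij_witness[of _ "\<lambda>k. M - k" "\<lambda>k. M - k"]) auto

text \<open>The substitution sends x+y to -(x+1) and x+1 to -(x+y). It thus exchanges
  \<open>k\<close> with \<open>M - k\<close>, and each of the \<open>M\<close> factors contributes a
  sign.\<close>

lemma gpoly_reflect:
  "gpoly r M g (- 1 - y - x) y = (-1) ^ M * gpoly r M (\<lambda>j k. g j (M - k)) x y"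
proof -
  have "(\<Sum>k\<le>M. g j k * (-1 - y - x + y) ^ k * (-1 - y - x + 1) ^ (M - k) * y ^ j)
     = (-1) ^ M * (\<Sum>k\<le>M. g j (M - k) * (x + y) ^ k * (x + 1) ^ (M - k) * y ^ j)" for j
  proof -
    have "(\<Sum>k\<le>M. g j k * (-1 - y - x + y) ^ k * (-1 - y - x + 1) ^ (M - k) * y ^ j)
        = (\<Sum>k\<le>M. (-1) ^ M * (g j k * (x + 1) ^ k * (x + y) ^ (M - k) * y ^ j))"
    proof (intro sum.cong refl)
      fix k assume "k \<in> {..M}"
      then have "(-1::real) ^ M = (-1) ^ k * (-1) ^ (M - k)" by (simp flip: power_add)
      moreover have "-1 - y - x + y = (-1) * (x + 1)" "-1 - y - x + 1 = (-1) * (x + y)" by auto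
      ultimately show "g j k * (-1 - y - x + y) ^ k * (-1 - y - x + 1) ^ (M - k) * y ^ j
         = (-1) ^ M * (g j k * (x + 1) ^ k * (x + y) ^ (M - k) * y ^ j)"
        by (simp only: power_mult_distrib mult_ac)
    qed
    also have "\<dots> = (-1) ^ M * (\<Sum>k\<le>M. g j (M - k) * (x + 1) ^ (M - k) * (x + y) ^ (M - (M - k)) * y ^ j)"
      unfolding sum_distrib_left[symmetric]
      by (subst sum_atMost_rev[symmetric]) (rule refl)
    also have "\<dots> = (-1) ^ M * (\<Sum>k\<le>M. g j (M - k) * (x + y) ^ k * (x + 1) ^ (M - k) * y ^ j)"
      by (intro arg_cong[where f="\<lambda>t. (-1) ^ M * t"] sum.cong refl) (simp add: mult_ac)
    finally show ?thesis .
  qed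
  then show ?thesis unfolding gpoly_def by (simp add: sum_distrib_left)
qed

text \<open>After division by \<open>y\<close> the factors x+y and x+1 trade places. Clearing
  denominators takes y^M for them and y^r for the powers of \<open>y\<close>, and reverses both
  indices.\<close>

lemma gpoly_reverse:
  assumes "y \<noteq> 0"
  shows "y ^ (M + r) * gpoly r M g (x / y) (1 / y) = gpoly r M (\<lambda>j k. g (r - j) (M - k)) x y"
proof -
  have "y ^ (M + r) * gpoly r M g (x / y) (1 / y)
      = (\<Sum>j\<le>r. \<Sum>k\<le>M. g j k * (x + 1) ^ k * (x + y) ^ (M - k) * y ^ (r - j))"
    unfolding gpoly_def sum_distrib_left
  proof (intro sum.cong refl)
    fix j k assume jk: "j \<in> {..r}" "k \<in> {..M}"
    then have "y ^ (M + r) = y ^ k * y ^ (M - k) * y ^ (r - j) * y ^ j" by (simp flip: power_add)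
    moreover have "x / y + 1 / y = (x + 1) / y" "x / y + 1 = (x + y) / y"
      using assms by (auto simp: field_simps)
    ultimately show "y ^ (M + r) * (g j k * (x / y + 1 / y) ^ k * (x / y + 1) ^ (M - k) * (1 / y) ^ j)
        = g j k * (x + 1) ^ k * (x + y) ^ (M - k) * y ^ (r - j)"
      using assms by (simp add: power_divide)
  qed
  also have "\<dots> = (\<Sum>j\<le>r. \<Sum>k\<le>M. g (r - j) (M - k) * (x + 1) ^ (M - k) * (x + y) ^ (M - (M - k)) * y ^ (r - (r - j)))"
    by (subst sum_atMost_rev[symmetric], subst (2) sum_atMost_rev[symmetric]) (rule refl)
  also have "\<dots> = gpoly r M (\<lambda>j k. g (r - j) (M - k)) x y"
    unfolding gpoly_def by (intro sum.cong refl) auto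
  finally show ?thesis .
qed

section \<open>The span of the mixed powers\<close>

definition gpolys :: "nat \<Rightarrow> nat \<Rightarrow> (real \<Rightarrow> real \<Rightarrow> real) set" where
  "gpolys r M = {h. \<exists>g. \<forall>x y. h x y = gpoly r M g x y}"

lemma gpolys_zero: "(\<lambda>_ _. 0) \<in> gpolys r M"
  unfolding gpolys_def by (auto intro!: exI[of _ "\<lambda>_ _. 0"] simp: gpoly_def)

lemma gpolys_add: "f \<in> gpolys r M \<Longrightarrow> h \<in> gpolys r M \<Longrightarrow> (\<lambda>x y. f x y + h x y) \<in> gpolys r M"
  unfolding gpolys_def by (auto simp flip: gpoly_add)

lemma gpolys_scale: "f \<in> gpolys r M \<Longrightarrow> (\<lambda>x y. c * f x y) \<in> gpolys r M"
  unfolding gpolys_def by (auto simp flip: gpoly_scale)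

lemma gpolys_sum: "(\<And>i. i \<in> A \<Longrightarrow> f i \<in> gpolys r M) \<Longrightarrow> (\<lambda>x y. \<Sum>i\<in>A. f i x y) \<in> gpolys r M"
  by (induction A rule: infinite_finite_induct) (auto intro: gpolys_zero gpolys_add)

lemma gpolys_basis:
  assumes "j \<le> r" "k \<le> M"
  shows "(\<lambda>x y. (x + y) ^ k * (x + 1) ^ (M - k) * y ^ j) \<in> gpolys r M"
proof -
  have "gpoly r M (\<lambda>j' k'. if j' = j then if k' = k then 1 else 0 else 0) x y
      = (x + y) ^ k * (x + 1) ^ (M - k) * y ^ j" for x y
  proof -
    have "(\<Sum>k'\<le>M. (if k' = k then 1 else 0) * (x + y) ^ k' * (x + 1) ^ (M - k') * y ^ j)
        = (\<Sum>k'\<le>M. if k' = k then (x + y) ^ k * (x + 1) ^ (M - k) * y ^ j else 0)"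
      by (rule sum.cong) auto
    also have "\<dots> = (x + y) ^ k * (x + 1) ^ (M - k) * y ^ j" using assms by simp
    finally have inner: "(\<Sum>k'\<le>M. (if k' = k then 1 else 0) * (x + y) ^ k' * (x + 1) ^ (M - k') * y ^ j)
        = (x + y) ^ k * (x + 1) ^ (M - k) * y ^ j" .
    have "gpoly r M (\<lambda>j' k'. if j' = j then if k' = k then 1 else 0 else 0) x y
        = (\<Sum>j'\<le>r. if j' = j then \<Sum>k'\<le>M. (if k' = k then 1 else 0) * (x + y) ^ k' * (x + 1) ^ (M - k') * y ^ j else 0)"
      unfolding gpoly_def by (rule sum.cong) auto
    then show ?thesis using assms unfolding inner by simp
  qed
  then show ?thesis unfolding gpolys_def by (auto intro!: exI[of _ "\<lambda>j' k'. if j' = j then if k' = k then 1 else 0 else 0"])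
qed

text \<open>In \<open>M - a\<close> of the factors write y-1 = (x+y) - (x+1). Together with (x+1)^a
  this gives forms of degree \<open>M\<close> in x+y and x+1; the remaining factors y-1 are expanded
  in powers of \<open>y\<close>.\<close>

lemma gpolys_monomial:
  assumes "a \<le> M" "M < a + i" "a + i \<le> M + r"
  shows "(\<lambda>x y. (x + 1) ^ a * (y - 1) ^ i) \<in> gpolys r M"
proof -
  \<comment> \<open>\<open>M < a + i\<close> makes the truncated subtraction exact, and
    \<open>a + i \<le> M + r\<close> bounds the result by \<open>r\<close>.\<close>
  define l where "l = i - (M - a)"
  have l: "l \<le> r" "i = (M - a) + l" using assms by (auto simp: l_def)
  have eq: "(x + 1) ^ a * (y - 1) ^ i = (\<Sum>k\<le>M-a. \<Sum>j\<le>l. real (M - a choose k) * (-1) ^ (M - a - k) * (real (l choose j) * (-1) ^ (l - j))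
        * ((x + y) ^ k * (x + 1) ^ (M - k) * y ^ j))" for x y :: real
  proof -
    have "(y - 1) ^ (M - a) = ((x + y) + (-1) * (x + 1)) ^ (M - a)" by simp
    also have "\<dots> = (\<Sum>k\<le>M-a. real (M - a choose k) * (x + y) ^ k * ((-1) ^ (M - a - k) * (x + 1) ^ (M - a - k)))"
      unfolding binomial_ring power_mult_distrib by simp
    finally have 1: "(x + 1) ^ a * (y - 1) ^ (M - a) = 
      (\<Sum>k\<le>M-a. real (M - a choose k) * (-1) ^ (M - a - k) * ((x + y) ^ k * (x + 1) ^ (M - k)))"
    proof -
      assume h: "(y - 1) ^ (M - a) = (\<Sum>k\<le>M-a. real (M - a choose k) * (x + y) ^ k * ((-1) ^ (M - a - k) * (x + 1) ^ (M - a - k)))"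
      show ?thesis unfolding h sum_distrib_left
      proof (intro sum.cong refl)
        fix k assume "k \<in> {..M - a}"
        then have "(x + 1) ^ (M - k) = (x + 1) ^ a * (x + 1) ^ (M - a - k)" using assms by (simp flip: power_add)
        then show "(x + 1) ^ a * (real (M - a choose k) * (x + y) ^ k * ((-1) ^ (M - a - k) * (x + 1) ^ (M - a - k)))
         = real (M - a choose k) * (-1) ^ (M - a - k) * ((x + y) ^ k * (x + 1) ^ (M - k))"
          by (simp add: mult_ac)
      qed
    qed
    have 2: "(y - 1) ^ l = (\<Sum>j\<le>l. real (l choose j) * (-1) ^ (l - j) * y ^ j)"
      using binomial_ring[of y "-1" l] by (simp add: mult_ac)
    show ?thesis
      unfolding l(2) power_add mult.assoc[symmetric] 1 2 sum_product
      by (intro sum.cong refl) (simp add: mult_ac)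
  qed
  show ?thesis unfolding eq
    using l assms by (intro gpolys_sum gpolys_scale gpolys_basis) auto
qed

lemma fpoly_diff:
  assumes "uniform_space E M L" "uniform_space E M L'" "card E = M + r"
  shows "(\<lambda>x y. fpoly E L x y - fpoly E L' x y) \<in> gpolys r M"
proof -
  interpret X: uniform_space E M L by fact
  interpret Y: uniform_space E M L' by fact
  have eq: "fpoly E L x y - fpoly E L' x y = (\<Sum>A\<in>Pow E. \<Sum>I\<in>Pow (E - A).
      (ecoef E L A I - ecoef E L' A I) * ((x + 1) ^ card A * (y - 1) ^ card I))" for x y
    using X.fpoly_expand[of "x + 1" "1 - y"] Y.fpoly_expand[of "x + 1" "1 - y"]
    by (simp add: sum_subtractf[symmetric] algebra_simps)
  show ?thesis unfolding eq
  proof (intro gpolys_sum)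
    fix A I assume AI: "A \<in> Pow E" "I \<in> Pow (E - A)"
    have f: "finite A" "finite I" using AI X.fin finite_subset[of I E] finite_subset[of A E] by auto
    have "card (A \<union> I) \<le> card E" using AI X.fin by (intro card_mono) auto
    then have c: "card A + card I \<le> M + r"
      using AI f assms(3) by (subst (asm) card_Un_disjoint) auto
    show "(\<lambda>x y. (ecoef E L A I - ecoef E L' A I) * ((x + 1) ^ card A * (y - 1) ^ card I)) \<in> gpolys r M"
    \<comment> \<open>For \<open>card A + card I \<le> M\<close> the two coefficients agree by
      \<open>ecoef_eq\<close>, and for \<open>card A > M\<close> both vanish. The surviving
      exponents are those of \<open>gpolys_monomial\<close>.\<close>
    proof (cases "card A \<le> M \<and> M < card A + card I")
      case True
      then show ?thesis using c by (intro gpolys_scale gpolys_monomial) auto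
    next
      case False
      then have "ecoef E L A I = ecoef E L' A I"
        using AI by (cases "card A \<le> M") (simp_all add: X.ecoef_eq Y.ecoef_eq X.ecoef_eq_0 Y.ecoef_eq_0)
      then show ?thesis by (simp add: gpolys_zero)
    qed
  qed
qed

section \<open>Symmetries of the f-polynomial\<close>

context uniform_space
begin

lemma sgns_values: "F \<in> sgns L \<Longrightarrow> F j \<in> {-1, 0, 1}"
  using sgns_subset[THEN subsetD, of F] by (cases "j \<in> E") (auto simp: choices_def)

lemma uminus_mem: "x \<in> L \<Longrightarrow> (\<lambda>j. - x j) \<in> L"
  using lin[of x x "-1" 0] by simp

lemma uminus_sgns:
  assumes "F \<in> sgns L" shows "(\<lambda>j. - F j) \<in> sgns L"
proof -
  obtain x where x: "x \<in> L" "x \<noteq> (\<lambda>_. 0)" "\<And>j. F j = sgn (x j)"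
    using assms unfolding sgns_iff by blast
  show ?thesis
    by (rule sgnsI[OF uminus_mem[OF x(1)]]) (use x in \<open>auto simp: fun_eq_iff sgn_minus\<close>)
qed

text \<open>The closed cell of \<open>G\<close> is treated by inclusion-exclusion over the open cones
  \<open>{F. \<forall>j\<in>I. F j = - G j}\<close>, all of which are nonempty because \<open>- G\<close> is a sign vector.\<close>
lemma closed_cell_sum:
  assumes G: "G \<in> sgns L"
  shows "(\<Sum>F | F \<in> sgns L \<and> (\<forall>j\<in>E. F j \<noteq> 0 \<longrightarrow> F j = G j). \<Prod>j\<in>E. wt (-1) 1 (F j)) = (-1) ^ (M + 1)"
proof -
  obtain x where x: "x \<in> L" "x \<noteq> (\<lambda>_. 0)" "\<And>j. G j = sgn (x j)"
    using G unfolding sgns_iff by blast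
  define Z where "Z = {j\<in>E. x j = 0}"
  have Z: "Z \<subseteq> E" "card Z < M" using zeros_less[OF x(1,2)] by (auto simp: Z_def)
  have finZ: "finite Z" using Z fin finite_subset by blast
  let ?L = "{x\<in>L. \<forall>j\<in>Z. x j = 0}"
  interpret R: uniform_space "E - Z" "M - card Z" ?L using restriction[of Z] Z by simp
  have ne: "E - Z \<noteq> {}"
  proof
    assume "E - Z = {}"
    then have "E = Z" using Z by blast
    then show False using M_le Z by simp
  qed
  have ind: "(if \<forall>j\<in>E. F j \<noteq> 0 \<longrightarrow> F j = G j then 1 else 0)
      = (\<Sum>I\<in>Pow (E - Z). (-1) ^ card I * (if \<forall>j\<in>I. F j = - G j then 1 else (0::real)))"
    if F: "F \<in> sgns ?L" for F
  proof -
    have FZ: "F j = 0" if "j \<in> Z" for j using F that by (auto simp: sgns_restriction)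
    have "(\<Sum>I\<in>Pow (E - Z). (-1) ^ card I * (if \<forall>j\<in>I. F j = - G j then 1 else (0::real)))
       = (\<Sum>I\<in>Pow (E - Z). (\<Prod>j\<in>I. if F j = - G j then -1 else 0) * (\<Prod>j\<in>E - Z - I. 1))"
    proof (rule sum.cong)
      fix I assume "I \<in> Pow (E - Z)"
      then have "finite I" using fin finite_subset[of I E] by blast
      then show "(-1) ^ card I * (if \<forall>j\<in>I. F j = - G j then 1 else (0::real))
        = (\<Prod>j\<in>I. if F j = - G j then -1 else 0) * (\<Prod>j\<in>E - Z - I. 1)"
        by (simp add: prod_if_const)
    qed simp
    also have "\<dots> = (\<Prod>j\<in>E - Z. (if F j = - G j then -1 else 0) + 1)"
      using fin by (subst prod_add) auto
    also have "\<dots> = (\<Prod>j\<in>E - Z. if F j \<noteq> - G j then 1 else 0)"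
      by (rule prod.cong) auto
    also have "\<dots> = (if \<forall>j\<in>E - Z. F j \<noteq> - G j then 1 else 0)"
      using fin by (subst prod_if_const) auto
    \<comment> \<open>Off \<open>Z\<close> the entry of \<open>G\<close> is 1 or -1, so avoiding its
      negative means being 0 or equal to it; on \<open>Z\<close> the vector \<open>F\<close>
      vanishes.\<close>
    also have "(\<forall>j\<in>E - Z. F j \<noteq> - G j) \<longleftrightarrow> (\<forall>j\<in>E. F j \<noteq> 0 \<longrightarrow> F j = G j)"
    proof -
      have "F j \<noteq> - G j \<longleftrightarrow> (F j \<noteq> 0 \<longrightarrow> F j = G j)" if j: "j \<in> E - Z" for j
      proof -
        have "G j \<in> {-1, 1}" using sgns_values[OF G, of j] j x(3)[of j] by (auto simp: Z_def sgn_0_0)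
        then show ?thesis using R.sgns_values[OF F, of j] by auto
      qed
      then show ?thesis using FZ by blast
    qed
    finally show ?thesis by simp
  qed
  have split: "(\<Prod>j\<in>E. wt (-1) 1 (F j)) = (-1) ^ card Z * (\<Prod>j\<in>E - Z. wt (-1) 1 (F j))"
    if F: "F \<in> sgns ?L" for F
  proof -
    have FZ: "F j = 0" if "j \<in> Z" for j using F that by (auto simp: sgns_restriction)
    have "(\<Prod>j\<in>E. wt (-1) 1 (F j)) = (\<Prod>j\<in>E - Z. wt (-1) 1 (F j)) * (\<Prod>j\<in>Z. wt (-1) 1 (F j))"
      using Z fin by (intro prod.subset_diff) auto
    also have "(\<Prod>j\<in>Z. wt (-1) 1 (F j)) = (\<Prod>j\<in>Z. -1)" by (rule prod.cong) (auto simp: FZ wt_def)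
    finally show ?thesis by simp
  qed
  have reg: "(\<Sum>F\<in>sgns ?L. (if \<forall>j\<in>I. F j = - G j then 1 else 0) * (\<Prod>j\<in>E - Z. wt (-1) 1 (F j)))
      = 1 - (if I = {} then (-1) ^ (M - card Z) else 0)" if I: "I \<in> Pow (E - Z)" for I
  proof -
    have "(\<Sum>F | F \<in> sgns ?L \<and> (\<forall>i\<in>I. F i = - G i). \<Prod>j\<in>E - Z. wt (-1) 1 (F j))
       = 1 - (if I = {} then (-1) ^ (M - card Z) else 0)"
    proof (rule region_sum[OF R.uniform_space_axioms])
      show "(\<lambda>j. - x j) \<in> ?L" using uminus_mem[OF x(1)] by (simp add: Z_def)
      show "\<And>i. i \<in> I \<Longrightarrow> - G i \<noteq> 0" using I x(3) by (auto simp: Z_def sgn_0_0)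
    qed (use I x(3) in \<open>auto simp: sgn_minus\<close>)
    then show ?thesis
      by (simp add: if_distrib[where f="\<lambda>t. t * _"] sum.If_cases R.finite_sgns Int_def cong: if_cong)
  qed
  have set_eq: "{F. F \<in> sgns L \<and> (\<forall>j\<in>E. F j \<noteq> 0 \<longrightarrow> F j = G j)}
      = {F \<in> sgns ?L. \<forall>j\<in>E. F j \<noteq> 0 \<longrightarrow> F j = G j}"
    unfolding sgns_restriction using x(3) by (auto simp: Z_def)
  have "(\<Sum>F | F \<in> sgns L \<and> (\<forall>j\<in>E. F j \<noteq> 0 \<longrightarrow> F j = G j). \<Prod>j\<in>E. wt (-1) 1 (F j))
      = (\<Sum>F\<in>sgns ?L. (if \<forall>j\<in>E. F j \<noteq> 0 \<longrightarrow> F j = G j then 1 else 0) * (\<Prod>j\<in>E. wt (-1) 1 (F j)))"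
    unfolding set_eq 
    by (simp add: if_distrib[where f="\<lambda>t. t * _"] sum.If_cases R.finite_sgns Int_def cong: if_cong)
  also have "\<dots> = (\<Sum>F\<in>sgns ?L. \<Sum>I\<in>Pow (E - Z). (-1) ^ card Z * (-1) ^ card I *
      ((if \<forall>j\<in>I. F j = - G j then 1 else 0) * (\<Prod>j\<in>E - Z. wt (-1) 1 (F j))))"
    by (rule sum.cong) (simp_all only: ind split sum_distrib_right sum_distrib_left mult_ac)
  also have "\<dots> = (\<Sum>I\<in>Pow (E - Z). (-1) ^ card Z * (-1) ^ card I *
      (1 - (if I = {} then (-1) ^ (M - card Z) else 0)))"
    by (subst sum.swap) (simp only: sum_distrib_left[symmetric] reg cong: sum.cong)
  also have "\<dots> = (-1) ^ card Z * ((\<Sum>I\<in>Pow (E - Z). (-1) ^ card I)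
      - (\<Sum>I\<in>Pow (E - Z). if I = {} then (-1) ^ (M - card Z) else 0))"
    unfolding sum_subtractf[symmetric] sum_distrib_left by (rule sum.cong) (auto simp: algebra_simps)
  \<comment> \<open>Since \<open>G\<close> has a nonzero entry, the alternating sum cancels. What is
    left is the correction at \<open>I = {}\<close>, that is, the zero vector absent from
    \<open>sgns\<close>.\<close>
  also have "(\<Sum>I\<in>Pow (E - Z). (-1::real) ^ card I) = 0"
  proof -
    have "(\<Sum>I\<in>Pow (E - Z). (-1::real) ^ card I) = (\<Prod>j\<in>E - Z. (-1::real) + 1)"
      using fin by (subst prod_add) auto
    then show ?thesis using fin ne by (simp add: card_gt_0_iff)
  qed
  also have "(\<Sum>I\<in>Pow (E - Z). if I = {} then (-1) ^ (M - card Z) else (0::real)) = (-1) ^ (M - card Z)"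
    using fin by simp
  also have "(-1) ^ card Z * (0 - (-1) ^ (M - card Z)) = - ((-1::real) ^ (card Z + (M - card Z)))"
    by (simp add: power_add)
  finally show ?thesis using Z by simp
qed

text \<open>At a zero entry the weight -1-y-x is minus the total weight of the three signs.
  Expanding it fills the zeros of \<open>F\<close> in all ways, and every filling \<open>G\<close>
  is again a sign vector by \<open>fill_sgns\<close>. Summing over \<open>F\<close> first leaves the
  closed cell of \<open>G\<close>, which contributes (-1)^(M+1).\<close>

lemma fpoly_reflect: "fpoly E L (-1 - y - x) y = (-1) ^ (M + 1) * fpoly E L x y"
proof -
  let ?R = "\<lambda>F G. \<forall>j\<in>E. F j \<noteq> 0 \<longrightarrow> F j = G j"
  have up: "(\<Prod>j\<in>E. wt (-1 - y - x) y (F j))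
      = (\<Sum>G\<in>{G\<in>sgns L. ?R F G}. (\<Prod>j\<in>E. wt (-1) 1 (F j)) * (\<Prod>j\<in>E. wt x y (G j)))"
    if F: "F \<in> sgns L" for F
  proof -
    let ?S = "\<lambda>j. if F j = 0 then {-1, 0, 1} else {F j}"
    have set_eq: "{G\<in>sgns L. ?R F G} = choices E ?S"
    proof (intro equalityI subsetI)
      fix G assume G: "G \<in> {G\<in>sgns L. ?R F G}"
      then show "G \<in> choices E ?S" using sgns_subset[THEN subsetD, of G] by (auto simp: choices_def)
    next
      fix G assume G: "G \<in> choices E ?S"
      have v: "G j \<in> {-1, 0, 1}" if "j \<in> E" for j
      proof -
        have "G j \<in> ?S j" using G that by (simp add: choices_def)
        then show ?thesis using sgns_values[OF F, of j] by (auto split: if_splits)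
      qed
      then have "G \<in> choices E (\<lambda>_. {-1, 0, 1})" using G by (simp add: choices_def)
      moreover have R: "?R F G" using G by (auto simp: choices_def split: if_splits)
      ultimately have "G \<in> sgns L" by (intro fill_sgns[OF F]) auto
      then show "G \<in> {G\<in>sgns L. ?R F G}" using R by simp
    qed
    have "(\<Prod>j\<in>E. wt (-1 - y - x) y (F j)) = (\<Prod>j\<in>E. \<Sum>s\<in>?S j. wt (-1) 1 (F j) * wt x y s)"
      by (rule prod.cong) (auto simp: wt_def)
    also have "\<dots> = (\<Sum>G\<in>choices E ?S. \<Prod>j\<in>E. wt (-1) 1 (F j) * wt x y (G j))"
      by (rule sum_choices_prod[OF fin, symmetric])
    finally show ?thesis unfolding set_eq by (simp add: prod.distrib)
  qed
  have "fpoly E L (-1 - y - x) y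
      = (\<Sum>F\<in>sgns L. \<Sum>G\<in>{G\<in>sgns L. ?R F G}. (\<Prod>j\<in>E. wt (-1) 1 (F j)) * (\<Prod>j\<in>E. wt x y (G j)))"
    unfolding fpoly_def by (rule sum.cong[OF refl up])
  also have "\<dots> = (\<Sum>G\<in>sgns L. \<Sum>F | F \<in> sgns L \<and> ?R F G. (\<Prod>j\<in>E. wt (-1) 1 (F j)) * (\<Prod>j\<in>E. wt x y (G j)))"
    by (rule sum.swap_restrict[OF finite_sgns finite_sgns])
  also have "\<dots> = (\<Sum>G\<in>sgns L. (-1) ^ (M + 1) * (\<Prod>j\<in>E. wt x y (G j)))"
    by (rule sum.cong[OF refl]) (simp only: sum_distrib_right[symmetric] closed_cell_sum)
  finally show ?thesis by (simp only: fpoly_def sum_distrib_left)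
qed

lemma fpoly_reverse:
  assumes "y \<noteq> 0"
  shows "y ^ card E * fpoly E L (x / y) (1 / y) = fpoly E L x y"
proof -
  have "y ^ card E * fpoly E L (x / y) (1 / y) = (\<Sum>F\<in>sgns L. \<Prod>j\<in>E. y * wt (x / y) (1 / y) (F j))"
    by (simp add: fpoly_def prod.distrib sum_distrib_left)
  also have "\<dots> = (\<Sum>F\<in>sgns L. \<Prod>j\<in>E. wt x y (- F j))"
  proof (rule sum.cong[OF refl], rule prod.cong[OF refl])
    fix F j assume "F \<in> sgns L"
    then show "y * wt (x / y) (1 / y) (F j) = wt x y (- F j)"
      using sgns_values[of F j] assms by (auto simp: wt_def)
  qed
  also have "\<dots> = fpoly E L x y" unfolding fpoly_def
    by (rule sum.reindex_bij_witness[of _ "\<lambda>F j. - F j" "\<lambda>F j. - F j"]) (auto intro: uminus_sgns)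
  finally show ?thesis .
qed

lemma fpoly_pointed:
  assumes "\<And>F. F \<in> sgns L \<Longrightarrow> \<exists>j\<in>E. F j = -1"
  shows "fpoly E L x 0 = 0"
  unfolding fpoly_def
proof (rule sum.neutral, rule ballI)
  fix F assume "F \<in> sgns L"
  then obtain j where "j \<in> E" "F j = -1" using assms by blast
  then show "(\<Prod>j\<in>E. wt x 0 (F j)) = 0" using fin by (intro prod_zero) (auto simp: wt_def)
qed

end

section \<open>Transfer of the symmetries to coefficients\<close>

lemma gpoly_0: "gpoly r M g x 0 = (\<Sum>k\<le>M. g 0 k * x ^ k * (x + 1) ^ (M - k))"
proof -
  have "(\<Sum>j\<le>r. g j k * 0 ^ j) = g 0 k" for k
    by (subst sum.remove[of _ 0]) (auto intro!: sum.neutral)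
  then show ?thesis by (simp add: gpoly_swap)
qed

lemma fpoly_diff_G0:
  assumes L: "uniform_space E M L" and L': "uniform_space E M L'" and c: "card E = M + r"
    and p: "\<And>F. F \<in> sgns L \<Longrightarrow> \<exists>j\<in>E. F j = -1" and p': "\<And>F. F \<in> sgns L' \<Longrightarrow> \<exists>j\<in>E. F j = -1"
  obtains g where "g \<in> G0_space (M + r) r"
    "\<And>x y. fpoly E L x y = fpoly E L' x y - gpoly r M g x y"
proof -
  interpret X: uniform_space E M L by fact
  interpret Y: uniform_space E M L' by fact
  obtain h where h: "\<And>x y. fpoly E L x y - fpoly E L' x y = gpoly r M h x y"
    using fpoly_diff[OF L L' c] by (auto simp: gpolys_def)
  \<comment> \<open>Euler's relation carries the sign (-1)^(M+1), the same substitution in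
    \<open>gpoly\<close> only (-1)^M; the surplus -1 is the antisymmetry in
    \<open>k\<close>.\<close>
  have k: "h j (M - k) = - h j k" if "j \<le> r" "k \<le> M" for j k
  proof -
    have "gpoly r M (\<lambda>j k. h j k + h j (M - k)) x y = 0" for x y
    proof -
      have "(-1) ^ M * gpoly r M (\<lambda>j k. h j (M - k)) x y = (-1) ^ (M + 1) * gpoly r M h x y"
        unfolding gpoly_reflect[symmetric] h[symmetric] X.fpoly_reflect Y.fpoly_reflect
        by (simp add: right_diff_distrib)
      then have "(-1) ^ M * gpoly r M (\<lambda>j k. h j (M - k)) x y = (-1) ^ M * (- gpoly r M h x y)" by simp
      then have "gpoly r M (\<lambda>j k. h j (M - k)) x y = - gpoly r M h x y"
        by (subst (asm) mult_cancel_left) simp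
      then show ?thesis by (simp add: gpoly_add)
    qed
    from gpoly_eq_0[OF this that] show ?thesis by simp
  qed
  \<comment> \<open>Negating sign vectors reverses both indices at once; combined with the preceding
    fact this gives antisymmetry in \<open>j\<close>.\<close>
  have j: "h (r - j) (M - k) = h j k" if "j \<le> r" "k \<le> M" for j k
  proof -
    have "gpoly r M (\<lambda>j k. h j k + (-1) * h (r - j) (M - k)) x y = 0" if "y \<noteq> 0" for x y
    proof -
      have "gpoly r M (\<lambda>j k. h (r - j) (M - k)) x y = gpoly r M h x y"
        unfolding gpoly_reverse[OF that, symmetric] h[symmetric] right_diff_distrib
          c[symmetric] X.fpoly_reverse[OF that] Y.fpoly_reverse[OF that] ..
      then show ?thesis unfolding gpoly_add gpoly_scale by simp
    qed
    from gpoly_eq_0[OF this that] show ?thesis by simp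
  qed
  have z: "h 0 k = 0" if "k \<le> M" for k
  proof (rule mixed_power_basis[where y=0 and c="h 0"])
    show "(\<Sum>k\<le>M. h 0 k * (x + 0) ^ k * (x + 1) ^ (M - k)) = 0" for x
      using h[of x 0] X.fpoly_pointed[OF p] Y.fpoly_pointed[OF p'] by (simp add: gpoly_0)
  qed (use that in auto)
  \<comment> \<open>The sign offsets the minus in \<open>S_poly\<close>; outside the index range
    \<open>G0_space\<close> requires zeros.\<close>
  define g where "g = (\<lambda>j k. if j \<le> r \<and> k \<le> M then - h j k else 0)"
  have "g \<in> G0_space (M + r) r"
    using j k z by (auto simp: g_def G0_space_def)
  moreover have "fpoly E L x y = fpoly E L' x y - gpoly r M g x y" for x y
  proof -
    have "gpoly r M g x y = gpoly r M (\<lambda>j k. (-1) * h j k) x y"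
      by (rule gpoly_cong) (simp add: g_def)
    then show ?thesis unfolding gpoly_scale using h[of x y] by simp
  qed
  ultimately show thesis using that by blast
qed

section \<open>Vector configurations and their f*-matrices\<close>

text \<open>Gaussian elimination: a pivot \<open>p\<close> with nonzero entry in the last equation
  clears that equation from the other vectors, and one unknown fewer faces one equation
  fewer.\<close>

lemma underdetermined_system:
  fixes v :: "'a \<Rightarrow> nat \<Rightarrow> real"
  assumes "finite J" "r < card J"
  obtains c where "\<exists>j\<in>J. c j \<noteq> 0" "\<And>i. i < r \<Longrightarrow> (\<Sum>j\<in>J. c j * v j i) = 0"
proof -
  have "\<exists>c. (\<exists>j\<in>J. c j \<noteq> 0) \<and> (\<forall>i<r. (\<Sum>j\<in>J. c j * v j i) = 0)"
    using assms
  proof (induction r arbitrary: J v)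
    case 0
    then obtain j where "j \<in> J" by fastforce
    then show ?case by (intro exI[of _ "\<lambda>_. 1"]) auto
  next
    case (Suc r)
    show ?case
    proof (cases "\<forall>j\<in>J. v j r = 0")
      case True
      obtain c where c: "\<exists>j\<in>J. c j \<noteq> 0" "\<forall>i<r. (\<Sum>j\<in>J. c j * v j i) = 0"
        using Suc.IH[of J v] Suc.prems by auto
      have "(\<Sum>j\<in>J. c j * v j r) = 0" using True by (intro sum.neutral) auto
      then show ?thesis using c by (intro exI[of _ c]) (auto simp: less_Suc_eq)
    next
      case False
      then obtain p where p: "p \<in> J" "v p r \<noteq> 0" by blast
      then have card: "finite (J - {p})" "r < card (J - {p})" using Suc.prems by auto
      define w where "w = (\<lambda>j i. v j i - (v j r / v p r) * v p i)"
      obtain c where c: "\<exists>j\<in>J - {p}. c j \<noteq> 0" "\<forall>i<r. (\<Sum>j\<in>J - {p}. c j * w j i) = 0"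
        using Suc.IH[of "J - {p}" w] card by blast
      \<comment> \<open>The coefficient of the pivot makes up for the multiples of
        \<open>v p\<close> subtracted from the other vectors.\<close>
      define cp where "cp = - (\<Sum>j\<in>J - {p}. c j * (v j r / v p r))"
      have eq: "(\<Sum>j\<in>J. (c(p := cp)) j * v j i) = (\<Sum>j\<in>J - {p}. c j * w j i)" for i
      proof -
        have "(\<Sum>j\<in>J. (c(p := cp)) j * v j i) = cp * v p i + (\<Sum>j\<in>J - {p}. (c(p := cp)) j * v j i)"
          using p Suc.prems by (subst sum.remove[of J p]) auto
        also have "(\<Sum>j\<in>J - {p}. (c(p := cp)) j * v j i) = (\<Sum>j\<in>J - {p}. c j * v j i)"
          by (rule sum.cong) auto
        also have "cp * v p i = - (\<Sum>j\<in>J - {p}. c j * (v j r / v p r) * v p i)"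
          by (simp add: cp_def sum_distrib_right)
        finally show ?thesis by (simp add: w_def algebra_simps sum_subtractf)
      qed
      have "(\<Sum>j\<in>J - {p}. c j * w j r) = 0" using p by (intro sum.neutral) (auto simp: w_def)
      then have "\<forall>i<Suc r. (\<Sum>j\<in>J. (c(p := cp)) j * v j i) = 0"
        unfolding eq using c(2) by (auto simp: less_Suc_eq)
      moreover have "\<exists>j\<in>J. (c(p := cp)) j \<noteq> 0" using c(1) by auto
      ultimately show ?thesis by blast
    qed
  qed
  then show thesis using that by blast
qed

definition indep :: "nat \<Rightarrow> rmat \<Rightarrow> nat set \<Rightarrow> bool" where
  "indep r V J \<longleftrightarrow> (\<forall>c. (\<forall>i<r. (\<Sum>j\<in>J. c j * V j i) = 0) \<longrightarrow> (\<forall>j\<in>J. c j = 0))"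

lemma indepD: "indep r V J \<Longrightarrow> (\<And>i. i < r \<Longrightarrow> (\<Sum>j\<in>J. c j * V j i) = 0) \<Longrightarrow> j \<in> J \<Longrightarrow> c j = 0"
  unfolding indep_def by blast

lemma general_position_iff:
  "general_position n r V \<longleftrightarrow> (\<forall>J. J \<subseteq> {..<n} \<and> card J = r \<longrightarrow> indep r V J)"
  by (simp add: general_position_def indep_def)

lemma indep_spans:
  assumes "finite J" "card J = r" "indep r V J"
  obtains c where "\<And>i. i < r \<Longrightarrow> (\<Sum>j\<in>J. c j * V j i) = b i"
proof -
  obtain e where e: "e \<notin> J" using ex_new_if_finite[OF infinite_UNIV_nat assms(1)] by blast
  obtain c where c: "\<exists>j\<in>insert e J. c j \<noteq> 0"
    "\<And>i. i < r \<Longrightarrow> (\<Sum>j\<in>insert e J. c j * (V(e := b)) j i) = 0"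
    using underdetermined_system[of "insert e J" r "V(e := b)"] assms e by auto
  have c': "c e * b i + (\<Sum>j\<in>J. c j * V j i) = 0" if "i < r" for i
  proof -
    have "(\<Sum>j\<in>J. c j * (V(e := b)) j i) = (\<Sum>j\<in>J. c j * V j i)"
      using e by (intro sum.cong) auto
    then show ?thesis using c(2)[OF that] e assms(1) by simp
  qed
  have "c e \<noteq> 0"
  proof
    assume ce: "c e = 0"
    then have "c j = 0" if "j \<in> J" for j
      using c' ce that indepD[OF assms(3), of c j] by simp
    then show False using c(1) ce by auto
  qed
  show thesis
  proof (rule that)
    fix i assume "i < r"
    have "(\<Sum>j\<in>J. - c j / c e * V j i) = (\<Sum>j\<in>J. (- 1 / c e) * (c j * V j i))"
      by (rule sum.cong) auto
    also have "\<dots> = (- 1 / c e) * (\<Sum>j\<in>J. c j * V j i)" by (simp add: sum_distrib_left)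
    also have "(\<Sum>j\<in>J. c j * V j i) = - c e * b i" using c'[OF \<open>i < r\<close>] by simp
    finally show "(\<Sum>j\<in>J. - c j / c e * V j i) = b i" using \<open>c e \<noteq> 0\<close> by simp
  qed
qed

section \<open>Spaces of linear dependencies\<close>

definition deps :: "nat \<Rightarrow> nat \<Rightarrow> rmat \<Rightarrow> (nat \<Rightarrow> real) set" where
  "deps n r V = {l. (\<forall>j\<ge>n. l j = 0) \<and> (\<forall>i<r. (\<Sum>j<n. l j * V j i) = 0)}"

text \<open>\<open>deps\<close> keeps the zero vector so as to be a subspace; \<open>sgns\<close>
  drops it again, in line with the nontriviality in \<open>lin_dep\<close>.\<close>

lemma sign_vectors_eq_sgns: "sign_vectors n r V = sgns (deps n r V)"
proof -
  have "lin_dep n r V l \<longleftrightarrow> l \<in> deps n r V \<and> l \<noteq> (\<lambda>_. 0)" for l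
    unfolding lin_dep_def deps_def fun_eq_iff by (auto simp: not_le) (metis not_le)
  then show ?thesis unfolding sign_vectors_def sgns_def by blast
qed

text \<open>The columns outside any \<open>n - r\<close> indices form a basis, so arbitrary values
  on these indices extend uniquely to a dependency.\<close>

lemma deps_uniform:
  assumes "general_position n r V" "r \<le> n"
  shows "uniform_space {..<n} (n - r) (deps n r V)"
proof
  show "n - r \<le> card {..<n}" by simp
  show "(\<lambda>j. a * x j + b * y j) \<in> deps n r V" if "x \<in> deps n r V" "y \<in> deps n r V" for x y a b
  proof -
    have "(\<Sum>j<n. (a * x j + b * y j) * V j i) = a * (\<Sum>j<n. x j * V j i) + b * (\<Sum>j<n. y j * V j i)" for i
      by (simp add: algebra_simps sum.distrib sum_distrib_left)
    then show ?thesis using that by (simp add: deps_def)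
  qed
  show "\<And>x j. x \<in> deps n r V \<Longrightarrow> j \<notin> {..<n} \<Longrightarrow> x j = 0" by (simp add: deps_def)
  fix A assume A: "A \<subseteq> {..<n}" "card A = n - r"
  let ?J = "{..<n} - A"
  have J: "finite ?J" "card ?J = r" using A assms finite_subset[of A] by (auto simp: card_Diff_subset)
  have ind: "indep r V ?J" using assms(1) J unfolding general_position_iff by auto
  have split: "(\<Sum>j<n. l j * V j i) = (\<Sum>j\<in>?J. l j * V j i) + (\<Sum>j\<in>A. l j * V j i)" for l i
    using A by (intro sum.subset_diff) auto
  show "\<exists>x\<in>deps n r V. \<forall>j\<in>A. x j = m j" for m
  proof -
    obtain c where c: "\<And>i. i < r \<Longrightarrow> (\<Sum>j\<in>?J. c j * V j i) = - (\<Sum>j\<in>A. m j * V j i)"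
      using indep_spans[OF J ind, where b="\<lambda>i. - (\<Sum>j\<in>A. m j * V j i)"] by blast
    define x where "x = (\<lambda>j. if j \<in> A then m j else if j < n then c j else 0)"
    have "(\<Sum>j\<in>?J. x j * V j i) = (\<Sum>j\<in>?J. c j * V j i)" "(\<Sum>j\<in>A. x j * V j i) = (\<Sum>j\<in>A. m j * V j i)" for i
      by (auto intro!: sum.cong simp: x_def)
    then have "x \<in> deps n r V" using c A unfolding deps_def split by (auto simp: x_def)
    then show ?thesis by (intro bexI[of _ x]) (auto simp: x_def)
  qed
  show "x = (\<lambda>_. 0)" if x: "x \<in> deps n r V" "\<forall>j\<in>A. x j = 0" for x
  proof
    fix j
    have "(\<Sum>j\<in>?J. x j * V j i) = 0" if "i < r" for i
      using x that split[of x i] by (simp add: deps_def)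
    then show "x j = 0" using indepD[OF ind, of x j] x by (cases "j < n"; cases "j \<in> A") (auto simp: deps_def)
  qed
qed simp

text \<open>Pairing a dependency with \<open>u\<close> writes 0 as a combination of positive
  numbers, so some coefficient is negative.\<close>

lemma pointed_sign_vector:
  assumes "pointed n r V" "F \<in> sgns (deps n r V)"
  shows "\<exists>j\<in>{..<n}. F j = -1"
proof (rule ccontr)
  assume neg: "\<not> ?thesis"
  obtain u where u: "\<And>j. j < n \<Longrightarrow> (\<Sum>i<r. u i * V j i) > 0"
    using assms(1) unfolding pointed_def by blast
  obtain x where x: "x \<in> deps n r V" "x \<noteq> (\<lambda>_. 0)" "\<And>j. F j = sgn (x j)"
    using assms(2) unfolding sgns_iff by blast
  have nn: "x j \<ge> 0" if "j < n" for j
  proof -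
    have "F j \<noteq> -1" using neg that by blast
    then show ?thesis using x(3)[of j] by (simp add: sgn_real_def split: if_splits)
  qed
  obtain k where k: "x k \<noteq> 0" using x(2) by (auto simp: fun_eq_iff)
  then have kn: "k < n" using x(1) not_le by (auto simp: deps_def)
  have "0 = (\<Sum>i<r. u i * (\<Sum>j<n. x j * V j i))" using x(1) by (simp add: deps_def)
  also have "\<dots> = (\<Sum>j<n. x j * (\<Sum>i<r. u i * V j i))"
    unfolding sum_distrib_left by (subst sum.swap) (simp add: mult_ac)
  also have "\<dots> > 0"
  proof (rule sum_pos2)
    show "0 < x k * (\<Sum>i<r. u i * V k i)" using k nn[OF kn] u[OF kn] by simp
    show "\<And>j. j \<in> {..<n} \<Longrightarrow> 0 \<le> x j * (\<Sum>i<r. u i * V j i)" using nn u by (simp add: less_imp_le)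
  qed (use kn in auto)
  finally show False by simp
qed

section \<open>Matrices as polynomial functions of two variables\<close>

definition meval :: "nat \<Rightarrow> rmat \<Rightarrow> real \<Rightarrow> real \<Rightarrow> real" where
  "meval n A x y = (\<Sum>s\<le>n. \<Sum>t\<le>n. A s t * x ^ (n - s) * y ^ t)"

lemma meval_inj:
  assumes "\<And>s t. \<not> (s \<le> n \<and> t \<le> n) \<Longrightarrow> A s t = 0" "\<And>s t. \<not> (s \<le> n \<and> t \<le> n) \<Longrightarrow> B s t = 0"
    and "\<And>x y. meval n A x y = meval n B x y"
  shows "A = B"
proof (rule ext, rule ext)
  fix s t
  show "A s t = B s t"
  proof (cases "s \<le> n \<and> t \<le> n")
    case True
    have ev: "meval n C x y = (\<Sum>s\<le>n. (\<Sum>t\<le>n. C (n - s) t * y ^ t) * x ^ s)" for C x y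
    proof -
      have "meval n C x y = (\<Sum>s\<le>n. (\<Sum>t\<le>n. C s t * y ^ t) * x ^ (n - s))"
        unfolding meval_def by (simp add: sum_distrib_left sum_distrib_right mult_ac)
      also have "\<dots> = (\<Sum>s\<le>n. (\<Sum>t\<le>n. C (n - s) t * y ^ t) * x ^ (n - (n - s)))"
        by (subst sum_atMost_rev[of "\<lambda>s. (\<Sum>t\<le>n. C s t * y ^ t) * x ^ (n - s)", symmetric]) (rule refl)
      also have "\<dots> = (\<Sum>s\<le>n. (\<Sum>t\<le>n. C (n - s) t * y ^ t) * x ^ s)" by (rule sum.cong) auto
      finally show ?thesis .
    qed
    have "(\<Sum>t\<le>n. A (n - (n - s)) t * y ^ t) = (\<Sum>t\<le>n. B (n - (n - s)) t * y ^ t)" for y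
    proof -
      have "\<forall>x. (\<Sum>s\<le>n. (\<Sum>t\<le>n. A (n - s) t * y ^ t) * x ^ s) = (\<Sum>s\<le>n. (\<Sum>t\<le>n. B (n - s) t * y ^ t) * x ^ s)"
        using assms(3)[of _ y, unfolded ev] by blast
      from this[unfolded polyfun_eq_coeffs, rule_format, of "n - s"] show ?thesis by simp
    qed
    then have "\<forall>y. (\<Sum>t\<le>n. A s t * y ^ t) = (\<Sum>t\<le>n. B s t * y ^ t)" using True by simp
    then show ?thesis unfolding polyfun_eq_coeffs using True by auto
  qed (use assms in simp)
qed

lemma prod_wt:
  assumes "F \<in> choices {..<n} (\<lambda>_. {-1, 0, 1})"
  shows "(\<Prod>j<n. wt x y (F j)) = x ^ (n - (card (pos_part n F) + card (neg_part n F))) * y ^ card (neg_part n F)"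
    and "card (pos_part n F) + card (neg_part n F) \<le> n"
proof -
  let ?Z = "{j\<in>{..<n}. F j = 0}"
  have v: "F j \<in> {-1, 0, 1}" if "j < n" for j using assms that by (auto simp: choices_def)
  have fin: "finite (pos_part n F)" "finite (neg_part n F)" by (auto simp: pos_part_def neg_part_def)
  have pn: "card (pos_part n F \<union> neg_part n F) = card (pos_part n F) + card (neg_part n F)"
    using fin by (intro card_Un_disjoint) (auto simp: pos_part_def neg_part_def)
  have "{..<n} = ?Z \<union> (pos_part n F \<union> neg_part n F)" using v by (auto simp: pos_part_def neg_part_def)
  then have "n = card (?Z \<union> (pos_part n F \<union> neg_part n F))" by (metis card_lessThan)
  also have "\<dots> = card ?Z + card (pos_part n F \<union> neg_part n F)"
    using fin by (intro card_Un_disjoint) (auto simp: pos_part_def neg_part_def)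
  finally have n: "n = card ?Z + (card (pos_part n F) + card (neg_part n F))" using pn by simp
  then show "card (pos_part n F) + card (neg_part n F) \<le> n" by simp
  have "(\<Prod>j<n. wt x y (F j)) = (\<Prod>j<n. (if F j = 0 then x else 1) * (if F j = -1 then y else 1))"
    by (rule prod.cong) (auto simp: wt_def)
  also have "\<dots> = (\<Prod>j<n. if F j = 0 then x else 1) * (\<Prod>j<n. if F j = -1 then y else 1)"
    by (rule prod.distrib)
  also have "(\<Prod>j<n. if F j = 0 then x else 1) = x ^ card ?Z" 
    by (simp add: prod.If_cases Int_def)
  also have "(\<Prod>j<n. if F j = -1 then y else 1) = y ^ card (neg_part n F)" 
    by (simp add: prod.If_cases Int_def neg_part_def)
  finally show "(\<Prod>j<n. wt x y (F j)) = x ^ (n - (card (pos_part n F) + card (neg_part n F))) * y ^ card (neg_part n F)"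
    using n by (metis diff_add_inverse2)
qed

text \<open>The row index \<open>s\<close> counts the nonzero entries of a sign vector, so the
  exponent \<open>n - s\<close> in \<open>meval\<close> counts its zeros.\<close>

lemma fstar_meval:
  assumes "uniform_space {..<n} M (deps n r V)"
  shows "meval n (fstar n r V) x y = fpoly {..<n} (deps n r V) x y"
proof -
  interpret uniform_space "{..<n}" M "deps n r V" by fact
  let ?L = "sgns (deps n r V)"
  let ?t = "\<lambda>F. card (neg_part n F)"
  let ?s = "\<lambda>F. card (pos_part n F) + ?t F"
  have "fstar n r V s t * x ^ (n - s) * y ^ t
      = (\<Sum>F\<in>?L. if ?t F = t then if ?s F = s then x ^ (n - s) * y ^ t else 0 else 0)" for s t
  proof -
    have "(\<Sum>F\<in>?L. if ?t F = t then if ?s F = s then x ^ (n - s) * y ^ t else 0 else 0)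
        = (\<Sum>F\<in>?L. if ?t F = t \<and> card (pos_part n F) + t = s then x ^ (n - s) * y ^ t else 0)"
      by (rule sum.cong) auto
    also have "\<dots> = real (card {F\<in>?L. ?t F = t \<and> card (pos_part n F) + t = s}) * (x ^ (n - s) * y ^ t)"
      by (simp add: sum.If_cases finite_sgns Int_def)
    finally show ?thesis by (simp add: fstar_def sign_vectors_eq_sgns)
  qed
  then have "meval n (fstar n r V) x y
      = (\<Sum>s\<le>n. \<Sum>F\<in>?L. \<Sum>t\<le>n. if ?t F = t then if ?s F = s then x ^ (n - s) * y ^ t else 0 else 0)"
    unfolding meval_def by (subst sum.swap) simp
  also have "\<dots> = (\<Sum>F\<in>?L. \<Sum>s\<le>n. \<Sum>t\<le>n. if ?t F = t then if ?s F = s then x ^ (n - s) * y ^ t else 0 else 0)"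
    by (rule sum.swap)
  also have "\<dots> = (\<Sum>F\<in>?L. \<Prod>j<n. wt x y (F j))"
  proof (rule sum.cong[OF refl])
    fix F assume "F \<in> ?L"
    then have F: "F \<in> choices {..<n} (\<lambda>_. {-1, 0, 1})" using sgns_subset by blast
    then show "(\<Sum>s\<le>n. \<Sum>t\<le>n. if ?t F = t then if ?s F = s then x ^ (n - s) * y ^ t else 0 else 0)
        = (\<Prod>j<n. wt x y (F j))"
      using prod_wt(2)[OF F] unfolding prod_wt(1)[OF F] by simp
  qed
  finally show ?thesis by (simp add: fpoly_def)
qed

lemma fstar_outside:
  assumes "\<not> (s \<le> n \<and> t \<le> n)" and "uniform_space {..<n} M (deps n r V)"
  shows "fstar n r V s t = 0"
proof -
  interpret uniform_space "{..<n}" M "deps n r V" by fact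
  have "card (neg_part n F) + card (pos_part n F) \<le> n" if "F \<in> sgns (deps n r V)" for F
    using prod_wt(2)[of F n] sgns_subset that by (auto simp: add.commute)
  then have "{F \<in> sgns (deps n r V). card (neg_part n F) = t \<and> card (pos_part n F) + t = s} = {}"
    using assms(1) by fastforce
  then show ?thesis unfolding fstar_def sign_vectors_eq_sgns by (simp only: card.empty of_nat_0)
qed

section \<open>Degrees of \<open>S_poly\<close> and linearity of \<open>S_map\<close>\<close>

definition bideg_le :: "nat \<Rightarrow> nat \<Rightarrow> real poly poly \<Rightarrow> bool" where
  "bideg_le a b P \<longleftrightarrow> (\<forall>t. degree (coeff P t) \<le> a) \<and> degree P \<le> b"

lemma bideg_le_mono: "bideg_le a b P \<Longrightarrow> a \<le> a' \<Longrightarrow> b \<le> b' \<Longrightarrow> bideg_le a' b' P"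
  unfolding bideg_le_def by (meson order_trans)

lemma bideg_le_mult:
  assumes "bideg_le a b P" "bideg_le a' b' Q"
  shows "bideg_le (a + a') (b + b') (P * Q)"
proof -
  have "degree (coeff (P * Q) t) \<le> a + a'" for t
    unfolding coeff_mult
  proof (rule degree_sum_le)
    fix i
    have "degree (coeff P i * coeff Q (t - i)) \<le> degree (coeff P i) + degree (coeff Q (t - i))"
      by (rule degree_mult_le)
    also have "\<dots> \<le> a + a'" using assms by (intro add_mono) (auto simp: bideg_le_def)
    finally show "degree (coeff P i * coeff Q (t - i)) \<le> a + a'" .
  qed simp
  moreover have "degree (P * Q) \<le> b + b'"
    using degree_mult_le[of P Q] assms by (simp add: bideg_le_def)
  ultimately show ?thesis by (simp add: bideg_le_def)
qed

lemma bideg_le_1: "bideg_le 0 0 1"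
  by (auto simp: bideg_le_def coeff_1)

lemma bideg_le_power: "bideg_le a b P \<Longrightarrow> bideg_le (k * a) (k * b) (P ^ k)"
  by (induction k) (auto intro: bideg_le_1 bideg_le_mult)

lemma bideg_le_sum:
  assumes "\<And>i. i \<in> I \<Longrightarrow> bideg_le a b (f i)"
  shows "bideg_le a b (\<Sum>i\<in>I. f i)"
proof (cases "finite I")
  case True
  then show ?thesis
    using assms unfolding bideg_le_def by (auto simp: coeff_sum intro!: degree_sum_le)
qed (simp add: bideg_le_def)

text \<open>With degree at most \<open>n\<close> in each variable, no coefficient is lost by the
  truncation in \<open>S_map\<close>.\<close>

lemma bideg_le_S_poly:
  assumes "r \<le> n" shows "bideg_le n n (S_poly n r g)"
proof -
  have 1: "bideg_le 1 1 [:[:0, 1:], 1:]"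
    by (auto simp: bideg_le_def coeff_pCons split: nat.split)
  have 2: "bideg_le 1 0 [:[:1, 1:]:]"
    by (auto simp: bideg_le_def coeff_pCons split: nat.split)
  have 3: "bideg_le 0 j (monom 1 j)" for j
    by (auto simp: bideg_le_def degree_monom_le)
  have 4: "bideg_le 0 0 [:[:c:]:]" for c
    by (auto simp: bideg_le_def coeff_pCons split: nat.split)
  have "bideg_le n n (smult [:g j k:] ([:[:0, 1:], 1:] ^ k * [:[:1, 1:]:] ^ (n - r - k) * monom 1 j))"
    if "j \<le> r" "k \<le> n - r" for j k
  proof (rule bideg_le_mono)
    have "bideg_le (0 + ((k * 1 + (n - r - k) * 1) + 0)) (0 + ((k * 1 + (n - r - k) * 0) + j))
      ([:[:g j k:]:] * ([:[:0, 1:], 1:] ^ k * [:[:1, 1:]:] ^ (n - r - k) * monom 1 j))"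
      by (intro bideg_le_mult bideg_le_power 1 2 3 4)
    then show "bideg_le (0 + ((k * 1 + (n - r - k) * 1) + 0)) (0 + ((k * 1 + (n - r - k) * 0) + j))
      (smult [:g j k:] ([:[:0, 1:], 1:] ^ k * [:[:1, 1:]:] ^ (n - r - k) * monom 1 j))" by simp
  qed (use that assms in auto)
  then have "bideg_le n n (\<Sum>j\<le>r. \<Sum>k\<le>n-r. smult [:g j k:] ([:[:0, 1:], 1:] ^ k * [:[:1, 1:]:] ^ (n - r - k) * monom 1 j))"
    by (intro bideg_le_sum) auto
  then show ?thesis by (simp add: bideg_le_def S_poly_def)
qed

lemma poly_sum_upto:
  fixes p :: "'a::comm_semiring_1 poly"
  assumes "degree p \<le> n" shows "poly p x = (\<Sum>i\<le>n. coeff p i * x ^ i)"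
  unfolding poly_altdef using assms by (intro sum.mono_neutral_left) (auto simp: coeff_eq_0)

lemma S_map_meval:
  assumes "r \<le> n" shows "meval n (S_map n r g) x y = - gpoly r (n - r) g x y"
proof -
  note b = bideg_le_S_poly[OF assms, of g]
  have "meval n (S_map n r g) x y = (\<Sum>s\<le>n. \<Sum>t\<le>n. coeff (coeff (S_poly n r g) t) (n - s) * x ^ (n - s) * y ^ t)"
    unfolding meval_def by (intro sum.cong refl) (auto simp: S_map_def)
  also have "\<dots> = (\<Sum>s\<le>n. \<Sum>t\<le>n. coeff (coeff (S_poly n r g) t) s * x ^ s * y ^ t)"
    by (rule sum_atMost_rev)
  also have "\<dots> = (\<Sum>t\<le>n. poly (coeff (S_poly n r g) t) x * y ^ t)"
    using b by (subst sum.swap) (simp add: bideg_le_def poly_sum_upto[of _ n] sum_distrib_right)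
  also have "\<dots> = poly (poly (S_poly n r g) [:y:]) x"
    using b by (subst poly_sum_upto[of "S_poly n r g" n]) (auto simp: bideg_le_def poly_sum poly_power)
  also have "\<dots> = - gpoly r (n - r) g x y"
    unfolding S_poly_def gpoly_def
    by (simp add: poly_sum poly_monom sum_distrib_left algebra_simps)
  finally show ?thesis .
qed

lemma S_map_outside: "\<not> (s \<le> n \<and> t \<le> n) \<Longrightarrow> S_map n r g s t = 0"
  by (auto simp: S_map_def)

lemma meval_sum:
  "meval n (\<lambda>s t. \<Sum>i\<in>I. c i * A i s t) x y = (\<Sum>i\<in>I. c i * meval n (A i) x y)"
proof (induction I rule: infinite_finite_induct)
  case (insert i I)
  have "meval n (\<lambda>s t. c i * A i s t + B s t) x y = c i * meval n (A i) x y + meval n B x y" for B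
    by (simp add: meval_def algebra_simps sum.distrib sum_distrib_left)
  then show ?case using insert by simp
qed (simp_all add: meval_def)

lemma gpoly_sum:
  "gpoly r M (\<lambda>j k. \<Sum>i\<in>I. c i * G i j k) x y = (\<Sum>i\<in>I. c i * gpoly r M (G i) x y)"
proof (induction I rule: infinite_finite_induct)
  case (insert i I)
  then show ?case by (simp add: gpoly_add gpoly_scale)
qed (simp_all add: gpoly_def)

lemma S_map_sum:
  assumes "r \<le> n"
  shows "S_map n r (\<lambda>j k. \<Sum>i\<in>I. c i * G i j k) = (\<lambda>s t. \<Sum>i\<in>I. c i * S_map n r (G i) s t)"
proof (rule meval_inj)
  show "meval n (S_map n r (\<lambda>j k. \<Sum>i\<in>I. c i * G i j k)) x y
     = meval n (\<lambda>s t. \<Sum>i\<in>I. c i * S_map n r (G i) s t) x y" for x y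
    unfolding meval_sum by (simp add: S_map_meval[OF assms] gpoly_sum sum_negf)
qed (simp_all add: S_map_outside)

lemma S_map_diff:
  assumes "r \<le> n"
  shows "S_map n r (\<lambda>j k. g j k - h j k) = S_map n r g - S_map n r h"
  using S_map_sum[OF assms, where I=UNIV and c="\<lambda>b. if b then 1 else -1"
      and G="\<lambda>b. if b then g else h"]
  by (simp add: UNIV_bool fun_eq_iff)

text \<open>Injectivity of \<open>S_map\<close>, inherited from the uniqueness of coefficients in
  \<open>gpoly\<close>.\<close>

lemma S_map_eq_0D:
  assumes "r \<le> n" "S_map n r g = (\<lambda>_ _. 0)" "j \<le> r" "k \<le> n - r"
  shows "g j k = 0"
proof (rule gpoly_eq_0[OF _ assms(3,4)])
  fix x y
  show "gpoly r (n - r) g x y = 0"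
    using S_map_meval[OF assms(1), of g x y] assms(2) by (simp add: meval_def)
qed

lemma fstar_S_mapI:
  assumes "V \<in> V0_set n r" "W \<in> V0_set n r" "r \<le> n"
    and "\<And>x y. fpoly {..<n} (deps n r V) x y = fpoly {..<n} (deps n r W) x y - gpoly r (n - r) g x y"
  shows "fstar n r V = fstar n r W + S_map n r g"
proof (rule meval_inj)
  have u: "uniform_space {..<n} (n - r) (deps n r V)" "uniform_space {..<n} (n - r) (deps n r W)"
    using assms by (auto simp: V0_set_def intro: deps_uniform)
  show "fstar n r V s t = 0" "(fstar n r W + S_map n r g) s t = 0" if "\<not> (s \<le> n \<and> t \<le> n)" for s t
    using that u by (simp_all add: fstar_outside S_map_outside)
  show "meval n (fstar n r V) x y = meval n (fstar n r W + S_map n r g) x y" for x y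
  proof -
    have "meval n (fstar n r W + S_map n r g) x y = meval n (fstar n r W) x y + meval n (S_map n r g) x y"
      by (simp add: meval_def sum.distrib algebra_simps)
    then show ?thesis using assms(4) by (simp add: fstar_meval[OF u(1)] fstar_meval[OF u(2)] S_map_meval[OF assms(3)])
  qed
qed

lemma fstar_difference:
  assumes "V \<in> V0_set n r" "W \<in> V0_set n r" "r \<le> n"
  obtains g where "g \<in> G0_space n r" "fstar n r V = fstar n r W + S_map n r g"
proof -
  have u: "uniform_space {..<n} (n - r) (deps n r V)" "uniform_space {..<n} (n - r) (deps n r W)"
    using assms by (auto simp: V0_set_def intro: deps_uniform)
  have p: "\<And>F. F \<in> sgns (deps n r V) \<Longrightarrow> \<exists>j\<in>{..<n}. F j = -1"
    "\<And>F. F \<in> sgns (deps n r W) \<Longrightarrow> \<exists>j\<in>{..<n}. F j = -1"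
    using assms by (auto simp: V0_set_def intro: pointed_sign_vector)
  obtain g where "g \<in> G0_space (n - r + r) r"
    "\<And>x y. fpoly {..<n} (deps n r V) x y = fpoly {..<n} (deps n r W) x y - gpoly r (n - r) g x y"
    using fpoly_diff_G0[OF u, of r] p assms(3) by auto
  then show thesis using that fstar_S_mapI[OF assms] assms(3) by simp
qed

section \<open>A basis of \<open>G0_space\<close>\<close>

lemma G0_spaceI:
  assumes "\<And>j k. j > r \<or> k > n - r \<Longrightarrow> g j k = 0"
    and j: "\<And>j k. j \<le> r \<Longrightarrow> k \<le> n - r \<Longrightarrow> g (r - j) k = - g j k"
    and k: "\<And>j k. j \<le> r \<Longrightarrow> k \<le> n - r \<Longrightarrow> g j (n - r - k) = - g j k"
    and "\<And>k. k \<le> n - r \<Longrightarrow> g 0 k = 0"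
  shows "g \<in> G0_space n r"
proof -
  have "g j k = - g (r - j) k \<and> g j k = - g j (n - r - k) \<and> g j k = g (r - j) (n - r - k)"
    if "j \<le> r" "k \<le> n - r" for j k
    using j[OF that] k[OF that] k[of "r - j" k] that by linarith
  then show ?thesis using assms(1,4) unfolding G0_space_def by blast
qed

lemma G0_spaceD:
  assumes "g \<in> G0_space n r"
  shows "j > r \<or> k > n - r \<Longrightarrow> g j k = 0"
    and "j \<le> r \<Longrightarrow> k \<le> n - r \<Longrightarrow> g (r - j) k = - g j k"
    and "j \<le> r \<Longrightarrow> k \<le> n - r \<Longrightarrow> g j (n - r - k) = - g j k"
    and "k \<le> n - r \<Longrightarrow> g 0 k = 0"
proof -
  have *: "g j k = - g (r - j) k \<and> g j k = - g j (n - r - k)" if "j \<le> r" "k \<le> n - r"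
    using assms that unfolding G0_space_def by blast
  show "j \<le> r \<Longrightarrow> k \<le> n - r \<Longrightarrow> g (r - j) k = - g j k"
    and "j \<le> r \<Longrightarrow> k \<le> n - r \<Longrightarrow> g j (n - r - k) = - g j k"
    using * by linarith+
qed (use assms in \<open>unfold G0_space_def, blast+\<close>)

text \<open>The matrix unit at \<open>(p, q)\<close>, antisymmetrised under both reflections; it
  vanishes if \<open>p\<close> or \<open>q\<close> is the centre of its range.\<close>

definition G0_basis :: "nat \<Rightarrow> nat \<Rightarrow> nat \<Rightarrow> nat \<Rightarrow> rmat" where
  "G0_basis r M p q = (\<lambda>j k. if j \<le> r \<and> k \<le> M
     then (of_bool (j = p) - of_bool (j = r - p)) * (of_bool (k = q) - of_bool (k = M - q)) else 0)"

text \<open>All of \<open>A\<close> lies strictly below the centre, so at most one of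
  \<open>j\<close> and \<open>r - j\<close> belongs to it, and that one contributes with the right
  sign.\<close>

lemma antisymmetric_expansion:
  fixes h :: "nat \<Rightarrow> real"
  assumes "finite A" "j \<le> r" "\<And>p. p \<in> A \<Longrightarrow> 2 * p < r"
    and "h (r - j) = - h j" "h j = 0 \<or> j \<in> A \<or> r - j \<in> A"
  shows "(\<Sum>p\<in>A. h p * (of_bool (j = p) - of_bool (j = r - p))) = h j"
proof -
  have "(\<Sum>p\<in>A. h p * (of_bool (j = p) - of_bool (j = r - p)))
      = (\<Sum>p\<in>A. (if p = j then h p else 0) - (if p = r - j then h p else 0))"
    using assms(2,3) by (intro sum.cong refl) (force simp: of_bool_def)
  also have "\<dots> = (if j \<in> A then h j else 0) - (if r - j \<in> A then h (r - j) else 0)"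
    using assms(1) by (simp add: sum_subtractf)
  also have "\<dots> = h j"
    using assms(3)[of j] assms(3)[of "r - j"] assms(2,4,5) by auto
  finally show ?thesis .
qed

text \<open>The index set holds one representative for each mirror pair of rows and of columns.
  Central rows and columns vanish by antisymmetry, rows 0 and \<open>r\<close> by the boundary
  condition; hence the two floors in the dimension.\<close>

lemma G0_expansion:
  assumes g: "g \<in> G0_space n r"
  shows "g = (\<lambda>j k. \<Sum>i\<in>{1..(r - 1) div 2} \<times> {..<(n - r + 1) div 2}.
     g (fst i) (snd i) * G0_basis r (n - r) (fst i) (snd i) j k)" (is "_ = ?h")
proof (rule ext, rule ext)
  fix j k
  let ?P = "{1..(r - 1) div 2}" and ?Q = "{..<(n - r + 1) div 2}" and ?M = "n - r"
  show "g j k = ?h j k"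
  proof (cases "j \<le> r \<and> k \<le> ?M")
    case False
    then show ?thesis using G0_spaceD(1)[OF g, of j k] by (auto simp: G0_basis_def not_le)
  next
    case True
    have as: "g (r - j) k = - g j k" "g j (?M - k) = - g j k" if "j \<le> r" "k \<le> ?M" for j k
      using G0_spaceD(2,3)[OF g that] by simp_all
    have g0: "g 0 k = 0" if "k \<le> ?M" for k using G0_spaceD(4)[OF g that] .
    have "(\<Sum>q\<in>?Q. g p q * (of_bool (k = q) - of_bool (k = ?M - q))) = g p k" if "p \<le> r" for p
    proof (rule antisymmetric_expansion)
      show "g p k = 0 \<or> k \<in> ?Q \<or> ?M - k \<in> ?Q"
      proof (cases "2 * k = ?M")
        case True
        then have "?M - k = k" by simp
        then show ?thesis using as(2)[OF that, of k] \<open>j \<le> r \<and> k \<le> ?M\<close> by simp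
      next
        case False
        then have "k \<in> ?Q \<or> ?M - k \<in> ?Q" using True by auto
        then show ?thesis by blast
      qed
    qed (use True that as in auto)
    then have inner: "(\<Sum>q\<in>?Q. g p q * (of_bool (k = q) - of_bool (k = ?M - q))) = g p k" if "p \<in> ?P" for p
      using that by auto
    have "?h j k = (\<Sum>p\<in>?P. \<Sum>q\<in>?Q. g p q * G0_basis r ?M p q j k)"
      by (simp add: sum.cartesian_product split_def)
    also have "\<dots> = (\<Sum>p\<in>?P. (\<Sum>q\<in>?Q. g p q * (of_bool (k = q) - of_bool (k = ?M - q))) * (of_bool (j = p) - of_bool (j = r - p)))"
      unfolding sum_distrib_right using True by (intro sum.cong refl) (simp add: G0_basis_def)
    also have "\<dots> = (\<Sum>p\<in>?P. g p k * (of_bool (j = p) - of_bool (j = r - p)))"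
      by (rule sum.cong) (simp_all only: inner)
    also have "\<dots> = g j k"
    proof (rule antisymmetric_expansion)
      show "g j k = 0 \<or> j \<in> ?P \<or> r - j \<in> ?P"
      proof (cases "2 * j = r \<or> j = 0 \<or> j = r")
        case True
        then have "g j k = 0" using as(1)[of j k] g0[of k] \<open>j \<le> r \<and> k \<le> ?M\<close> by auto
        then show ?thesis by blast
      next
        case False
        then have "j \<in> ?P \<or> r - j \<in> ?P" using True by auto
        then show ?thesis by blast
      qed
    qed (use True as in auto)
    finally show ?thesis by simp
  qed
qed

lemma G0_basis_mem:
  assumes "1 \<le> p" "p < r" "q \<le> n - r"
  shows "G0_basis r (n - r) p q \<in> G0_space n r"
proof (rule G0_spaceI)
  show "G0_basis r (n - r) p q (r - j) k = - G0_basis r (n - r) p q j k"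
    if "j \<le> r" "k \<le> n - r" for j k
  proof -
    have "r - j = p \<longleftrightarrow> j = r - p" "r - j = r - p \<longleftrightarrow> j = p" using that assms by auto
    then show ?thesis using that by (simp add: G0_basis_def algebra_simps)
  qed
  show "G0_basis r (n - r) p q j (n - r - k) = - G0_basis r (n - r) p q j k"
    if "j \<le> r" "k \<le> n - r" for j k
  proof -
    define M where "M = n - r"
    have "M - k = q \<longleftrightarrow> k = M - q" "M - k = M - q \<longleftrightarrow> k = q" using that assms by (auto simp: M_def)
    then show ?thesis using that unfolding M_def[symmetric] by (simp add: G0_basis_def algebra_simps)
  qed
qed (use assms in \<open>auto simp: G0_basis_def\<close>)

lemma G0_lincomb:
  assumes "\<And>i. i \<in> I \<Longrightarrow> G i \<in> G0_space n r"
  shows "(\<lambda>j k. \<Sum>i\<in>I. c i * G i j k) \<in> G0_space n r"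
proof -
  have neg: "(\<Sum>i\<in>I. c i * G i j' k') = - (\<Sum>i\<in>I. c i * G i j k)"
    if "\<And>i. i \<in> I \<Longrightarrow> G i j' k' = - G i j k" for j k j' k'
    using that by (simp add: sum_negf[symmetric])
  show ?thesis
  proof (rule G0_spaceI)
    show "(\<Sum>i\<in>I. c i * G i (r - j) k) = - (\<Sum>i\<in>I. c i * G i j k)" if "j \<le> r" "k \<le> n - r" for j k
      by (rule neg) (rule G0_spaceD(2)[OF assms that])
    show "(\<Sum>i\<in>I. c i * G i j (n - r - k)) = - (\<Sum>i\<in>I. c i * G i j k)" if "j \<le> r" "k \<le> n - r" for j k
      by (rule neg) (rule G0_spaceD(3)[OF assms that])
  qed (auto intro!: sum.neutral simp: G0_spaceD(1,4)[OF assms])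
qed

section \<open>Mutations\<close>

lemma indep_subset:
  assumes "indep r V B" "finite B" "A \<subseteq> B"
  shows "indep r V A"
  unfolding indep_def
proof (intro allI impI ballI)
  fix c j assume c: "\<forall>i<r. (\<Sum>j\<in>A. c j * V j i) = 0" and j: "j \<in> A"
  let ?d = "\<lambda>j. if j \<in> A then c j else 0"
  have "(\<Sum>j\<in>B. ?d j * V j i) = (\<Sum>j\<in>A. c j * V j i)" for i
    using assms by (intro sum.mono_neutral_cong_right) auto
  then have "?d j = 0" using c j assms by (intro indepD[OF assms(1), of ?d j]) auto
  then show "c j = 0" using j by simp
qed

lemma indep_cong: "(\<And>j i. j \<in> B \<Longrightarrow> V j i = W j i) \<Longrightarrow> indep r V B \<longleftrightarrow> indep r W B"
  unfolding indep_def by (simp cong: sum.cong)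

lemma hyperplane_normal:
  assumes "finite B" "card B < r"
  obtains h where "\<exists>i<r. h i \<noteq> 0" "\<And>b. b \<in> B \<Longrightarrow> (\<Sum>i<r. h i * V b i) = (0::real)"
proof -
  obtain e where e: "bij_betw e {0..<card B} B"
    using ex_bij_betw_nat_finite[OF assms(1)] by blast
  obtain h where h: "\<exists>i\<in>{..<r}. h i \<noteq> 0" "\<And>l. l < card B \<Longrightarrow> (\<Sum>i<r. h i * V (e l) i) = 0"
    using underdetermined_system[of "{..<r}" "card B" "\<lambda>i l. V (e l) i"] assms by auto
  show thesis
  proof (rule that)
    show "\<exists>i<r. h i \<noteq> 0" using h(1) by auto
    fix b assume "b \<in> B"
    then have "b \<in> e ` {0..<card B}" using bij_betw_imp_surj_on[OF e] by simp
    then obtain l where "l < card B" "b = e l" by auto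
    then show "(\<Sum>i<r. h i * V b i) = 0" using h(2) by simp
  qed
qed

text \<open>Pairing a dependency with the normal \<open>h\<close> isolates the coefficient of
  \<open>a\<close>.\<close>

lemma indep_insert_normal:
  assumes "indep r V B" "finite B" "a \<notin> B"
    and "\<And>b. b \<in> B \<Longrightarrow> (\<Sum>i<r. h i * V b i) = 0" "(\<Sum>i<r. h i * V a i) \<noteq> 0"
  shows "indep r V (insert a B)"
  unfolding indep_def
proof (intro allI impI)
  fix c assume c: "\<forall>i<r. (\<Sum>j\<in>insert a B. c j * V j i) = 0"
  have "0 = (\<Sum>i<r. h i * (\<Sum>j\<in>insert a B. c j * V j i))" using c by simp
  also have "\<dots> = (\<Sum>j\<in>insert a B. c j * (\<Sum>i<r. h i * V j i))"
    unfolding sum_distrib_left by (subst sum.swap) (simp add: mult_ac)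
  also have "\<dots> = c a * (\<Sum>i<r. h i * V a i)" using assms by simp
  finally have "c a = 0" using assms(5) by simp
  then show "\<forall>j\<in>insert a B. c j = 0"
    using c assms(2,3) indepD[OF assms(1), of c] by auto
qed

text \<open>Along the shifted moment curve each linear form is a nonzero polynomial in \<open>\<tau>\<close>.\<close>
lemma moment_curve_avoids:
  fixes h :: "'a \<Rightarrow> nat \<Rightarrow> real"
  assumes "finite A" "\<And>a. a \<in> A \<Longrightarrow> \<exists>i<r. h a i \<noteq> 0"
  obtains \<tau> where "0 < \<tau>" "\<tau> < 1" "\<And>a. a \<in> A \<Longrightarrow> (\<Sum>i<r. h a i * (p i + \<tau> ^ Suc i)) \<noteq> 0"
proof -
  have "finite {\<tau>. (\<Sum>i<r. h a i * (p i + \<tau> ^ Suc i)) = 0}" if "a \<in> A" for a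
  proof -
    \<comment> \<open>The exponents start at 1, so the base point \<open>p\<close> enters only the
      constant coefficient and cannot cancel a nonzero \<open>h a i\<close>.\<close>
    let ?d = "\<lambda>k. case k of 0 \<Rightarrow> \<Sum>i<r. h a i * p i | Suc i \<Rightarrow> h a i"
    obtain i where i: "i < r" "h a i \<noteq> 0" using assms(2) \<open>a \<in> A\<close> by blast
    then have "\<exists>k\<le>r. ?d k \<noteq> 0" by (intro exI[of _ "Suc i"]) auto
    then have "finite {\<tau>. (\<Sum>k\<le>r. ?d k * \<tau> ^ k) = 0}" by (subst polyfun_finite_roots)
    moreover have "(\<Sum>k\<le>r. ?d k * \<tau> ^ k) = (\<Sum>i<r. h a i * (p i + \<tau> ^ Suc i))" for \<tau>
      by (subst sum.atMost_shift) (simp add: sum.distrib[symmetric] algebra_simps)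
    ultimately show ?thesis by simp
  qed
  then have "finite (\<Union>a\<in>A. {\<tau>. (\<Sum>i<r. h a i * (p i + \<tau> ^ Suc i)) = 0})" using assms(1) by blast
  then have "infinite ({0<..<1} - (\<Union>a\<in>A. {\<tau>. (\<Sum>i<r. h a i * (p i + \<tau> ^ Suc i)) = 0}))"
    by (intro Diff_infinite_finite infinite_Ioo) auto
  then obtain \<tau> where "\<tau> \<in> {0<..<1} - (\<Union>a\<in>A. {\<tau>. (\<Sum>i<r. h a i * (p i + \<tau> ^ Suc i)) = 0})"
    using infinite_imp_nonempty by blast
  then show thesis using that[of \<tau>] by auto
qed

text \<open>Exactly \<open>p\<close> entries are negative. They are as large as
  \<open>- real r\<close> because the coordinates of column 0 below are negated circuit entries and
  their sum must be positive for pointedness.\<close>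

definition circ :: "nat \<Rightarrow> nat \<Rightarrow> nat \<Rightarrow> real" where
  "circ r p j = (if 1 \<le> j \<and> j \<le> p then - real r else 1)"

text \<open>Configurations of \<open>r + N\<close> vectors in \<open>\<real>\<^sup>r\<close> whose only violation of general position
  is that the first \<open>r\<close> vectors lie in a coordinate hyperplane, with circuit \<open>circ r p\<close>;
  \<open>min k N\<close> of the other vectors lie on the positive side.\<close>
locale degenerate_config =
  fixes r p k N :: nat and V :: rmat
  assumes p: "1 \<le> p" "p < r"
    and outside: "r + N \<le> j \<or> r \<le> i \<Longrightarrow> V j i = 0"
    and col_0: "i < r - 1 \<Longrightarrow> V 0 i = - circ r p (Suc i)"
    and col_unit: "1 \<le> j \<Longrightarrow> j < r \<Longrightarrow> V j i = of_bool (Suc i = j)"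
    and col_0_last: "V 0 (r - 1) = 0"
    and col_pos: "r \<le> q \<Longrightarrow> q < r + N \<Longrightarrow> i < r - 1 \<Longrightarrow> V q i > 0"
    and last_pos: "r \<le> q \<Longrightarrow> q < r + k \<Longrightarrow> q < r + N \<Longrightarrow> V q (r - 1) > 0"
    and last_neg: "r + k \<le> q \<Longrightarrow> q < r + N \<Longrightarrow> V q (r - 1) < 0"
    and indep_small: "B \<subseteq> {..<r + N} \<Longrightarrow> card B = r - 1 \<Longrightarrow> indep r V B"
    and indep_big: "B \<subseteq> {..<r + N} \<Longrightarrow> card B = r \<Longrightarrow> B \<noteq> {..<r} \<Longrightarrow> indep r V B"

text \<open>Induction on the number of further vectors. A new vector is taken off finitely many
  hyperplanes, one containing each \<open>r - 1\<close> of the old vectors, so every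
  \<open>r\<close>-set through it is independent.\<close>

lemma degenerate_config_exists:
  assumes "1 \<le> p" "p < r"
  shows "\<exists>V. degenerate_config r p k N V"
proof (induction N)
    case 0
    define V where "V = (\<lambda>j i. if j = 0 then if i < r - 1 then - circ r p (Suc i) else 0
      else if j < r then of_bool (Suc i = j) else (0::real))"
    have circ0: "circ r p j \<noteq> 0" for j using assms by (simp add: circ_def)
    have "indep r V B" if B: "B \<subseteq> {..<r}" "card B = r - 1" for B
      unfolding indep_def
    proof (intro allI impI)
      fix c assume c: "\<forall>i<r. (\<Sum>j\<in>B. c j * V j i) = 0"
      define d where "d = (\<lambda>j. if j \<in> B then c j else 0)"
      \<comment> \<open>Among the first \<open>r\<close> columns, coordinate \<open>j - 1\<close>
        involves only columns 0 and \<open>j\<close>, so dependencies are multiples of the circuit.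
        \<open>B\<close> omits an index and the circuit has no zero entry, so the multiple is
        0.\<close>
      have d: "d j = d 0 * circ r p j" if j: "1 \<le> j" "j < r" for j
      proof -
        have "0 = (\<Sum>l\<in>B. c l * V l (j - 1))" using c j by simp
        also have "\<dots> = (\<Sum>l<r. d l * V l (j - 1))"
          using B by (intro sum.mono_neutral_cong_left) (auto simp: d_def)
        also have "\<dots> = (\<Sum>l\<in>{0, j}. d l * V l (j - 1))"
          using j by (intro sum.mono_neutral_right) (auto simp: V_def of_bool_def)
        also have "\<dots> = - (d 0 * circ r p j) + d j" using j by (simp add: V_def)
        finally show ?thesis by simp
      qed
      have "B \<noteq> {..<r}" using B assms by auto
      then obtain l where l: "l < r" "l \<notin> B" using B by blast
      then have "d l = 0" by (simp add: d_def)
      then have "d 0 = 0" using d[of l] circ0[of l] l by (cases "l = 0") auto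
      then have "d j = 0" if "j < r" for j using d[of j] that by (cases "j = 0") auto
      then show "\<forall>j\<in>B. c j = 0" using B by (metis d_def lessThan_iff subsetD)
    qed
    moreover have "B = {..<r}" if "B \<subseteq> {..<r}" "card B = r" for B
      using that by (intro card_subset_eq) auto
    ultimately have "degenerate_config r p k 0 V"
      by unfold_locales (use assms in \<open>auto simp: V_def\<close>)
    then show ?case by blast
  next
    case (Suc N)
    then obtain V where "degenerate_config r p k N V" by blast
    then interpret degenerate_config r p k N V .
    let ?a = "r + N"
    let ?A = "{B. B \<subseteq> {..<?a} \<and> card B = r - 1}"
    have "\<exists>h. (\<exists>i<r. h i \<noteq> 0) \<and> (\<forall>b\<in>B. (\<Sum>i<r. h i * V b i) = 0)" if "B \<in> ?A" for B
    proof -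
      have "finite B" "card B < r" using that assms finite_subset[of B "{..<?a}"] by auto
      then show ?thesis by (rule hyperplane_normal[of B r V]) blast
    qed
    then have "\<exists>h. \<forall>B\<in>?A. (\<exists>i<r. h B i \<noteq> 0) \<and> (\<forall>b\<in>B. (\<Sum>i<r. h B i * V b i) = 0)"
      by (intro bchoice ballI)
    then obtain h where h: "\<And>B. B \<in> ?A \<Longrightarrow> \<exists>i<r. h B i \<noteq> 0"
      "\<And>B b. B \<in> ?A \<Longrightarrow> b \<in> B \<Longrightarrow> (\<Sum>i<r. h B i * V b i) = 0" by blast
    \<comment> \<open>The base point fixes all signs: -1 in the last coordinate once
      \<open>k\<close> vectors lie on the positive side, and 1 elsewhere. The added powers of
      \<open>\<tau>\<close> lie between 0 and 1 and cannot change them.\<close>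
    define c where "c = (\<lambda>i. if i = r - 1 \<and> k \<le> N then -1 else (1::real))"
    obtain \<tau> where \<tau>: "0 < \<tau>" "\<tau> < 1" "\<And>B. B \<in> ?A \<Longrightarrow> (\<Sum>i<r. h B i * (c i + \<tau> ^ Suc i)) \<noteq> 0"
      using moment_curve_avoids[of ?A r h c] h(1) by auto
    define W where "W = V(?a := \<lambda>i. if i < r then c i + \<tau> ^ Suc i else 0)"
    have W: "W j = V j" if "j \<noteq> ?a" for j using that by (simp add: W_def)
    have new: "indep r W (insert ?a B)" if B: "B \<in> ?A" for B
    proof (rule indep_insert_normal[where h="h B"])
      have a: "?a \<notin> B" using B by auto
      then show "?a \<notin> B" .
      have "indep r V B" using B indep_small by blast
      then show "indep r W B" using a by (subst indep_cong[of B W V]) (auto simp: W_def)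
      show "finite B" using B finite_subset[of B "{..<?a}"] by auto
      show "(\<Sum>i<r. h B i * W b i) = 0" if "b \<in> B" for b
      proof -
        have "b \<noteq> ?a" using that a by blast
        then show ?thesis using h(2)[OF B that] by (simp add: W)
      qed
      show "(\<Sum>i<r. h B i * W ?a i) \<noteq> 0" using \<tau>(3)[OF B] by (simp add: W_def)
    qed
    have big: "indep r W B" if B: "B \<subseteq> {..<Suc ?a}" "card B = r" "?a \<in> B" for B
    proof -
      have "B - {?a} \<in> ?A" using B by (auto simp: less_Suc_eq)
      then have "indep r W (insert ?a (B - {?a}))" by (rule new)
      then show ?thesis using B by (simp add: insert_absorb)
    qed
    have old: "indep r W B \<longleftrightarrow> indep r V B" if "?a \<notin> B" for B
      using that by (intro indep_cong) (auto simp: W_def)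
    have "indep r W B" if B: "B \<subseteq> {..<Suc ?a}" "card B = r - 1" for B
    proof (cases "?a \<in> B")
      case True
      have fB: "finite B" using B finite_subset by blast
      \<comment> \<open>Some old index is missing from \<open>B\<close>; adding it gives an
        \<open>r\<close>-set through the new vector, already known to be independent.\<close>
      have "\<not> {..<?a} \<subseteq> B"
      proof
        assume "{..<?a} \<subseteq> B"
        then have "card {..<?a} \<le> card B" using fB by (intro card_mono) auto
        then show False using B assms by simp
      qed
      then obtain b where b: "b < ?a" "b \<notin> B" by blast
      have "indep r W (insert b B)"
        using B b fB True assms by (intro big) auto
      then show ?thesis by (rule indep_subset) (use fB in auto)
    next
      case False
      then have "B \<subseteq> {..<?a}" using B by (auto simp: less_Suc_eq)
      then show ?thesis using old[OF False] indep_small B by simp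
    qed
    moreover have "indep r W B" if B: "B \<subseteq> {..<Suc ?a}" "card B = r" "B \<noteq> {..<r}" for B
    proof (cases "?a \<in> B")
      case False
      then have "B \<subseteq> {..<?a}" using B by (auto simp: less_Suc_eq)
      then show ?thesis using old[OF False] indep_big B by simp
    qed (use big B in simp)
    moreover have "W q i > 0" if "r \<le> q" "q < Suc ?a" "i < r - 1" for q i
      using col_pos[of q i] that \<tau> by (cases "q = ?a") (auto simp: W_def c_def add_pos_pos)
    moreover have "W q (r - 1) > 0" if "r \<le> q" "q < r + k" "q < Suc ?a" for q
      using last_pos[of q] that \<tau> assms by (cases "q = ?a") (auto simp: W_def c_def add_pos_pos)
    moreover have "W q (r - 1) < 0" if "r + k \<le> q" "q < Suc ?a" for q
    proof -
      have "\<tau> ^ r < 1" using \<tau> assms by (intro power_less_one_iff[THEN iffD2]) auto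
      then show ?thesis using last_neg[of q] that assms by (cases "q = ?a") (auto simp: W_def c_def)
    qed
    moreover have "W 0 = V 0" using assms by (intro W) simp
    moreover have "W j = V j" if "j < r" for j using that by (intro W) simp
    moreover have "W j i = 0" if "Suc ?a \<le> j \<or> r \<le> i" for j i
      using that outside[of j i] by (auto simp: W_def)
    ultimately have "degenerate_config r p k (Suc N) W"
      by unfold_locales (use assms col_0 col_unit col_0_last in auto)
    then show ?case by blast
qed

text \<open>The vectors are functions on the naturals, so the subsequence is refined one coordinate
  at a time.\<close>

lemma Bolzano_Weierstrass_finite:
  fixes f :: "nat \<Rightarrow> nat \<Rightarrow> real"
  assumes "\<And>m j. j < n \<Longrightarrow> \<bar>f m j\<bar> \<le> 1"
  shows "\<exists>\<phi> x. strict_mono \<phi> \<and> (\<forall>j<n. (\<lambda>m. f (\<phi> m) j) \<longlonglongrightarrow> x j)"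
  using assms
proof (induction n)
  case 0
  then show ?case by (intro exI[of _ "\<lambda>m. m"]) (auto simp: strict_mono_def)
next
  case (Suc n)
  then obtain \<phi> x where \<phi>: "strict_mono \<phi>" "\<And>j. j < n \<Longrightarrow> (\<lambda>m. f (\<phi> m) j) \<longlonglongrightarrow> x j" by force
  have "f (\<phi> m) n \<in> {-1..1}" for m using Suc.prems[of n "\<phi> m"] by (auto simp: abs_le_iff)
  then obtain l \<psi> where \<psi>: "strict_mono \<psi>" "((\<lambda>m. f (\<phi> m) n) \<circ> \<psi>) \<longlonglongrightarrow> l"
    using compact_Icc[of "-1::real" 1] unfolding compact_def by (metis (no_types, lifting))
  have "(\<lambda>m. f ((\<phi> \<circ> \<psi>) m) j) \<longlonglongrightarrow> (x(n := l)) j" if "j < Suc n" for j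
  proof (cases "j = n")
    case True
    then show ?thesis using \<psi>(2) by (simp add: o_def)
  next
    case False
    then show ?thesis using LIMSEQ_subseq_LIMSEQ[OF \<phi>(2) \<psi>(1), of j] that by (simp add: o_def)
  qed
  then show ?case using strict_mono_o[OF \<phi>(1) \<psi>(1)] by blast
qed

section \<open>Pushing one vector off the degenerate hyperplane\<close>

context degenerate_config
begin

definition perturb :: "real \<Rightarrow> rmat" where
  "perturb t = (\<lambda>j i. V j i + (if j = 0 \<and> i = r - 1 then t else 0))"

abbreviation (input) "n \<equiv> r + N"

lemma sum_perturb:
  assumes "finite B"
  shows "(\<Sum>j\<in>B. c j * perturb t j i)
    = (\<Sum>j\<in>B. c j * V j i) + (if 0 \<in> B \<and> i = r - 1 then c 0 * t else 0)"
proof -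
  have "(\<Sum>j\<in>B. c j * perturb t j i)
      = (\<Sum>j\<in>B. c j * V j i) + (\<Sum>j\<in>B. if j = 0 then if i = r - 1 then c j * t else 0 else 0)"
    unfolding sum.distrib[symmetric] by (rule sum.cong) (auto simp: perturb_def algebra_simps)
  then show ?thesis using assms by simp
qed

lemma deps_perturb:
  "x \<in> deps n r (perturb t) \<longleftrightarrow> (\<forall>j\<ge>n. x j = 0) \<and>
     (\<forall>i<r. (\<Sum>j<n. x j * V j i) + (if i = r - 1 then x 0 * t else 0) = 0)"
  using p by (simp add: deps_def sum_perturb)

lemma V_last: "j < r \<Longrightarrow> V j (r - 1) = 0"
  using col_unit[of j "r - 1"] col_0_last by (cases "j = 0") (auto simp: of_bool_def)

lemma circ_nonzero: "circ r p j \<noteq> 0" and circ_0: "circ r p 0 = 1"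
  using p by (auto simp: circ_def)

lemma circuit: "(\<Sum>j<r. circ r p j * V j i) = 0"
proof (cases "i < r - 1")
  case True
  have "(\<Sum>j<r. circ r p j * V j i) = (\<Sum>j\<in>{0, Suc i}. circ r p j * V j i)"
    using True by (intro sum.mono_neutral_right) (auto simp: col_unit of_bool_def)
  also have "\<dots> = 0" using True by (simp add: col_0 col_unit circ_0)
  finally show ?thesis .
next
  case False
  then show ?thesis using V_last outside by (cases "i = r - 1") (auto intro!: sum.neutral)
qed

text \<open>Subtracting the multiple of the circuit that agrees at index 0 leaves a dependency among
  \<open>r - 1\<close> columns, which is zero.\<close>

lemma circuit_unique:
  assumes "\<And>i. i < r \<Longrightarrow> (\<Sum>j<r. d j * V j i) = 0" "j < r"
  shows "d j = d 0 * circ r p j"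
proof -
  define e where "e = (\<lambda>j. d j - d 0 * circ r p j)"
  have "indep r V {1..<r}" using p by (intro indep_small) auto
  moreover have "(\<Sum>j\<in>{1..<r}. e j * V j i) = 0" if "i < r" for i
  proof -
    have "(\<Sum>j\<in>{1..<r}. e j * V j i) = (\<Sum>j<r. e j * V j i)"
      by (rule sum.mono_neutral_left) (auto simp: e_def circ_0 not_less_eq_eq)
    also have "\<dots> = (\<Sum>j<r. d j * V j i) - d 0 * (\<Sum>j<r. circ r p j * V j i)"
      by (simp add: e_def algebra_simps sum_subtractf sum_distrib_left)
    finally show ?thesis using assms(1)[OF that] circuit by simp
  qed
  ultimately have "e j = 0" if "j \<in> {1..<r}" for j using indepD that by blast
  moreover have "e 0 = 0" by (simp add: e_def circ_0)
  ultimately have "e j = 0" using assms(2) by (cases "j = 0") auto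
  then show ?thesis by (simp add: e_def)
qed

lemma eventually_nonzero: "\<forall>\<^sub>F t in nhds (0::real). 1 + t * b \<noteq> 0"
proof -
  have "((\<lambda>t. 1 + t * b) \<longlongrightarrow> 1 + 0 * b) (nhds 0)" by (intro tendsto_intros filterlim_ident)
  then have "\<forall>\<^sub>F t in nhds 0. 0 < 1 + t * b" by (rule order_tendstoD) simp
  then show ?thesis by eventually_elim simp
qed

lemma eventually_indep:
  assumes B: "B \<subseteq> {..<n}" "card B = r" "B \<noteq> {..<r}"
  shows "\<forall>\<^sub>F t in nhds 0. indep r (perturb t) B"
proof -
  have fB: "finite B" using B finite_subset by blast
  have ind: "indep r V B" by (rule indep_big[OF B])
  \<comment> \<open>\<open>\<beta>\<close> expresses the direction of the push in the basis
    \<open>B\<close>. It converts a dependency of the pushed columns into one of \<open>V\<close>,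
    changing the entry at 0 by the factor \<open>1 + t * \<beta> 0\<close>, which is nonzero near
    0.\<close>
  obtain \<beta> where \<beta>: "\<And>i. i < r \<Longrightarrow> (\<Sum>j\<in>B. \<beta> j * V j i) = of_bool (i = r - 1)"
    using indep_spans[OF fB B(2) ind, where b="\<lambda>i. of_bool (i = r - 1)"] by blast
  show ?thesis using eventually_nonzero[of "\<beta> 0"]
  proof eventually_elim
    case (elim t)
    show ?case unfolding indep_def
    proof (intro allI impI)
      fix c assume c: "\<forall>i<r. (\<Sum>j\<in>B. c j * perturb t j i) = 0"
      define c0 where "c0 = (if 0 \<in> B then c 0 else 0)"
      define d where "d = (\<lambda>j. c j + c0 * t * \<beta> j)"
      have "(\<Sum>j\<in>B. d j * V j i) = 0" if "i < r" for i
      proof -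
        have "(\<Sum>j\<in>B. d j * V j i) = (\<Sum>j\<in>B. c j * V j i) + c0 * t * (\<Sum>j\<in>B. \<beta> j * V j i)"
          by (simp add: d_def algebra_simps sum.distrib sum_distrib_left)
        also have "\<dots> = (\<Sum>j\<in>B. c j * perturb t j i)"
          using that by (simp add: sum_perturb[OF fB] \<beta> c0_def)
        finally show ?thesis using c that by simp
      qed
      then have d0: "d j = 0" if "j \<in> B" for j using indepD[OF ind] that by blast
      have "c0 = 0"
      proof (cases "0 \<in> B")
        case True
        then have "c0 * (1 + t * \<beta> 0) = 0" using d0[of 0] by (simp add: d_def c0_def algebra_simps)
        then show ?thesis using elim by simp
      qed (simp add: c0_def)
      then show "\<forall>j\<in>B. c j = 0" using d0 by (simp add: d_def)
    qed
  qed
qed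

lemma indep_first:
  assumes "t \<noteq> 0"
  shows "indep r (perturb t) {..<r}"
  unfolding indep_def
proof (intro allI impI)
  fix c assume c: "\<forall>i<r. (\<Sum>j<r. c j * perturb t j i) = 0"
  have eq: "(\<Sum>j<r. c j * V j i) + (if i = r - 1 then c 0 * t else 0) = 0" if "i < r" for i
    using c that p by (simp add: sum_perturb)
  have "(\<Sum>j<r. c j * V j (r - 1)) = 0" by (rule sum.neutral) (simp add: V_last[simplified])
  then have "c 0 = 0" using eq[of "r - 1"] p assms by simp
  then have "(\<Sum>j<r. c j * V j i) = 0" if "i < r" for i using eq[OF that] by (simp split: if_splits)
  then have "c j = 0" if "j < r" for j using circuit_unique[of c j] that \<open>c 0 = 0\<close> by simp
  then show "\<forall>j\<in>{..<r}. c j = 0" by simp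
qed

lemma eventually_general_position: "\<forall>\<^sub>F t in at 0. general_position n r (perturb t)"
proof -
  have "\<forall>\<^sub>F t in nhds 0. \<forall>B\<in>{B. B \<subseteq> {..<n} \<and> card B = r \<and> B \<noteq> {..<r}}. indep r (perturb t) B"
  proof (rule eventually_ball_finite)
    show "finite {B. B \<subseteq> {..<n} \<and> card B = r \<and> B \<noteq> {..<r}}" by simp
  qed (use eventually_indep in blast)
  then have "\<forall>\<^sub>F t in at 0. \<forall>B\<in>{B. B \<subseteq> {..<n} \<and> card B = r \<and> B \<noteq> {..<r}}. indep r (perturb t) B"
    by (rule eventually_at_filter[THEN iffD2, OF eventually_mono]) auto
  moreover have "\<forall>\<^sub>F t in at (0::real). t \<noteq> 0" by (simp add: eventually_at_filter)
  ultimately show ?thesis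
  proof eventually_elim
    case (elim t)
    show ?case unfolding general_position_iff
    proof (intro allI impI)
      fix J assume J: "J \<subseteq> {..<n} \<and> card J = r"
      show "indep r (perturb t) J"
      proof (cases "J = {..<r}")
        case True
        then show ?thesis using indep_first[OF elim(2)] by (simp only:)
      next
        case False
        then show ?thesis using elim(1) J by blast
      qed
    qed
  qed
qed

lemma sum_circ_pos: "(\<Sum>i<r - 1. - circ r p (Suc i)) > 0"
proof -
  have "(\<Sum>i<r - 1. - circ r p (Suc i)) = (\<Sum>i<r - 1. if i < p then real r + 1 else 0) - (\<Sum>i<r - 1. 1)"
    unfolding sum_subtractf[symmetric] by (rule sum.cong) (auto simp: circ_def)
  also have "(\<Sum>i<r - 1. if i < p then real r + 1 else 0) = (\<Sum>i<p. real r + 1)"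
    using p by (intro sum.mono_neutral_cong_right) auto
  also have "\<dots> - (\<Sum>i<r - 1. 1) = real p * (real r + 1) - real (r - 1)" by simp
  also have "\<dots> > 0"
  proof -
    have "real (r - 1) < 1 * (real r + 1)" by simp
    also have "\<dots> \<le> real p * (real r + 1)" using p by (intro mult_right_mono) auto
    finally show ?thesis by (simp only: diff_gt_0_iff_gt)
  qed
  finally show ?thesis .
qed

lemma perturb_V0:
  assumes "general_position n r (perturb t)"
  shows "perturb t \<in> V0_set n r"
proof -
  have "vconf n r (perturb t)" using outside p by (auto simp: vconf_def perturb_def)
  \<comment> \<open>The sum of the first \<open>r - 1\<close> coordinates is positive on every
    column and does not see the push, which acts on the last coordinate.\<close>
  moreover have "pointed n r (perturb t)"
    unfolding pointed_def
  proof (intro exI[of _ "\<lambda>i. of_bool (i < r - 1)"] conjI allI impI)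
    show "\<exists>i<r. of_bool (i < r - 1) \<noteq> (0::real)" using p by (intro exI[of _ 0]) auto
    fix j assume j: "j < n"
    have "(\<Sum>i<r. of_bool (i < r - 1) * perturb t j i) = (\<Sum>i<r - 1. V j i)"
      by (rule sum.mono_neutral_cong_right) (auto simp: perturb_def)
    also have "\<dots> > 0"
    proof -
      consider "j = 0" | "1 \<le> j" "j < r" | "r \<le> j" by linarith
      then show ?thesis
      proof cases
        case 1
        then show ?thesis using sum_circ_pos by (simp add: col_0)
      next
        case 2
        then have "(\<Sum>i<r - 1. V j i) = (\<Sum>i<r - 1. if i = j - 1 then 1 else 0)"
          by (intro sum.cong) (auto simp: col_unit)
        then show ?thesis using 2 by simp
      next
        case 3
        have "{..<r - 1} \<noteq> {}" using p by (simp add: lessThan_empty_iff)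
        then show ?thesis using 3 j by (intro sum_pos) (auto intro: col_pos[simplified])
      qed
    qed
    finally show "0 < (\<Sum>i<r. of_bool (i < r - 1) * perturb t j i)" .
  qed
  ultimately show ?thesis using assms by (simp add: V0_set_def)
qed

text \<open>A dependency of \<open>V\<close> involving some \<open>q \<ge> r\<close> has an
  independent \<open>r\<close>-set \<open>B\<close> inside its support. Corrections along
  \<open>B\<close> are harmless for small sizes, since the signs there are already nonzero; they
  serve both to fill the zeros of \<open>x\<close> and to absorb the push of column 0.\<close>

lemma eventually_fill:
  assumes x: "x \<in> deps n r V" "q < n" "r \<le> q" "x q \<noteq> 0"
    and F: "F \<in> choices {..<n} (\<lambda>_. {-1, 0, 1})" "\<And>j. x j \<noteq> 0 \<Longrightarrow> sgn (x j) = F j"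
  shows "\<forall>\<^sub>F t in nhds 0. F \<in> sgns (deps n r (perturb t))"
proof -
  define S where "S = {j. j < n \<and> x j \<noteq> 0}"
  have S: "S \<subseteq> {..<n}" "finite S" "q \<in> S" using x by (auto simp: S_def)
  have dep: "(\<Sum>j\<in>C. x j * V j i) = 0" if "S \<subseteq> C" "C \<subseteq> {..<n}" "i < r" for C i
  proof -
    have "(\<Sum>j\<in>C. x j * V j i) = (\<Sum>j<n. x j * V j i)"
      using that by (intro sum.mono_neutral_left) (auto simp: S_def)
    then show ?thesis using x(1) that by (simp add: deps_def)
  qed
  \<comment> \<open>A support of at most \<open>r\<close> elements would lie in an
    \<open>r\<close>-set through \<open>q\<close>. That set is not the degenerate one, so it is
    independent and forces \<open>x q = 0\<close>.\<close>
  have "r < card S"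
  proof (rule ccontr)
    assume "\<not> r < card S"
    then obtain C where C: "S \<subseteq> C" "C \<subseteq> {..<n}" "card C = r"
      using exists_subset_between[of S r "{..<n}"] S by auto
    have "q \<in> C" using C S by blast
    then have "C \<noteq> {..<r}" using x(3) by (metis lessThan_iff not_le)
    then have "indep r V C" using C by (intro indep_big) auto
    then have "x q = 0" using dep[OF C(1,2)] C(1) S(3) by (intro indepD[of r V C x q]) auto
    then show False using x by simp
  qed
  then have "r - 1 \<le> card (S - {q})" using S by simp
  then obtain B' where B': "B' \<subseteq> S - {q}" "card B' = r - 1" by (rule obtain_subset_with_card_n)
  define B where "B = insert q B'"
  have fB': "finite B'" using B'(1) S(2) finite_subset by auto
  have B: "B \<subseteq> S" "finite B" "card B = r" "B \<noteq> {..<r}" "B \<subseteq> {..<n}"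
    using B' S p x fB' by (auto simp: B_def card_insert_if)
  have ind: "indep r V B" using B by (intro indep_big) auto
  obtain \<beta>' where \<beta>': "\<And>i. i < r \<Longrightarrow> (\<Sum>j\<in>B. \<beta>' j * V j i) = of_bool (i = r - 1)"
    using indep_spans[OF B(2,3) ind, where b="\<lambda>i. of_bool (i = r - 1)"] by blast
  define \<beta> where "\<beta> = (\<lambda>j. if j \<in> B then \<beta>' j else 0)"
  have \<beta>: "(\<Sum>j<n. \<beta> j * V j i) = of_bool (i = r - 1)" if "i < r" for i
  proof -
    have "(\<Sum>j<n. \<beta> j * V j i) = (\<Sum>j\<in>B. \<beta>' j * V j i)"
      using B by (intro sum.mono_neutral_cong_right) (auto simp: \<beta>_def)
    then show ?thesis using \<beta>'[OF that] by simp
  qed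
  \<comment> \<open>The signs of \<open>F\<close> are prescribed off the support and balanced along
    \<open>B\<close>.\<close>
  obtain \<nu>' where \<nu>': "\<And>i. i < r \<Longrightarrow> (\<Sum>j\<in>B. \<nu>' j * V j i) = - (\<Sum>j\<in>{..<n} - S. F j * V j i)"
    using indep_spans[OF B(2,3) ind, where b="\<lambda>i. - (\<Sum>j\<in>{..<n} - S. F j * V j i)"] by blast
  define \<nu> where "\<nu> = (\<lambda>j. if j \<in> B then \<nu>' j else if j \<in> {..<n} - S then F j else 0)"
  have \<nu>: "(\<Sum>j<n. \<nu> j * V j i) = 0" if "i < r" for i
  proof -
    have "(\<Sum>j<n. \<nu> j * V j i) = (\<Sum>j\<in>B \<union> ({..<n} - S). \<nu> j * V j i)"
      using B S by (intro sum.mono_neutral_right) (auto simp: \<nu>_def)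
    also have "\<dots> = (\<Sum>j\<in>B. \<nu> j * V j i) + (\<Sum>j\<in>{..<n} - S. \<nu> j * V j i)"
      using B by (intro sum.union_disjoint) auto
    also have "(\<Sum>j\<in>B. \<nu> j * V j i) = (\<Sum>j\<in>B. \<nu>' j * V j i)" by (rule sum.cong) (auto simp: \<nu>_def)
    also have "(\<Sum>j\<in>{..<n} - S. \<nu> j * V j i) = (\<Sum>j\<in>{..<n} - S. F j * V j i)"
      using B by (intro sum.cong) (auto simp: \<nu>_def)
    finally show ?thesis using \<nu>'[OF that] by simp
  qed
  obtain d where d: "d > 0"
    "\<And>h j. \<bar>h\<bar> < d \<Longrightarrow> j \<in> {..<n} \<Longrightarrow> x j \<noteq> 0 \<Longrightarrow> sgn (x j + h * \<nu> j) = sgn (x j)"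
    using sgn_perturb[of "{..<n}" x \<nu>] by blast
  define y where "y = (\<lambda>j. x j + d / 2 * \<nu> j)"
  have Fv: "F j \<in> {-1, 0, 1}" for j using F(1) by (cases "j < n") (auto simp: choices_def)
  have sy: "sgn (y j) = F j" for j
  proof -
    consider "j \<in> S" | "j < n" "j \<notin> S" | "n \<le> j" by linarith
    then show ?thesis
    proof cases
      case 1
      then show ?thesis using d(1) d(2)[of "d / 2" j] F(2)[of j] by (simp add: y_def S_def)
    next
      case 2
      then have "y j = d / 2 * F j" using B by (auto simp: y_def \<nu>_def S_def)
      then show ?thesis using d(1) Fv[of j] by (auto simp: sgn_mult)
    next
      case 3
      then have "\<nu> j = 0" "x j = 0" "F j = 0"
        using x(1) B F(1) by (auto simp: \<nu>_def deps_def choices_def)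
      then show ?thesis by (simp add: y_def)
    qed
  qed
  have yV: "(\<Sum>j<n. y j * V j i) = 0" if "i < r" for i
  proof -
    have "(\<Sum>j<n. y j * V j i) = (\<Sum>j<n. x j * V j i) + d / 2 * (\<Sum>j<n. \<nu> j * V j i)"
      by (simp add: y_def algebra_simps sum.distrib sum_distrib_left)
    then show ?thesis using dep[of "{..<n}" i] S \<nu>[OF that] that by simp
  qed
  obtain d' where d': "d' > 0"
    "\<And>h j. \<bar>h\<bar> < d' \<Longrightarrow> j \<in> {..<n} \<Longrightarrow> y j \<noteq> 0 \<Longrightarrow> sgn (y j + h * \<beta> j) = sgn (y j)"
    using sgn_perturb[of "{..<n}" y \<beta>] by blast
  \<comment> \<open>Solves s + t (y_0 + s \<beta>_0) = 0, the last coordinate of the pushed system,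
    and tends to 0 with \<open>t\<close>.\<close>
  define s where "s = (\<lambda>t. - t * y 0 / (1 + t * \<beta> 0))"
  have "(s \<longlongrightarrow> - 0 * y 0 / (1 + 0 * \<beta> 0)) (nhds 0)"
    unfolding s_def by (intro tendsto_intros filterlim_ident) auto
  then have "((\<lambda>t. \<bar>s t\<bar>) \<longlongrightarrow> 0) (nhds 0)" by (intro tendsto_rabs_zero) simp
  then have "\<forall>\<^sub>F t in nhds 0. \<bar>s t\<bar> < d'" by (rule order_tendstoD(2)) (rule d'(1))
  with eventually_nonzero[of "\<beta> 0"] show ?thesis
  proof eventually_elim
    case (elim t)
    define z where "z = (\<lambda>j. y j + s t * \<beta> j)"
    have "z \<in> deps n r (perturb t)"
      unfolding deps_perturb
    proof (intro conjI allI impI)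
      fix j assume "n \<le> j"
      then have "F j = 0" "\<beta> j = 0" using F(1) B by (auto simp: choices_def \<beta>_def)
      then show "z j = 0" using sy[of j] by (simp add: z_def sgn_0_0)
    next
      fix i assume i: "i < r"
      have "(\<Sum>j<n. z j * V j i) = (\<Sum>j<n. y j * V j i) + s t * (\<Sum>j<n. \<beta> j * V j i)"
        by (simp add: z_def algebra_simps sum.distrib sum_distrib_left)
      also have "\<dots> = s t * of_bool (i = r - 1)" using yV[OF i] \<beta>[OF i] by simp
      finally have "(\<Sum>j<n. z j * V j i) = s t * of_bool (i = r - 1)" .
      moreover have "s t + z 0 * t = 0"
      proof -
        have "s t * (1 + t * \<beta> 0) = - t * y 0" using elim by (simp add: s_def)
        then show ?thesis by (simp add: z_def algebra_simps)
      qed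
      ultimately show "(\<Sum>j<n. z j * V j i) + (if i = r - 1 then z 0 * t else 0) = 0" by auto
    qed
    moreover have sz: "F j = sgn (z j)" for j
    proof (cases "y j = 0 \<or> n \<le> j")
      case True
      then have "F j = 0" using sy[of j] F(1) by (auto simp: choices_def)
      moreover have "j \<notin> B"
      proof
        assume j: "j \<in> B"
        then have "x j \<noteq> 0" "j < n" using B by (auto simp: S_def)
        then have "sgn (x j) = 0" using F(2) calculation by simp
        then show False using \<open>x j \<noteq> 0\<close> by (simp add: sgn_0_0)
      qed
      ultimately show ?thesis using sy[of j] by (simp add: z_def \<beta>_def sgn_0_0)
    next
      case False
      then show ?thesis using d'(2)[of "s t" j] elim sy[of j] by (simp add: z_def)
    qed
    moreover have "z \<noteq> (\<lambda>_. 0)"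
    proof
      assume "z = (\<lambda>_. 0)"
      then have "F q = 0" using sz[of q] by simp
      then show False using F(2)[OF x(4)] x(4) by (simp add: sgn_0_0)
    qed
    ultimately show ?case by (intro sgnsI[of z])
  qed
qed

text \<open>Compactness: dependencies with sign vector \<open>F\<close>, normalised to absolute sum
  1, accumulate at a dependency of \<open>V\<close>. The normalisation keeps the limit nonzero;
  passing to the limit can only turn signs into zeros.\<close>

lemma limit_dependency:
  assumes "\<exists>\<^sub>F t in at 0. F \<in> sgns (deps n r (perturb t))"
  obtains x where "x \<in> deps n r V" "x \<noteq> (\<lambda>_. 0)" "\<And>j. x j \<noteq> 0 \<Longrightarrow> sgn (x j) = F j"
proof -
  let ?P = "\<lambda>m t l. \<bar>t\<bar> < inverse (real (Suc m)) \<and> l \<in> deps n r (perturb t) \<and>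
     (\<Sum>j<n. \<bar>l j\<bar>) = 1 \<and> (\<forall>j. sgn (l j) = F j)"
  have "\<forall>m. \<exists>t. \<exists>l. ?P m t l"
  proof
    fix m
    have "\<forall>\<^sub>F t in at (0::real). \<bar>t\<bar> < inverse (real (Suc m))"
      unfolding eventually_at by (intro exI[of _ "inverse (real (Suc m))"]) auto
    with assms have "\<exists>\<^sub>F t in at 0. F \<in> sgns (deps n r (perturb t)) \<and> \<bar>t\<bar> < inverse (real (Suc m))"
      by (rule frequently_eventually_frequently)
    then obtain t where t: "F \<in> sgns (deps n r (perturb t))" "\<bar>t\<bar> < inverse (real (Suc m))"
      by (elim frequently_ex[THEN exE] conjE)
    obtain y where y: "y \<in> deps n r (perturb t)" "y \<noteq> (\<lambda>_. 0)" "\<And>j. F j = sgn (y j)"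
      using t(1) unfolding sgns_iff by blast
    define c where "c = (\<Sum>j<n. \<bar>y j\<bar>)"
    obtain j where j: "y j \<noteq> 0" using y(2) by (auto simp: fun_eq_iff)
    then have jn: "j < n" using y(1) not_le by (auto simp: deps_def)
    have "c > 0" unfolding c_def by (rule sum_pos2[of _ j]) (use j jn in auto)
    define l where "l = (\<lambda>j. y j / c)"
    have "(\<Sum>j<n. l j * perturb t j i) = (\<Sum>j<n. y j * perturb t j i) / c" for i
      by (simp add: l_def sum_divide_distrib)
    then have "l \<in> deps n r (perturb t)" using y(1) by (simp add: deps_def l_def)
    moreover have "(\<Sum>j<n. \<bar>l j\<bar>) = 1"
      using \<open>c > 0\<close> by (simp add: l_def abs_divide sum_divide_distrib[symmetric] c_def[symmetric])
    moreover have "sgn (l j) = F j" for j using \<open>c > 0\<close> y(3) by (simp add: l_def sgn_divide)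
    ultimately show "\<exists>t. \<exists>l. ?P m t l" using t(2) by blast
  qed
  from choice[OF this] obtain T where "\<forall>m. \<exists>l. ?P m (T m) l" by blast
  from choice[OF this] obtain l where "\<forall>m. ?P m (T m) (l m)" by blast
  then have T: "\<And>m. \<bar>T m\<bar> < inverse (real (Suc m))"
    and l: "\<And>m. l m \<in> deps n r (perturb (T m))" "\<And>m. (\<Sum>j<n. \<bar>l m j\<bar>) = 1" "\<And>m j. sgn (l m j) = F j"
    by auto
  have T0: "T \<longlonglongrightarrow> 0"
    by (rule Lim_null_comparison[OF _ LIMSEQ_inverse_real_of_nat]) (use T in \<open>auto intro!: always_eventually less_imp_le\<close>)
  have "\<bar>l m j\<bar> \<le> 1" if "j < n" for m j
    unfolding l(2)[of m, symmetric] by (rule member_le_sum) (use that in auto)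
  then obtain \<phi> x' where \<phi>: "strict_mono \<phi>" "\<And>j. j < n \<Longrightarrow> (\<lambda>m. l (\<phi> m) j) \<longlonglongrightarrow> x' j"
    using Bolzano_Weierstrass_finite[of n l] by blast
  define x where "x = (\<lambda>j. if j < n then x' j else 0)"
  have lim: "(\<lambda>m. l (\<phi> m) j) \<longlonglongrightarrow> x j" if "j < n" for j using \<phi>(2)[OF that] that by (simp add: x_def)
  have T\<phi>: "(\<lambda>m. T (\<phi> m)) \<longlonglongrightarrow> 0" using LIMSEQ_subseq_LIMSEQ[OF T0 \<phi>(1)] by (simp add: o_def)
  have "(\<Sum>j<n. x j * V j i) = 0" if "i < r" for i
  proof -
    have "(\<lambda>m. \<Sum>j<n. l (\<phi> m) j * V j i) \<longlonglongrightarrow> (\<Sum>j<n. x j * V j i)"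
      by (intro tendsto_sum tendsto_mult lim tendsto_const) auto
    moreover have "(\<lambda>m. l (\<phi> m) 0 * T (\<phi> m)) \<longlonglongrightarrow> x 0 * 0"
      using p by (intro tendsto_mult lim T\<phi>) auto
    then have "(\<lambda>m. if i = r - 1 then l (\<phi> m) 0 * T (\<phi> m) else 0) \<longlonglongrightarrow> 0"
      by (cases "i = r - 1") simp_all
    ultimately have "(\<lambda>m. (\<Sum>j<n. l (\<phi> m) j * V j i) + (if i = r - 1 then l (\<phi> m) 0 * T (\<phi> m) else 0))
      \<longlonglongrightarrow> (\<Sum>j<n. x j * V j i) + 0"
      by (rule tendsto_add)
    moreover have "(\<Sum>j<n. l (\<phi> m) j * V j i) + (if i = r - 1 then l (\<phi> m) 0 * T (\<phi> m) else 0) = 0" for m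
      using l(1)[of "\<phi> m"] that unfolding deps_perturb by blast
    ultimately have "(\<lambda>m::nat. 0::real) \<longlonglongrightarrow> (\<Sum>j<n. x j * V j i) + 0" by (simp only:)
    then show ?thesis by (simp add: LIMSEQ_const_iff)
  qed
  then have "x \<in> deps n r V" by (simp add: deps_def x_def)
  moreover have "x \<noteq> (\<lambda>_. 0)"
  proof
    assume "x = (\<lambda>_. 0)"
    moreover have "(\<lambda>m. \<Sum>j<n. \<bar>l (\<phi> m) j\<bar>) \<longlonglongrightarrow> (\<Sum>j<n. \<bar>x j\<bar>)"
      by (intro tendsto_sum tendsto_rabs lim) auto
    ultimately show False by (simp add: l(2) LIMSEQ_const_iff)
  qed
  moreover have "sgn (x j) = F j" if "x j \<noteq> 0" for j
  proof -
    have "j < n" using that by (auto simp: x_def split: if_splits)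
    show ?thesis
    proof (cases "x j > 0")
      case True
      then have "\<forall>\<^sub>F m in sequentially. 0 < l (\<phi> m) j" by (rule order_tendstoD(1)[OF lim[OF \<open>j < n\<close>]])
      then obtain m where "0 < l (\<phi> m) j" by (auto dest: eventually_happens)
      then show ?thesis using True l(3)[of "\<phi> m" j] by simp
    next
      case False
      then have "x j < 0" using that by simp
      then have "\<forall>\<^sub>F m in sequentially. l (\<phi> m) j < 0" by (rule order_tendstoD(2)[OF lim[OF \<open>j < n\<close>]])
      then obtain m where "l (\<phi> m) j < 0" by (auto dest: eventually_happens)
      then show ?thesis using \<open>x j < 0\<close> l(3)[of "\<phi> m" j] by simp
    qed
  qed
  ultimately show thesis by (rule that)
qed

end

text \<open>Both sides of the wall are parametrised by \<open>t > 0\<close>, with \<open>s\<close>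
  selecting the side.\<close>

lemma eventually_at_right_mult_sign:
  assumes "\<forall>\<^sub>F t in at (0::real). P t" "s \<in> {1, -1::real}"
  shows "\<forall>\<^sub>F t in at_right 0. P (s * t)"
proof -
  obtain d where "d > 0" "\<And>t. t \<noteq> 0 \<Longrightarrow> dist t 0 < d \<Longrightarrow> P t"
    using assms(1) unfolding eventually_at by blast
  then show ?thesis
    unfolding eventually_at using assms(2) by (intro exI[of _ d]) auto
qed

lemma gpoly_G0_basis:
  assumes "p \<le> r" "k \<le> M"
  shows "gpoly r M (G0_basis r M p k) x y
    = (y ^ p - y ^ (r - p)) * ((x + y) ^ k * (x + 1) ^ (M - k) - (x + y) ^ (M - k) * (x + 1) ^ k)"
proof -
  have "gpoly r M (G0_basis r M p k) x y
      = (\<Sum>j\<le>r. \<Sum>l\<le>M. ((of_bool (j = p) - of_bool (j = r - p)) * y ^ j) *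
          ((of_bool (l = k) - of_bool (l = M - k)) * ((x + y) ^ l * (x + 1) ^ (M - l))))"
    unfolding gpoly_def by (intro sum.cong refl) (simp add: G0_basis_def)
  also have "\<dots> = (\<Sum>j\<le>r. (of_bool (j = p) - of_bool (j = r - p)) * y ^ j) *
      (\<Sum>l\<le>M. (of_bool (l = k) - of_bool (l = M - k)) * ((x + y) ^ l * (x + 1) ^ (M - l)))"
    by (rule sum_product[symmetric])
  also have "(\<Sum>j\<le>r. (of_bool (j = p) - of_bool (j = r - p)) * y ^ j) = y ^ p - y ^ (r - p)"
  proof -
    have "(\<Sum>j\<le>r. (of_bool (j = p) - of_bool (j = r - p)) * y ^ j)
        = (\<Sum>j\<le>r. if j = p then y ^ j else 0) - (\<Sum>j\<le>r. if j = r - p then y ^ j else 0)"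
      unfolding sum_subtractf[symmetric] by (rule sum.cong) (auto simp: algebra_simps)
    then show ?thesis using assms by simp
  qed
  also have "(\<Sum>l\<le>M. (of_bool (l = k) - of_bool (l = M - k)) * ((x + y) ^ l * (x + 1) ^ (M - l)))
      = (x + y) ^ k * (x + 1) ^ (M - k) - (x + y) ^ (M - k) * (x + 1) ^ k"
  proof -
    have "(\<Sum>l\<le>M. (of_bool (l = k) - of_bool (l = M - k)) * ((x + y) ^ l * (x + 1) ^ (M - l)))
        = (\<Sum>l\<le>M. if l = k then (x + y) ^ l * (x + 1) ^ (M - l) else 0)
          - (\<Sum>l\<le>M. if l = M - k then (x + y) ^ l * (x + 1) ^ (M - l) else 0)"
      unfolding sum_subtractf[symmetric] by (rule sum.cong) (auto simp: algebra_simps)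
    then show ?thesis using assms by simp
  qed
  finally show ?thesis .
qed

section \<open>Sign vectors extending the circuit, and the effect of a mutation\<close>

context degenerate_config
begin

definition loc :: "real \<Rightarrow> (nat \<Rightarrow> real) set" where
  "loc \<kappa> = choices {..<n} (\<lambda>j. if j < r then {\<kappa> * sgn (circ r p j)} else {-1, 0, 1})"

lemma loc_subset: "\<kappa> \<in> {1, -1} \<Longrightarrow> loc \<kappa> \<subseteq> choices {..<n} (\<lambda>_. {-1, 0, 1})"
  by (auto simp: loc_def choices_def sgn_real_def)

lemma locD:
  assumes "F \<in> loc \<kappa>"
  shows loc_first: "j < r \<Longrightarrow> F j = \<kappa> * sgn (circ r p j)"
    and loc_rest: "r \<le> j \<Longrightarrow> j < n \<Longrightarrow> F j \<in> {-1, 0, 1}"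
    and loc_outside: "n \<le> j \<Longrightarrow> F j = 0"
proof -
  have *: "F j \<in> (if j < r then {\<kappa> * sgn (circ r p j)} else {-1, 0, 1})" if "j < n" for j
    using assms that unfolding loc_def choices_def by blast
  show "j < r \<Longrightarrow> F j = \<kappa> * sgn (circ r p j)" "r \<le> j \<Longrightarrow> j < n \<Longrightarrow> F j \<in> {-1, 0, 1}"
    using *[of j] by auto
  show "n \<le> j \<Longrightarrow> F j = 0" using assms by (simp add: loc_def choices_def)
qed

text \<open>Only sign vectors extending plus or minus the circuit (those in \<open>loc 1\<close>, \<open>loc (-1)\<close>)
  can distinguish the two sides of the mutation.\<close>
lemma nonlocal_stable:
  assumes F: "F \<in> choices {..<n} (\<lambda>_. {-1, 0, 1})" "F \<notin> loc 1" "F \<notin> loc (-1)"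
  shows "(\<forall>\<^sub>F t in at 0. F \<in> sgns (deps n r (perturb t))) \<or>
    (\<forall>\<^sub>F t in at 0. F \<notin> sgns (deps n r (perturb t)))"
proof (rule disjCI)
  assume "\<not> (\<forall>\<^sub>F t in at 0. F \<notin> sgns (deps n r (perturb t)))"
  then have "\<exists>\<^sub>F t in at 0. F \<in> sgns (deps n r (perturb t))" by (simp add: frequently_def)
  then obtain x where x: "x \<in> deps n r V" "x \<noteq> (\<lambda>_. 0)" "\<And>j. x j \<noteq> 0 \<Longrightarrow> sgn (x j) = F j"
    by (rule limit_dependency) blast
  \<comment> \<open>A limit dependency supported on the first \<open>r\<close> vectors is a multiple
    of the circuit and would put \<open>F\<close> into \<open>loc 1\<close> or
    \<open>loc (-1)\<close>. Otherwise \<open>eventually_fill\<close> applies.\<close>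
  have "\<exists>q<n. r \<le> q \<and> x q \<noteq> 0"
  proof (rule ccontr)
    assume "\<not> ?thesis"
    then have x0: "x j = 0" if "r \<le> j" for j using x(1) that by (cases "j < n") (auto simp: deps_def)
    have "(\<Sum>j<r. x j * V j i) = 0" if "i < r" for i
    proof -
      have "(\<Sum>j<r. x j * V j i) = (\<Sum>j<n. x j * V j i)"
        using x0 by (intro sum.mono_neutral_left) auto
      then show ?thesis using x(1) that by (simp add: deps_def)
    qed
    then have c: "x j = x 0 * circ r p j" if "j < r" for j using circuit_unique that by blast
    have "x 0 \<noteq> 0"
    proof
      assume "x 0 = 0"
      then have "x j = 0" for j using c[of j] x0[of j] by (cases "j < r") auto
      then show False using x(2) by auto
    qed
    then have "F j = sgn (x 0) * sgn (circ r p j)" if "j < r" for j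
      using x(3)[of j] c[OF that] circ_nonzero[of j] by (simp add: sgn_mult)
    then have "F \<in> loc (sgn (x 0))" using F(1) by (auto simp: loc_def choices_def)
    moreover have "sgn (x 0) \<in> {1, -1}" using \<open>x 0 \<noteq> 0\<close> by (simp add: sgn_real_def)
    ultimately show False using F by auto
  qed
  then obtain q where "q < n" "r \<le> q" "x q \<noteq> 0" by blast
  then have "\<forall>\<^sub>F t in nhds 0. F \<in> sgns (deps n r (perturb t))"
    using eventually_fill x F(1) by blast
  then show "\<forall>\<^sub>F t in at 0. F \<in> sgns (deps n r (perturb t))"
    by (rule eventually_at_filter[THEN iffD2, OF eventually_mono]) auto
qed

text \<open>In the last coordinate the first \<open>r\<close> vectors contribute only the push, of
  sign \<open>\<kappa> * s\<close>, so some further vector has to contribute with the opposite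
  sign.\<close>

lemma local_necessary:
  assumes "t > 0" "\<kappa> \<in> {1, -1}" "s \<in> {1, -1}" "F \<in> loc \<kappa>" "F \<in> sgns (deps n r (perturb (s * t)))"
  shows "\<exists>q\<in>{r..<n}. F q * V q (r - 1) * (\<kappa> * s) < 0"
proof (rule ccontr)
  assume neg: "\<not> ?thesis"
  obtain x where x: "x \<in> deps n r (perturb (s * t))" "\<And>j. F j = sgn (x j)"
    using assms(5) unfolding sgns_iff by blast
  have "F 0 = \<kappa>" using loc_first[OF assms(4), of 0] p by (simp add: circ_0)
  then have \<kappa>: "\<kappa> = sgn (x 0)" using x(2)[of 0] by simp
  then have "x 0 \<noteq> 0" using assms(2) by auto
  then have x0: "x 0 * \<kappa> > 0" unfolding \<kappa> by (auto simp: sgn_real_def)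
  have nn: "x j * V j (r - 1) * (\<kappa> * s) \<ge> 0" if "j < n" for j
  proof (cases "j < r")
    case True
    then show ?thesis using V_last by simp
  next
    case False
    then have "F j * V j (r - 1) * (\<kappa> * s) \<ge> 0" using neg that by (auto simp: not_less)
    then have "\<bar>x j\<bar> * (F j * V j (r - 1) * (\<kappa> * s)) \<ge> 0" by simp
    also have "\<bar>x j\<bar> * (F j * V j (r - 1) * (\<kappa> * s)) = (sgn (x j) * \<bar>x j\<bar>) * V j (r - 1) * (\<kappa> * s)"
      using x(2)[of j] by simp
    also have "sgn (x j) * \<bar>x j\<bar> = x j" by (simp add: sgn_mult_abs)
    finally show ?thesis .
  qed
  have eq: "(\<Sum>j<n. x j * V j (r - 1)) + x 0 * (s * t) = 0"
    using x(1)[unfolded deps_perturb, THEN conjunct2, rule_format, of "r - 1"] p by simp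
  have "0 = ((\<Sum>j<n. x j * V j (r - 1)) + x 0 * (s * t)) * (\<kappa> * s)" unfolding eq by simp
  also have "\<dots> = (\<Sum>j<n. x j * V j (r - 1) * (\<kappa> * s)) + x 0 * \<kappa> * (s * s) * t"
    by (simp add: algebra_simps sum_distrib_left sum_distrib_right)
  also have "s * s = 1" using assms(3) by auto
  finally have "0 = (\<Sum>j<n. x j * V j (r - 1) * (\<kappa> * s)) + x 0 * \<kappa> * 1 * t" .
  moreover have "(\<Sum>j<n. x j * V j (r - 1) * (\<kappa> * s)) \<ge> 0" using nn by (intro sum_nonneg) auto
  moreover have "x 0 * \<kappa> * 1 * t > 0" using x0 assms(1) by simp
  ultimately show False by linarith
qed

text \<open>The dependency is \<open>\<kappa>\<close> times the circuit plus \<open>t\<close> times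
  a correction whose last coordinate is \<open>- \<kappa> * s\<close>. The given \<open>q\<close>
  supplies that amount while the other further vectors receive small entries with the signs of
  \<open>F\<close>.\<close>

lemma local_sufficient:
  assumes \<kappa>: "\<kappa> \<in> {1, -1}" and s: "s \<in> {1, -1}" and F: "F \<in> loc \<kappa>"
    and q: "q \<in> {r..<n}" "F q * V q (r - 1) * (\<kappa> * s) < 0"
  shows "\<forall>\<^sub>F t in at_right 0. F \<in> sgns (deps n r (perturb (s * t)))"
proof -
  define a where "a = (\<lambda>j. V j (r - 1))"
  define R where "R = (\<Sum>j\<in>{r..<n} - {q}. F j * a j)"
  define \<epsilon> where "\<epsilon> = 1 / (\<bar>R\<bar> + 1)"
  \<comment> \<open>The other entries contribute less than 1 in absolute value, so the entry
    \<open>e\<close>, which provides the rest of \<open>- \<kappa> * s\<close>, has the sign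
    \<open>F q\<close>.\<close>
  have \<epsilon>: "\<epsilon> > 0" "\<bar>\<epsilon> * R\<bar> < 1" by (auto simp: \<epsilon>_def abs_mult divide_simps)
  have q': "F q * a q * (\<kappa> * s) < 0" using q(2) by (simp add: a_def)
  then have aq: "a q \<noteq> 0" by auto
  have Fv: "F j \<in> {-1, 0, 1}" for j
    using loc_subset[OF \<kappa>] F by (cases "j < n") (auto simp: choices_def)
  define e where "e = (- \<kappa> * s - \<epsilon> * R) / a q"
  have sgn_e: "sgn e = F q"
  proof -
    have "sgn (- \<kappa> * s - \<epsilon> * R) = - \<kappa> * s"
      using \<epsilon>(2) \<kappa> s by (auto simp: sgn_real_def abs_less_iff)
    moreover have "F q = - \<kappa> * s * sgn (a q)"
      using Fv[of q] \<kappa> s q' aq by (auto simp: sgn_real_def mult_less_0_iff zero_less_mult_iff)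
    ultimately show ?thesis by (simp add: e_def sgn_divide)
  qed
  define \<eta> where "\<eta> = (\<lambda>j. if j = q then e else if j \<in> {r..<n} then \<epsilon> * F j else 0)"
  have sgn_\<eta>: "sgn (\<eta> j) = F j" if "r \<le> j" for j
  proof -
    have "sgn (\<epsilon> * F j) = F j" using Fv[of j] \<epsilon>(1) by (auto simp: sgn_mult)
    moreover have "F j = 0" if "n \<le> j" using loc_outside[OF F that] .
    ultimately show ?thesis using sgn_e that by (auto simp: \<eta>_def)
  qed
  have sum_\<eta>: "(\<Sum>j\<in>{r..<n}. \<eta> j * a j) = - \<kappa> * s"
  proof -
    have "(\<Sum>j\<in>{r..<n}. \<eta> j * a j) = \<eta> q * a q + (\<Sum>j\<in>{r..<n} - {q}. \<eta> j * a j)"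
      using q by (intro sum.remove) auto
    also have "(\<Sum>j\<in>{r..<n} - {q}. \<eta> j * a j) = \<epsilon> * R"
      unfolding R_def sum_distrib_left by (rule sum.cong) (auto simp: \<eta>_def)
    finally show ?thesis using aq by (simp add: \<eta>_def e_def)
  qed
  have ins: "{1..r} = insert r {1..<r}" using p by auto
  have rn: "r < n" using q by auto
  have "indep r V {1..r}"
  proof (rule indep_big)
    show "{1..r} \<noteq> {..<r}" by (metis atLeastAtMost_iff lessThan_iff less_irrefl order_refl p less_imp_le order_trans)
  qed (use rn in auto)
  then obtain d where d: "\<And>i. i < r \<Longrightarrow> (\<Sum>j\<in>{1..r}. d j * V j i)
      = - ((\<Sum>j\<in>{r..<n}. \<eta> j * V j i) + (if i = r - 1 then \<kappa> * s else 0))"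
    using indep_spans[of "{1..r}" r V "\<lambda>i. - ((\<Sum>j\<in>{r..<n}. \<eta> j * V j i) + (if i = r - 1 then \<kappa> * s else 0))"]
    by auto
  have dr: "d r = 0"
  proof -
    have "(\<Sum>j\<in>{1..r}. d j * a j) = d r * a r"
      unfolding ins a_def using V_last by (subst sum.insert) auto
    moreover have "(\<Sum>j\<in>{1..r}. d j * a j) = 0"
      using d[of "r - 1"] p sum_\<eta> by (simp add: a_def)
    moreover have "a r \<noteq> 0"
      using last_pos[of r] last_neg[of r] rn by (cases "r < r + k") (auto simp: a_def)
    ultimately show ?thesis by simp
  qed
  \<comment> \<open>\<open>\<rho>\<close> is 0 at index 0, so \<open>z 0\<close> below is exactly
    \<open>\<kappa>\<close> and the push contributes exactly
    \<open>\<kappa> * s * t\<close>.\<close>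
  define \<rho> where "\<rho> = (\<lambda>j. if j < r then if 1 \<le> j then d j else 0 else \<eta> j)"
  define c where "c = (\<lambda>j. if j < r then \<kappa> * circ r p j else 0)"
  have n_split: "(\<Sum>j<n. f j) = (\<Sum>j<r. f j) + (\<Sum>j\<in>{r..<n}. f j)" for f :: "nat \<Rightarrow> real"
    by (metis atLeast0LessThan le_add1 le0 sum.atLeastLessThan_concat)
  have sum_\<rho>: "(\<Sum>j<n. \<rho> j * V j i) = - (if i = r - 1 then \<kappa> * s else 0)" if "i < r" for i
  proof -
    have "(\<Sum>j<r. \<rho> j * V j i) = (\<Sum>j\<in>{1..<r}. d j * V j i)"
      by (rule sum.mono_neutral_cong_right) (auto simp: \<rho>_def)
    also have "\<dots> = (\<Sum>j\<in>{1..r}. d j * V j i)" unfolding ins using dr by simp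
    moreover have "(\<Sum>j\<in>{r..<n}. \<rho> j * V j i) = (\<Sum>j\<in>{r..<n}. \<eta> j * V j i)"
      by (rule sum.cong) (auto simp: \<rho>_def)
    ultimately show ?thesis unfolding n_split d[OF that] by simp
  qed
  have sum_c: "(\<Sum>j<n. c j * V j i) = 0" for i
  proof -
    have "(\<Sum>j<n. c j * V j i) = (\<Sum>j<r. \<kappa> * (circ r p j * V j i))"
      by (rule sum.mono_neutral_cong_right) (auto simp: c_def)
    then show ?thesis by (simp add: sum_distrib_left[symmetric] circuit)
  qed
  obtain D where D: "D > 0"
    "\<And>h j. \<bar>h\<bar> < D \<Longrightarrow> j \<in> {..<n} \<Longrightarrow> c j \<noteq> 0 \<Longrightarrow> sgn (c j + h * \<rho> j) = sgn (c j)"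
    using sgn_perturb[of "{..<n}" c \<rho>] by blast
  have mem: "F \<in> sgns (deps n r (perturb (s * t)))" if t: "0 < t" "t < D" for t
  proof -
    define z where "z = (\<lambda>j. c j + t * \<rho> j)"
    have "z \<in> deps n r (perturb (s * t))"
      unfolding deps_perturb
    proof (intro conjI allI impI)
      show "z j = 0" if "n \<le> j" for j using that q by (auto simp: z_def c_def \<rho>_def \<eta>_def)
      fix i assume i: "i < r"
      have "(\<Sum>j<n. z j * V j i) = (\<Sum>j<n. c j * V j i) + t * (\<Sum>j<n. \<rho> j * V j i)"
        by (simp add: z_def algebra_simps sum.distrib sum_distrib_left)
      moreover have "z 0 = \<kappa>" using p by (simp add: z_def c_def \<rho>_def circ_0)
      ultimately show "(\<Sum>j<n. z j * V j i) + (if i = r - 1 then z 0 * (s * t) else 0) = 0"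
        by (simp add: sum_c sum_\<rho>[OF i])
    qed
    moreover have sz: "F j = sgn (z j)" for j
    proof (cases "j < r")
      case True
      then have "c j \<noteq> 0" using \<kappa> circ_nonzero[of j] by (auto simp: c_def)
      then have "sgn (z j) = sgn (c j)" unfolding z_def using t True by (intro D(2)) auto
      also have "\<dots> = F j" using loc_first[OF F True] True \<kappa> by (auto simp: c_def sgn_mult)
      finally show ?thesis by simp
    next
      case False
      then show ?thesis using t sgn_\<eta>[of j] by (simp add: z_def c_def \<rho>_def sgn_mult)
    qed
    moreover have "z \<noteq> (\<lambda>_. 0)"
    proof
      assume "z = (\<lambda>_. 0)"
      then have "F q = 0" using sz[of q] by simp
      then show False using q by simp
    qed
    ultimately show ?thesis by (intro sgnsI[of z])
  qed
  show ?thesis unfolding eventually_at using D(1) mem by (intro exI[of _ D]) (auto simp: dist_real_def)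
qed

text \<open>These are the extensions of the signed circuit that are missing on side
  \<open>s\<close>. Being missing leaves two allowed signs at each further vector independently, so
  the weights factor; the vectors present are handled as the complement.\<close>

lemma fpoly_loc:
  assumes "k \<le> N" "\<kappa> \<in> {1, -1}" "s \<in> {1, -1}"
  shows "(\<Sum>F | F \<in> loc \<kappa> \<and> (\<forall>q\<in>{r..<n}. \<not> F q * V q (r - 1) * (\<kappa> * s) < 0). \<Prod>j<n. wt x y (F j))
    = (if \<kappa> = 1 then y ^ p else y ^ (r - p)) *
      (if \<kappa> * s = 1 then (x + 1) ^ k * (x + y) ^ (N - k) else (x + y) ^ k * (x + 1) ^ (N - k))"
proof -
  let ?S = "\<lambda>j. if j < r then {\<kappa> * sgn (circ r p j)}
    else if (j < r + k) = (\<kappa> * s = 1) then {0, 1} else {-1, 0}"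
  have sg: "(\<not> v * V q (r - 1) * (\<kappa> * s) < 0) \<longleftrightarrow> v \<in> ?S q"
    if "v \<in> {-1, 0, 1}" "q \<in> {r..<n}" for v q
    using last_pos[of q] last_neg[of q] that assms(2,3) by (cases "q < r + k") auto
  have set_eq: "{F. F \<in> loc \<kappa> \<and> (\<forall>q\<in>{r..<n}. \<not> F q * V q (r - 1) * (\<kappa> * s) < 0)} = choices {..<n} ?S"
  proof (intro equalityI subsetI)
    fix F assume F: "F \<in> {F. F \<in> loc \<kappa> \<and> (\<forall>q\<in>{r..<n}. \<not> F q * V q (r - 1) * (\<kappa> * s) < 0)}"
    show "F \<in> choices {..<n} ?S"
      unfolding choices_def
    proof (intro CollectI conjI ballI allI impI)
      fix j assume j: "j \<in> {..<n}"
      show "F j \<in> ?S j"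
      proof (cases "j < r")
        case True
        then show ?thesis using loc_first F by auto
      next
        case False
        then have "F j \<in> {-1, 0, 1}" "j \<in> {r..<n}" using loc_rest[of F \<kappa> j] F j by auto
        then show ?thesis using sg F by blast
      qed
    next
      fix j assume "j \<notin> {..<n}"
      then show "F j = 0" using loc_outside[of F \<kappa> j] F by simp
    qed
  next
    fix F assume F: "F \<in> choices {..<n} ?S"
    have v: "F q \<in> {-1, 0, 1} \<and> F q \<in> ?S q" if "q \<in> {r..<n}" for q
    proof -
      have "q \<in> {..<n}" using that by simp
      then have "F q \<in> ?S q" using F unfolding choices_def by blast
      moreover have "?S q \<subseteq> {-1, 0, 1}" using that by auto
      ultimately show ?thesis by blast
    qed
    have "F \<in> loc \<kappa>"
      unfolding loc_def choices_def
    proof (intro CollectI conjI ballI allI impI)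
      fix j assume j: "j \<in> {..<n}"
      show "F j \<in> (if j < r then {\<kappa> * sgn (circ r p j)} else {-1, 0, 1})"
      proof (cases "j < r")
        case True
        have "F j \<in> ?S j" using F j by (simp add: choices_def)
        then show ?thesis using True by simp
      next
        case False
        then show ?thesis using v[of j] j by simp
      qed
    qed (use F in \<open>simp add: choices_def\<close>)
    moreover have "\<not> F q * V q (r - 1) * (\<kappa> * s) < 0" if "q \<in> {r..<n}" for q
      using sg v[OF that] that by blast
    ultimately show "F \<in> {F. F \<in> loc \<kappa> \<and> (\<forall>q\<in>{r..<n}. \<not> F q * V q (r - 1) * (\<kappa> * s) < 0)}" by blast
  qed
  have n_split: "(\<Prod>j<n. f j) = (\<Prod>j<r. f j) * (\<Prod>j\<in>{r..<n}. f j)" for f :: "nat \<Rightarrow> real"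
    by (metis atLeast0LessThan le_add1 le0 prod.atLeastLessThan_concat)
  have k_split: "(\<Prod>j\<in>{r..<n}. if j < r + k then u else v) = u ^ k * v ^ (N - k)" for u v :: real
  proof -
    have "(\<Prod>j\<in>{r..<n}. if j < r + k then u else v)
        = (\<Prod>j\<in>{r..<r + k}. if j < r + k then u else v) * (\<Prod>j\<in>{r + k..<n}. if j < r + k then u else v)"
      using assms(1) by (intro prod.atLeastLessThan_concat[symmetric]) auto
    also have "(\<Prod>j\<in>{r..<r + k}. if j < r + k then u else v) = u ^ k" by simp
    also have "(\<Prod>j\<in>{r + k..<n}. if j < r + k then u else v) = v ^ (N - k)" by simp
    finally show ?thesis .
  qed
  have "(\<Sum>F\<in>choices {..<n} ?S. \<Prod>j<n. wt x y (F j)) = (\<Prod>j<n. \<Sum>v\<in>?S j. wt x y v)"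
    by (rule sum_choices_prod) simp
  also have "\<dots> = (\<Prod>j<r. \<Sum>v\<in>?S j. wt x y v) * (\<Prod>j\<in>{r..<n}. \<Sum>v\<in>?S j. wt x y v)" by (rule n_split)
  also have "(\<Prod>j<r. \<Sum>v\<in>?S j. wt x y v) = (if \<kappa> = 1 then y ^ p else y ^ (r - p))"
  proof -
    have "(\<Prod>j<r. \<Sum>v\<in>?S j. wt x y v) = (\<Prod>j<r. if (j \<in> {1..p}) = (\<kappa> = 1) then y else 1)"
      using assms(2) p by (intro prod.cong) (auto simp: wt_def circ_def)
    also have "\<dots> = y ^ card ({..<r} \<inter> {j. (j \<in> {1..p}) = (\<kappa> = 1)})"
      by (simp add: prod.If_cases)
    also have "card ({..<r} \<inter> {j. (j \<in> {1..p}) = (\<kappa> = 1)}) = (if \<kappa> = 1 then p else r - p)"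
    proof (cases "\<kappa> = 1")
      case True
      then have "{..<r} \<inter> {j. (j \<in> {1..p}) = (\<kappa> = 1)} = {1..p}" using p by auto
      then show ?thesis using True by simp
    next
      case False
      then have "{..<r} \<inter> {j. (j \<in> {1..p}) = (\<kappa> = 1)} = {..<r} - {1..p}" by auto
      moreover have "card ({..<r} - {1..p}) = r - p" using p by (subst card_Diff_subset) auto
      ultimately show ?thesis using False by simp
    qed
    finally show ?thesis by simp
  qed
  also have "(\<Prod>j\<in>{r..<n}. \<Sum>v\<in>?S j. wt x y v)
      = (if \<kappa> * s = 1 then (x + 1) ^ k * (x + y) ^ (N - k) else (x + y) ^ k * (x + 1) ^ (N - k))"
  proof (cases "\<kappa> * s = 1")
    case True
    then have "(\<Prod>j\<in>{r..<n}. \<Sum>v\<in>?S j. wt x y v) = (\<Prod>j\<in>{r..<n}. if j < r + k then x + 1 else x + y)"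
      by (intro prod.cong) (auto simp: wt_def)
    then show ?thesis unfolding k_split using True by simp
  next
    case False
    then have "(\<Prod>j\<in>{r..<n}. \<Sum>v\<in>?S j. wt x y v) = (\<Prod>j\<in>{r..<n}. if j < r + k then x + y else x + 1)"
      by (intro prod.cong) (auto simp: wt_def)
    then show ?thesis unfolding k_split using False by simp
  qed
  finally show ?thesis unfolding set_eq .
qed

lemma mutation:
  assumes "k \<le> N"
  shows "\<exists>V\<in>V0_set n r. \<exists>W\<in>V0_set n r. fstar n r V = fstar n r W + S_map n r (G0_basis r N p k)"
proof -
  let ?C = "choices {..<n} (\<lambda>_. {-1, 0, 1})"
  let ?A = "\<lambda>t. sgns (deps n r (perturb t))"
  let ?w = "\<lambda>\<kappa> s F. \<exists>q\<in>{r..<n}. F q * V q (r - 1) * (\<kappa> * s) < 0"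
  let ?K = "{1, -1::real}"
  have finC: "finite ?C" by (intro finite_choices) auto
  \<comment> \<open>There are finitely many sign vectors, so a single \<open>t\<close> serves all of
    them on both sides.\<close>
  have "\<forall>\<^sub>F t in at_right 0. \<forall>F\<in>?C - loc 1 - loc (-1). F \<in> ?A (1 * t) \<longleftrightarrow> F \<in> ?A (-1 * t)"
  proof (rule eventually_ball_finite)
    show "\<forall>F\<in>?C - loc 1 - loc (-1). \<forall>\<^sub>F t in at_right 0. F \<in> ?A (1 * t) \<longleftrightarrow> F \<in> ?A (-1 * t)"
    proof
      fix F assume "F \<in> ?C - loc 1 - loc (-1)"
      then have "(\<forall>\<^sub>F t in at 0. F \<in> ?A t) \<or> (\<forall>\<^sub>F t in at 0. F \<notin> ?A t)"
        by (intro nonlocal_stable) auto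
      then show "\<forall>\<^sub>F t in at_right 0. F \<in> ?A (1 * t) \<longleftrightarrow> F \<in> ?A (-1 * t)"
      proof
        assume st: "\<forall>\<^sub>F t in at 0. F \<in> ?A t"
        from st have "\<forall>\<^sub>F t in at_right 0. F \<in> ?A (1 * t)" by (rule eventually_at_right_mult_sign) simp
        moreover from st have "\<forall>\<^sub>F t in at_right 0. F \<in> ?A (-1 * t)" by (rule eventually_at_right_mult_sign) simp
        ultimately show ?thesis by eventually_elim blast
      next
        assume st: "\<forall>\<^sub>F t in at 0. F \<notin> ?A t"
        from st have "\<forall>\<^sub>F t in at_right 0. F \<notin> ?A (1 * t)" by (rule eventually_at_right_mult_sign) simp
        moreover from st have "\<forall>\<^sub>F t in at_right 0. F \<notin> ?A (-1 * t)" by (rule eventually_at_right_mult_sign) simp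
        ultimately show ?thesis by eventually_elim blast
      qed
    qed
  qed (use finC in simp)
  moreover have "\<forall>\<^sub>F t in at_right 0. \<forall>\<kappa>\<in>?K. \<forall>s\<in>?K. \<forall>F\<in>loc \<kappa>. ?w \<kappa> s F \<longrightarrow> F \<in> ?A (s * t)"
  proof (intro eventually_ball_finite ballI)
    fix \<kappa> s F assume *: "\<kappa> \<in> ?K" "s \<in> ?K" "F \<in> loc \<kappa>"
    show "\<forall>\<^sub>F t in at_right 0. ?w \<kappa> s F \<longrightarrow> F \<in> ?A (s * t)"
    proof (cases "?w \<kappa> s F")
      case True
      then obtain q where "q \<in> {r..<n}" "F q * V q (r - 1) * (\<kappa> * s) < 0" by blast
      then have "\<forall>\<^sub>F t in at_right 0. F \<in> ?A (s * t)" by (rule local_sufficient[OF *])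
      then show ?thesis by (rule eventually_mono) simp
    qed simp
  next
    fix \<kappa> assume "\<kappa> \<in> ?K"
    then show "finite (loc \<kappa>)" using loc_subset finC finite_subset by blast
  qed simp_all
  moreover have "\<forall>\<^sub>F t in at_right 0. \<forall>s\<in>?K. general_position n r (perturb (s * t))"
    by (intro eventually_ball_finite ballI eventually_at_right_mult_sign eventually_general_position) auto
  moreover have "\<forall>\<^sub>F t in at_right (0::real). t > 0" by (rule eventually_at_right_less)
  ultimately have "\<forall>\<^sub>F t in at_right 0. (\<forall>F\<in>?C - loc 1 - loc (-1). F \<in> ?A (1 * t) \<longleftrightarrow> F \<in> ?A (-1 * t)) \<and>
     (\<forall>\<kappa>\<in>?K. \<forall>s\<in>?K. \<forall>F\<in>loc \<kappa>. ?w \<kappa> s F \<longrightarrow> F \<in> ?A (s * t)) \<and>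
     (\<forall>s\<in>?K. general_position n r (perturb (s * t))) \<and> t > 0"
    by (intro eventually_conj)
  from eventually_happens'[OF trivial_limit_at_right_real this]
  obtain t where st: "\<forall>F\<in>?C - loc 1 - loc (-1). F \<in> ?A (1 * t) \<longleftrightarrow> F \<in> ?A (-1 * t)"
    and suff: "\<forall>\<kappa>\<in>?K. \<forall>s\<in>?K. \<forall>F\<in>loc \<kappa>. ?w \<kappa> s F \<longrightarrow> F \<in> ?A (s * t)"
    and gp: "\<forall>s\<in>?K. general_position n r (perturb (s * t))" and t: "t > 0"
    by (elim exE conjE) (rule that)
  have u: "uniform_space {..<n} N (deps n r (perturb (s * t)))" if "s \<in> ?K" for s
    using deps_uniform[OF bspec[OF gp that]] by simp
  have sub: "?A (s * t) \<subseteq> ?C" if "s \<in> ?K" for s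
    using uniform_space.sgns_subset[OF u[OF that]] .
  have iff: "F \<in> ?A (s * t) \<longleftrightarrow> ?w \<kappa> s F" if "\<kappa> \<in> ?K" "s \<in> ?K" "F \<in> loc \<kappa>" for \<kappa> s F
    using local_necessary[OF t that] suff that by blast
  have disj: "loc 1 \<inter> loc (-1) = {}"
  proof -
    have False if "F \<in> loc 1" "F \<in> loc (-1)" for F
      using loc_first[OF that(1), of 0] loc_first[OF that(2), of 0] p by (simp add: circ_0)
    then show ?thesis by blast
  qed
  have fin_loc: "finite (loc \<kappa>)" if "\<kappa> \<in> ?K" for \<kappa> using loc_subset[OF that] finC finite_subset by blast
  have "fpoly {..<n} (deps n r (perturb (-1 * t))) x y
      = fpoly {..<n} (deps n r (perturb (1 * t))) x y - gpoly r N (G0_basis r N p k) x y" for x y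
  proof -
    let ?W = "\<lambda>F. \<Prod>j<n. wt x y (F j)"
    \<comment> \<open>Nonlocal vectors and the full local sums are common to both sides; only the
      missing parts differ.\<close>
    have f: "fpoly {..<n} (deps n r (perturb (s * t))) x y = (\<Sum>F\<in>?A (s * t) - (loc 1 \<union> loc (-1)). ?W F)
      + ((\<Sum>F\<in>loc 1. ?W F) - (\<Sum>F | F \<in> loc 1 \<and> (\<forall>q\<in>{r..<n}. \<not> F q * V q (r - 1) * (1 * s) < 0). ?W F))
      + ((\<Sum>F\<in>loc (-1). ?W F) - (\<Sum>F | F \<in> loc (-1) \<and> (\<forall>q\<in>{r..<n}. \<not> F q * V q (r - 1) * (-1 * s) < 0). ?W F))"
      if s: "s \<in> ?K" for s
    proof -
      have finA: "finite (?A (s * t))" using sub[OF s] finC finite_subset by blast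
      have part: "(\<Sum>F\<in>?A (s * t) \<inter> loc \<kappa>. ?W F)
          = (\<Sum>F\<in>loc \<kappa>. ?W F) - (\<Sum>F | F \<in> loc \<kappa> \<and> (\<forall>q\<in>{r..<n}. \<not> F q * V q (r - 1) * (\<kappa> * s) < 0). ?W F)"
        if \<kappa>: "\<kappa> \<in> ?K" for \<kappa>
      proof -
        have "?A (s * t) \<inter> loc \<kappa> = loc \<kappa> - {F. F \<in> loc \<kappa> \<and> (\<forall>q\<in>{r..<n}. \<not> F q * V q (r - 1) * (\<kappa> * s) < 0)}"
          using iff[OF \<kappa> s] by blast
        then show ?thesis using fin_loc[OF \<kappa>] by (simp only:) (subst sum_diff, auto)
      qed
      have "(\<Sum>F\<in>?A (s * t). ?W F) = (\<Sum>F\<in>?A (s * t) - (loc 1 \<union> loc (-1)). ?W F) + (\<Sum>F\<in>?A (s * t) \<inter> (loc 1 \<union> loc (-1)). ?W F)"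
        using finA by (subst sum.Int_Diff[of _ _ "loc 1 \<union> loc (-1)"]) (simp_all add: add.commute)
      also have "(\<Sum>F\<in>?A (s * t) \<inter> (loc 1 \<union> loc (-1)). ?W F)
          = (\<Sum>F\<in>?A (s * t) \<inter> loc 1. ?W F) + (\<Sum>F\<in>?A (s * t) \<inter> loc (-1). ?W F)"
        unfolding Int_Un_distrib using finA disj by (intro sum.union_disjoint) auto
      finally show ?thesis unfolding fpoly_def part[of 1, simplified] part[of "-1", simplified] by simp
    qed
    have K: "1 \<in> ?K" "-1 \<in> ?K" by auto
    have eq: "?A (-1 * t) - (loc 1 \<union> loc (-1)) = ?A (1 * t) - (loc 1 \<union> loc (-1))"
      using st sub[OF K(1)] sub[OF K(2)] by blast
    show ?thesis
      unfolding f[OF K(1)] f[OF K(2)] eq fpoly_loc[OF assms K(1) K(1)] fpoly_loc[OF assms K(1) K(2)]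
        fpoly_loc[OF assms K(2) K(1)] fpoly_loc[OF assms K(2) K(2)]
      using p assms by (simp add: gpoly_G0_basis algebra_simps)
  qed
  then have "fstar n r (perturb (-1 * t)) = fstar n r (perturb (1 * t)) + S_map n r (G0_basis r N p k)"
    using gp by (intro fstar_S_mapI perturb_V0) auto
  moreover have "perturb (-1 * t) \<in> V0_set n r" "perturb (1 * t) \<in> V0_set n r"
    using gp by (auto intro!: perturb_V0)
  ultimately show ?thesis by blast
qed

end

section \<open>The affine hull\<close>

lemma sum_rmat_apply: "(\<Sum>v\<in>A. f v) s t = (\<Sum>v\<in>A. (f v :: rmat) s t)"
  by (induction A rule: infinite_finite_induct) auto

lemma mat_affine_hull_iff:
  "x \<in> mat_affine_hull X \<longleftrightarrow> (\<exists>F u. finite F \<and> F \<noteq> {} \<and> F \<subseteq> X \<and> sum u F = 1 \<and>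
     (\<forall>s t. x s t = (\<Sum>v\<in>F. u v * v s t)))"
  unfolding mat_affine_hull_def by (auto simp: fun_eq_iff sum_rmat_apply mscale_def)

lemma mat_affine_hull_base: "x \<in> X \<Longrightarrow> x \<in> mat_affine_hull X"
  unfolding mat_affine_hull_iff by (intro exI[of _ "{x}"] exI[of _ "\<lambda>_. 1"]) auto

text \<open>The weights change by \<open>c\<close> at \<open>y\<close> and by \<open>- c\<close> at
  \<open>z\<close>, so their sum stays 1.\<close>

lemma mat_affine_hull_step:
  assumes x: "x \<in> mat_affine_hull X" and "y \<in> X" "z \<in> X"
  shows "(\<lambda>s t. x s t + c * (y s t - z s t)) \<in> mat_affine_hull X"
proof -
  obtain F u where F: "finite F" "F \<noteq> {}" "F \<subseteq> X" "sum u F = 1"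
    and eq: "\<And>s t. x s t = (\<Sum>v\<in>F. u v * v s t)"
    using x unfolding mat_affine_hull_iff by blast
  define G where "G = F \<union> {y, z}"
  define w where "w = (\<lambda>v. (if v \<in> F then u v else 0) + c * (of_bool (v = y) - of_bool (v = z)))"
  have fin: "finite G" and GF: "G \<inter> F = F" using F by (auto simp: G_def)
  have w: "(\<Sum>v\<in>G. w v * h v) = (\<Sum>v\<in>F. u v * h v) + c * (h y - h z)" for h
  proof -
    have "(\<Sum>v\<in>G. w v * h v) = (\<Sum>v\<in>G. if v \<in> F then u v * h v else 0)
        + ((\<Sum>v\<in>G. if v = y then c * h v else 0) - (\<Sum>v\<in>G. if v = z then c * h v else 0))"
      unfolding sum_subtractf[symmetric] sum.distrib[symmetric]
      by (rule sum.cong) (auto simp: w_def algebra_simps)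
    also have "(\<Sum>v\<in>G. if v \<in> F then u v * h v else 0) = (\<Sum>v\<in>F. u v * h v)"
      using fin GF by (simp add: sum.inter_restrict[symmetric])
    finally show ?thesis using fin by (simp add: G_def algebra_simps)
  qed
  have "sum w G = 1" using w[of "\<lambda>_. 1"] F by simp
  moreover have "\<forall>s t. x s t + c * (y s t - z s t) = (\<Sum>v\<in>G. w v * v s t)"
    by (simp add: w eq)
  moreover have "G \<noteq> {}" "G \<subseteq> X" using F assms by (auto simp: G_def)
  ultimately show ?thesis unfolding mat_affine_hull_iff using fin by blast
qed

lemma mat_affine_hull_steps:
  assumes "x \<in> mat_affine_hull X" "finite I" "\<And>i. i \<in> I \<Longrightarrow> y i \<in> X \<and> z i \<in> X"
  shows "(\<lambda>s t. x s t + (\<Sum>i\<in>I. c i * (y i s t - z i s t))) \<in> mat_affine_hull X"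
  using assms(2,3)
proof (induction I rule: finite_induct)
  case empty
  then show ?case using assms(1) by simp
next
  case (insert i I)
  have "(\<lambda>s t. (x s t + (\<Sum>i\<in>I. c i * (y i s t - z i s t))) + c i * (y i s t - z i s t)) \<in> mat_affine_hull X"
    using insert by (intro mat_affine_hull_step) auto
  then show ?case using insert.hyps by (simp add: algebra_simps)
qed

abbreviation (input) basis_index :: "nat \<Rightarrow> nat \<Rightarrow> (nat \<times> nat) set" where
  "basis_index n r \<equiv> {1..(r - 1) div 2} \<times> {..<(n - r + 1) div 2}"

lemma basis_mutation:
  assumes "r \<le> n" "i \<in> basis_index n r"
  shows "\<exists>V\<in>V0_set n r. \<exists>W\<in>V0_set n r.
    fstar n r V = fstar n r W + S_map n r (G0_basis r (n - r) (fst i) (snd i))"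
proof -
  have i: "1 \<le> fst i" "fst i < r" "snd i \<le> n - r" using assms(2) by auto
  obtain V where "degenerate_config r (fst i) (snd i) (n - r) V"
    using degenerate_config_exists[OF i(1,2)] by blast
  from degenerate_config.mutation[OF this i(3)] show ?thesis using assms(1) by simp
qed

section \<open>The hull as a translate, and its dimension\<close>

context
  fixes n r :: nat
  assumes r_le: "r \<le> n"
begin

abbreviation (input) "aff_fstar \<equiv> mat_affine_hull (fstar n r ` V0_set n r)"
abbreviation (input) "b \<equiv> \<lambda>i. G0_basis r (n - r) (fst i) (snd i)"

lemma S_map_expansion:
  "g \<in> G0_space n r \<Longrightarrow> S_map n r g = (\<lambda>s t. \<Sum>i\<in>basis_index n r. g (fst i) (snd i) * S_map n r (b i) s t)"
  by (subst G0_expansion) (auto intro: S_map_sum[OF r_le])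

text \<open>Weights of sum 1 keep the base point with coefficient 1. Conversely each basis direction
  is the difference of two generators, so every translate by \<open>S_map n r g\<close> is reached
  in finitely many steps.\<close>

lemma hull_eq:
  assumes V0: "V0 \<in> V0_set n r"
  shows "aff_fstar = {fstar n r V0 + S_map n r g | g. g \<in> G0_space n r}"
proof (intro equalityI subsetI)
  fix x assume "x \<in> aff_fstar"
  then obtain F u where F: "finite F" "F \<subseteq> fstar n r ` V0_set n r" "sum u F = 1"
    and eq: "\<And>s t. x s t = (\<Sum>v\<in>F. u v * v s t)"
    unfolding mat_affine_hull_iff by blast
  have "\<exists>g\<in>G0_space n r. v = fstar n r V0 + S_map n r g" if "v \<in> F" for v
    using F(2) that fstar_difference[OF _ V0 r_le] by blast
  then obtain G where G: "\<And>v. v \<in> F \<Longrightarrow> G v \<in> G0_space n r"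
    "\<And>v. v \<in> F \<Longrightarrow> v = fstar n r V0 + S_map n r (G v)" by metis
  let ?g = "\<lambda>j k. \<Sum>v\<in>F. u v * G v j k"
  have "x = fstar n r V0 + S_map n r ?g"
  proof (rule ext, rule ext)
    fix s t
    have "x s t = (\<Sum>v\<in>F. u v * (fstar n r V0 s t + S_map n r (G v) s t))"
      unfolding eq
    proof (rule sum.cong[OF refl])
      fix v assume "v \<in> F"
      have "v s t = (fstar n r V0 + S_map n r (G v)) s t" using G(2)[OF \<open>v \<in> F\<close>] by (rule arg_cong)
      then show "u v * v s t = u v * (fstar n r V0 s t + S_map n r (G v) s t)" by simp
    qed
    also have "\<dots> = (\<Sum>v\<in>F. u v) * fstar n r V0 s t + (\<Sum>v\<in>F. u v * S_map n r (G v) s t)"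
      by (simp add: algebra_simps sum.distrib sum_distrib_left sum_distrib_right)
    finally show "x s t = (fstar n r V0 + S_map n r ?g) s t"
      using F(3) by (simp add: S_map_sum[OF r_le])
  qed
  then show "x \<in> {fstar n r V0 + S_map n r g | g. g \<in> G0_space n r}"
    using G0_lincomb[of F G, OF G(1)] by blast
next
  fix x assume "x \<in> {fstar n r V0 + S_map n r g | g. g \<in> G0_space n r}"
  then obtain g where g: "g \<in> G0_space n r" and x: "x = fstar n r V0 + S_map n r g" by blast
  obtain V W where VW: "\<And>i. i \<in> basis_index n r \<Longrightarrow> V i \<in> V0_set n r \<and> W i \<in> V0_set n r
     \<and> fstar n r (V i) = fstar n r (W i) + S_map n r (b i)"
    using basis_mutation[OF r_le] by metis
  have "(\<lambda>s t. fstar n r V0 s t + (\<Sum>i\<in>basis_index n r. g (fst i) (snd i) *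
      (fstar n r (V i) s t - fstar n r (W i) s t))) \<in> aff_fstar"
    using VW V0 by (intro mat_affine_hull_steps mat_affine_hull_base) (blast, simp, blast)
  also have "(\<lambda>s t. fstar n r V0 s t + (\<Sum>i\<in>basis_index n r. g (fst i) (snd i) *
      (fstar n r (V i) s t - fstar n r (W i) s t))) = x"
  proof (rule ext, rule ext)
    fix s t
    have "(\<Sum>i\<in>basis_index n r. g (fst i) (snd i) * (fstar n r (V i) s t - fstar n r (W i) s t))
        = (\<Sum>i\<in>basis_index n r. g (fst i) (snd i) * S_map n r (b i) s t)"
      using VW by (intro sum.cong refl) simp
    then show "fstar n r V0 s t + (\<Sum>i\<in>basis_index n r. g (fst i) (snd i) *
      (fstar n r (V i) s t - fstar n r (W i) s t)) = x s t"
      unfolding x S_map_expansion[OF g] by simp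
  qed
  finally show "x \<in> aff_fstar" .
qed

text \<open>Evaluation at the representatives is dual to the basis, because the mirror image of a
  representative is never one. Injectivity and linear independence rest on this.\<close>

lemma basis_at:
  assumes "i \<in> basis_index n r" "i' \<in> basis_index n r"
  shows "b i' (fst i) (snd i) = of_bool (i = i')"
proof -
  have *: "fst i \<le> r" "snd i \<le> n - r" "fst i \<noteq> r - fst i'" "snd i \<noteq> n - r - snd i'"
    using assms by auto
  then show ?thesis by (auto simp: G0_basis_def prod_eq_iff of_bool_def)
qed

lemma basis_mem: "i \<in> basis_index n r \<Longrightarrow> b i \<in> G0_space n r"
  by (intro G0_basis_mem) auto

lemma inj_S_basis: "inj_on (\<lambda>i. S_map n r (b i)) (basis_index n r)"
proof (rule inj_onI)
  fix i i' assume i: "i \<in> basis_index n r" "i' \<in> basis_index n r" and eq: "S_map n r (b i) = S_map n r (b i')"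
  have "S_map n r (\<lambda>j k. b i j k - b i' j k) = (\<lambda>_ _. 0)"
    unfolding S_map_diff[OF r_le] eq by (simp add: fun_eq_iff)
  from S_map_eq_0D[OF r_le this, of "fst i" "snd i"]
  have "b i (fst i) (snd i) - b i' (fst i) (snd i) = 0" using i by auto
  then show "i = i'" using basis_at[OF i(1) i(1)] basis_at[OF i] by (simp split: if_splits)
qed

lemma mat_aff_dim_hull: "mat_aff_dim aff_fstar = (r - 1) div 2 * ((n - r + 1) div 2)"
proof -
  interpret ms: vector_space mscale
    by unfold_locales (auto simp: mscale_def fun_eq_iff algebra_simps)
  let ?I = "basis_index n r" and ?D = "{x - y | x y. x \<in> aff_fstar \<and> y \<in> aff_fstar}"
  have card_I: "card ?I = (r - 1) div 2 * ((n - r + 1) div 2)" by simp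
  show ?thesis
  \<comment> \<open>Without configurations the hull is empty. Any basis index would supply a
    configuration, so the index set is then empty as well and both sides are 0.\<close>
  proof (cases "V0_set n r = {}")
    case True
    then have "?I = {}" using basis_mutation[OF r_le] by blast
    then have "card ?I = 0" by simp
    moreover have D: "?D = {}" using True by (auto simp: mat_affine_hull_iff)
    moreover have "ms.dim {} = 0" by (rule ms.dim_unique[of "{}"]) (auto simp: ms.independent_empty)
    ultimately show ?thesis unfolding mat_aff_dim_def D card_I by simp
  next
    case False
    then obtain V0 where V0: "V0 \<in> V0_set n r" by blast
    \<comment> \<open>The base point cancels in differences, which leaves the linear image of
      \<open>G0_space\<close>.\<close>
    have D: "?D = S_map n r ` G0_space n r"
    proof (intro equalityI subsetI)
      fix d assume "d \<in> ?D"
      then obtain g h where gh: "g \<in> G0_space n r" "h \<in> G0_space n r"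
        "d = (fstar n r V0 + S_map n r g) - (fstar n r V0 + S_map n r h)"
        unfolding hull_eq[OF V0] by blast
      have "d = S_map n r (\<lambda>j k. g j k - h j k)" unfolding gh(3) S_map_diff[OF r_le] by simp
      moreover have "(\<lambda>j k. g j k - h j k) \<in> G0_space n r"
        using G0_lincomb[of UNIV "\<lambda>b. if b then g else h" n r "\<lambda>b. if b then 1 else -1"] gh
        by (simp add: UNIV_bool)
      ultimately show "d \<in> S_map n r ` G0_space n r" by blast
    next
      fix d assume "d \<in> S_map n r ` G0_space n r"
      then obtain g where g: "g \<in> G0_space n r" "d = S_map n r g" by blast
      have "fstar n r V0 + S_map n r g \<in> aff_fstar" using g hull_eq[OF V0] by blast
      moreover have "fstar n r V0 \<in> aff_fstar" using V0 by (intro mat_affine_hull_base) auto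
      moreover have "d = (fstar n r V0 + S_map n r g) - fstar n r V0" using g by simp
      ultimately show "d \<in> ?D" by blast
    qed
    let ?B = "(\<lambda>i. S_map n r (b i)) ` ?I"
    have "ms.dim ?D = card ?I"
      unfolding D
    proof (rule ms.dim_unique)
      show "?B \<subseteq> S_map n r ` G0_space n r" using basis_mem by blast
      show "card ?B = card ?I" by (rule card_image[OF inj_S_basis])
      show "S_map n r ` G0_space n r \<subseteq> ms.span ?B"
      proof
        fix d assume "d \<in> S_map n r ` G0_space n r"
        then obtain g where g: "g \<in> G0_space n r" "d = S_map n r g" by blast
        have "d = (\<Sum>i\<in>?I. mscale (g (fst i) (snd i)) (S_map n r (b i)))"
          unfolding g(2) S_map_expansion[OF g(1)] by (simp add: fun_eq_iff sum_rmat_apply mscale_def)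
        moreover have "\<dots> \<in> ms.span ?B" by (intro ms.span_sum ms.span_scale ms.span_base imageI)
        ultimately show "d \<in> ms.span ?B" by (simp only:)
      qed
      show "ms.independent ?B"
      proof (rule ms.independent_if_scalars_zero)
        fix u x assume u: "(\<Sum>x\<in>?B. mscale (u x) x) = 0" and x: "x \<in> ?B"
        then obtain i where i: "i \<in> ?I" "x = S_map n r (b i)" by blast
        let ?g = "\<lambda>j k. \<Sum>i\<in>?I. u (S_map n r (b i)) * b i j k"
        have "S_map n r ?g s t = (\<Sum>x\<in>?B. mscale (u x) x) s t" for s t
          unfolding sum.reindex[OF inj_S_basis] S_map_sum[OF r_le]
          by (simp add: sum_rmat_apply mscale_def)
        then have "S_map n r ?g = (\<lambda>_ _. 0)" unfolding u by (simp add: fun_eq_iff)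
        from S_map_eq_0D[OF r_le this, of "fst i" "snd i"]
        have "(\<Sum>i'\<in>?I. u (S_map n r (b i')) * b i' (fst i) (snd i)) = 0" using i by auto
        also have "(\<Sum>i'\<in>?I. u (S_map n r (b i')) * b i' (fst i) (snd i))
            = (\<Sum>i'\<in>?I. if i' = i then u (S_map n r (b i')) else 0)"
          by (rule sum.cong) (auto simp: basis_at[OF i(1)] simp del: mem_Sigma_iff)
        finally show "u x = 0" using i by (simp del: mem_Sigma_iff)
      qed simp
    qed
    then show ?thesis unfolding mat_aff_dim_def card_I .
  qed
qed

end

theorem theorem1p14:
  fixes n r :: nat
  assumes "1 \<le> r" and "r \<le> n"
  shows "mat_aff_dim (mat_affine_hull (fstar n r ` V0_set n r))
           = ((r - 1) div 2) * ((n - r + 1) div 2)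
       \<and> (\<forall>V0 \<in> V0_set n r.
            mat_affine_hull (fstar n r ` V0_set n r)
              = {fstar n r V0 + S_map n r g | g. g \<in> G0_space n r})"
  using mat_aff_dim_hull[OF assms(2)] hull_eq[OF assms(2)] by blast

unused_thms

end
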